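(* Let $\varphi=\frac12+\frac{\sqrt5}{2}$ and $\bar\varphi=\frac12-\frac{\sqrt5}{2}$. Let $A$ be a maximal indecomposable cyclotomic matrix over the ring $\mathbb{Z}[\varphi]$ which is not a matrix over $\mathbb{Z}$. Then $A$ is equivalent to the adjacency matrix of one of the following weighted graphs (all unlisted edge weights and charges are $0$): (1) $S_3$: vertices $a,b,c$ with charges $\varphi,\bar\varphi,1$; edges $ac$ of weight $\bar\varphi$, $cb$ of weight $\varphi$, $ab$ of weight $1$. (2) $S_4^{(1,\varphi)}$: vertices $a,b,c,d$ with charges $1,-1,-1,1$; edges $ab$ of weight $\varphi$, $ac$ of weight $\bar\varphi$, $bd$ of weight $\bar\varphi$, $cd$ of weight $-\varphi$. (3) $S_4^{(2,\varphi)}$: vertices $a,b,c,d$ with charges $\varphi,-\varphi,-\varphi,\varphi$; edges $ac$ and $bd$ of weight $\bar\varphi$, $ab$ of weight $1$, $cd$ of weight $-1$. (4) $S_4^{(3,\varphi)}$: vertices $a,b,c,d$ with charges $0,\varphi,\bar\varphi,-1$; edges $ab$ of weight $\bar\varphi$, $ac$ of weight $\varphi$, and $bd$, $cd$, $ad$ of weight $1$. (5) $S_6$: vertices $a,b,c,d,e,f$, all uncharged; edges $ab$, $cd$, $ef$ of weight $\varphi$, $be$, $ad$, $cf$ of weight $\bar\varphi$, and $bc$, $de$, $af$ of weight $1$. (6) $S_8^{\dag\dag}$: vertices $a,\dots,h$, all uncharged; edges $ab$, $ef$, $gh$ of weight $\bar\varphi$, $cd$ of weight $-\bar\varphi$,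 $cg$, $ae$, $dh$ of weight $\varphi$, $bf$ of weight $-\varphi$, $bd$, $fh$, $ac$ of weight $1$, and $eg$ of weight $-1$. (7) $S_8^\ddag$: vertices $a,\dots,h$, all uncharged; edges $ab$, $cg$, $fh$ of weight $\varphi$, $bf$, $gh$, $ac$ of weight $\bar\varphi$, $ef$, $cd$, $bd$, $eg$, $ae$, $dh$ of weight $1$, and $de$ of weight $-1$. Moreover, every indecomposable cyclotomic $\mathbb{Z}[\varphi]$-matrix is contained (as a principal submatrix) in a maximal one.
   Context: A real symmetric matrix $A$ is cyclotomic if its characteristic polynomial $\det(xI-A)$ has integer coefficients and all its eigenvalues lie in $[-2,2]$. A square matrix is indecomposable if it is not equivalent (in the sense below) to a block diagonal matrix with more than one block, equivalently its underlying graph (vertices $u\neq v$ adjacent iff $a_{uv}\ne0$) is connected. A maximal indecomposable cyclotomic matrix over a ring $T$ is an indecomposable cyclotomic $T$-matrix that is not a proper principal submatrix of any indecomposable cyclotomic $T$-matrix. Equivalence: with $K=\mathbb{Q}(\sqrt5)$, $A$ is strongly equivalent to $B$ if $A=\sigma(QBQ^\top)$ for some $Q\in O_n(\mathbb{Z})$ (signed permutation matrix) and some $\sigma\in\operatorname{Gal}(K/\mathbb{Q})$ applied entrywise; $A$ and $B$ are equivalent if $A$ is strongly equivalent to $B$ or to $-B$. The adjacency matrix of a weighted graph has $(u,v)$ entry the weight of edge $uv$ (zero if absent) and $(v,v)$ entry the charge of $v$. *)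

theory Defs
  imports "Jordan_Normal_Form.Char_Poly" "HOL-Computational_Algebra.Polynomial"
begin

definition phi :: real where "phi = 1/2 + sqrt 5 / 2"
definition phibar :: real where "phibar = 1/2 - sqrt 5 / 2"

definition Zring :: "real set" where "Zring = {x. \<exists>a::int. x = of_int a}"
definition Zphi :: "real set" where
  "Zphi = {x. \<exists>a b::int. x = of_int a + of_int b * phi}"

text \<open>The nontrivial automorphism of K = Q(sqrt 5), p + q sqrt 5 to p - q sqrt 5
  (only ever applied to elements of K).\<close>
definition galconj :: "real \<Rightarrow> real" where
  "galconj x = (THE y. \<exists>p q::rat. x = of_rat p + of_rat q * sqrt 5 \<and> y = of_rat p - of_rat q * sqrt 5)"

definition matrix_over :: "real set \<Rightarrow> real mat \<Rightarrow> bool" where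
  "matrix_over T A \<longleftrightarrow> dim_row A = dim_col A \<and>
     (\<forall>i < dim_row A. \<forall>j < dim_col A. A $$ (i,j) \<in> T)"

definition cyclotomic :: "real mat \<Rightarrow> bool" where
  "cyclotomic A \<longleftrightarrow> dim_row A = dim_col A \<and> A = transpose_mat A \<and>
     (\<forall>i. coeff (char_poly A) i \<in> \<int>) \<and>
     (\<forall>z. eigenvalue (map_mat complex_of_real A) z \<longrightarrow>
          z \<in> \<real> \<and> -2 \<le> Re z \<and> Re z \<le> 2)"

definition indecomposable :: "real mat \<Rightarrow> bool" where
  "indecomposable A \<longleftrightarrow> dim_row A = dim_col A \<and> 0 < dim_row A \<and>
     (\<forall>i < dim_row A. \<forall>j < dim_row A.
        (\<lambda>u v. u < dim_row A \<and> v < dim_row A \<and> u \<noteq> v \<and> A $$ (u,v) \<noteq> 0)\<^sup>*\<^sup>* i j)"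

definition principal_submatrix :: "real mat \<Rightarrow> real mat \<Rightarrow> bool" where
  "principal_submatrix A B \<longleftrightarrow> dim_row A = dim_col A \<and> dim_row B = dim_col B \<and>
     (\<exists>f. inj_on f {..<dim_row A} \<and> f ` {..<dim_row A} \<subseteq> {..<dim_row B} \<and>
          (\<forall>i < dim_row A. \<forall>j < dim_row A. A $$ (i,j) = B $$ (f i, f j)))"

definition proper_principal_submatrix :: "real mat \<Rightarrow> real mat \<Rightarrow> bool" where
  "proper_principal_submatrix A B \<longleftrightarrow> principal_submatrix A B \<and> dim_row A < dim_row B"

definition maximal_indecomposable_cyclotomic :: "real set \<Rightarrow> real mat \<Rightarrow> bool" where
  "maximal_indecomposable_cyclotomic T A \<longleftrightarrow>
     matrix_over T A \<and> indecomposable A \<and> cyclotomic A \<and>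
     \<not> (\<exists>B. matrix_over T B \<and> indecomposable B \<and> cyclotomic B \<and>
            proper_principal_submatrix A B)"

text \<open>O_n(Z): integer orthogonal matrices (= signed permutation matrices).\<close>
definition orth_int :: "nat \<Rightarrow> real mat \<Rightarrow> bool" where
  "orth_int n Q \<longleftrightarrow> Q \<in> carrier_mat n n \<and> (\<forall>i<n. \<forall>j<n. Q $$ (i,j) \<in> \<int>) \<and>
     Q * transpose_mat Q = 1\<^sub>m n"

definition strongly_equivalent :: "real mat \<Rightarrow> real mat \<Rightarrow> bool" where
  "strongly_equivalent A B \<longleftrightarrow> (\<exists>n Q \<sigma>. A \<in> carrier_mat n n \<and> B \<in> carrier_mat n n \<and>
     orth_int n Q \<and> (\<sigma> = id \<or> \<sigma> = galconj) \<and>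
     A = map_mat \<sigma> (Q * B * transpose_mat Q))"

definition equivalent :: "real mat \<Rightarrow> real mat \<Rightarrow> bool" where
  "equivalent A B \<longleftrightarrow> strongly_equivalent A B \<or> strongly_equivalent A (- B)"

definition wgraph :: "real list \<Rightarrow> (nat \<times> nat \<times> real) list \<Rightarrow> real mat" where
  "wgraph cs es = mat (length cs) (length cs) (\<lambda>(i,j).
     if i = j then cs ! i
     else sum_list (map (\<lambda>(u,v,w). if (u = i \<and> v = j) \<or> (u = j \<and> v = i) then w else 0) es))"

text \<open>Vertices a,b,c,... are numbered 0,1,2,...\<close>
definition S3 :: "real mat" where
  "S3 = wgraph [phi, phibar, 1] [(0,2,phibar), (2,1,phi), (0,1,1)]"

definition S4_1 :: "real mat" where
  "S4_1 = wgraph [1, -1, -1, 1] [(0,1,phi), (0,2,phibar), (1,3,phibar), (2,3,-phi)]"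

definition S4_2 :: "real mat" where
  "S4_2 = wgraph [phi, -phi, -phi, phi] [(0,2,phibar), (1,3,phibar), (0,1,1), (2,3,-1)]"

definition S4_3 :: "real mat" where
  "S4_3 = wgraph [0, phi, phibar, -1] [(0,1,phibar), (0,2,phi), (1,3,1), (2,3,1), (0,3,1)]"

definition S6 :: "real mat" where
  "S6 = wgraph [0,0,0,0,0,0]
     [(0,1,phi), (2,3,phi), (4,5,phi), (1,4,phibar), (0,3,phibar), (2,5,phibar),
      (1,2,1), (3,4,1), (0,5,1)]"

definition S8_dagdag :: "real mat" where
  "S8_dagdag = wgraph [0,0,0,0,0,0,0,0]
     [(0,1,phibar), (4,5,phibar), (6,7,phibar), (2,3,-phibar),
      (2,6,phi), (0,4,phi), (3,7,phi), (1,5,-phi),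
      (1,3,1), (5,7,1), (0,2,1), (4,6,-1)]"

definition S8_ddag :: "real mat" where
  "S8_ddag = wgraph [0,0,0,0,0,0,0,0]
     [(0,1,phi), (2,6,phi), (5,7,phi), (1,5,phibar), (6,7,phibar), (0,2,phibar),
      (4,5,1), (2,3,1), (1,3,1), (4,6,1), (0,4,1), (3,7,1), (3,4,-1)]"

end

theory Submission
  imports Defs "HOL-Analysis.Function_Topology"
begin

text \<open>An integral characteristic polynomial is shared by a cyclotomic matrix and its conjugate, so
  both have operator norm at most 2; conversely a symmetric matrix with square 4 is cyclotomic, and
  maximal once it is connected, because its rows already have the largest possible norm.

  Irrational matrices are grown one vertex at a time from an irrational charge or edge. Row norms
  leave finitely many candidate rows, the wrong ones are unmasked by iterating the matrix on the
  new basis vector, and what survives is always a signed minor of one of the seven graphs, all of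
  which have square 4.

  For an integral matrix $A$ with arbitrarily large extensions, the extensions contain arbitrarily
  long geodesics leaving $A$. These carry no charges away from their ends, so in the limit
  $2 \pm R - e e^T$ is positive semidefinite for a neighbourhood $R$ of $A$ and its end vertex $e$.
  More generally, $2 \pm R - a a^T \ge 0$ with $a$ integral forces $a$ to be supported on at most
  two vertices, and deleting them reproduces the same situation one level further in. Reading this
  backwards completes $R$ to a matrix with square 4.\<close>

section \<open>The ring $\mathbf{Z}[\varphi]$ and its two embeddings\<close>

text \<open>The integral case cannot be reduced to a finite list: indecomposable integral square
  roots of 4 exist in arbitrarily large sizes. Hence that case constructs a completion without
  classifying anything. The term \<open>e e^T\<close> is a Schur complement. Eliminating an
  uncharged path of \<open>k\<close> further vertices with edges 1 or -1 from \<open>2 + M\<close>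
  or \<open>2 - M\<close> subtracts \<open>k / (k + 1)\<close> at the vertex where it is attached,
  for both signs alike, and this tends to 1; the half-infinite path solves
  \<open>x = 1 / (2 - x)\<close>. The peeling of pairs is elimination as well. If the integral
  vector \<open>a\<close> has square sum 2, both forms vanish at \<open>a\<close>, so
  \<open>M a = 0\<close>. As \<open>a\<close> is supported on two vertices with values 1 or -1,
  their columns agree up to sign: they are twins. Eliminating an uncharged pair of twins leaves
  \<open>2 + M - b b^T\<close> and \<open>2 - M - b b^T\<close> on the rest, where \<open>b\<close>
  is the row of one twin. Square sum 1 is raised to 2 by adding a twin by hand, and square sum 0 or
  a charged pair ends the descent.\<close>

text \<open>\<open>ZP a b\<close> stands for $a + b\varphi$.\<close>
datatype zphi = ZP int int

instantiation zphi :: comm_ring_1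
begin
fun plus_zphi where "ZP a b + ZP c d = ZP (a + c) (b + d)"
fun minus_zphi where "ZP a b - ZP c d = ZP (a - c) (b - d)"
fun uminus_zphi where "- ZP a b = ZP (- a) (- b)"
fun times_zphi where "ZP a b * ZP c d = ZP (a * c + b * d) (a * d + b * c + b * d)"
definition "0 = ZP 0 0"
definition "1 = ZP 1 0"
instance
proof
  fix x y z :: zphi
  show "x * y * z = x * (y * z)" by (cases x; cases y; cases z) (simp add: algebra_simps)
  show "x * y = y * x" by (cases x; cases y) (simp add: algebra_simps)
  show "1 * x = x" by (cases x) (simp add: one_zphi_def)
  show "x + y + z = x + (y + z)" by (cases x; cases y; cases z) simp
  show "x + y = y + x" by (cases x; cases y) simp
  show "0 + x = x" by (cases x) (simp add: zero_zphi_def)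
  show "- x + x = 0" by (cases x) (simp add: zero_zphi_def)
  show "x - y = x + - y" by (cases x; cases y) simp
  show "(x + y) * z = x * z + y * z" by (cases x; cases y; cases z) (simp add: algebra_simps)
  show "(0::zphi) \<noteq> 1" by (simp add: zero_zphi_def one_zphi_def)
qed
end

fun zcnj :: "zphi \<Rightarrow> zphi" where "zcnj (ZP a b) = ZP (a + b) (- b)"

definition twist :: "bool \<Rightarrow> bool \<Rightarrow> zphi \<Rightarrow> zphi" where
  "twist cj ng z = (let y = (if cj then zcnj z else z) in if ng then - y else y)"

text \<open>Total nonnegativity, read off trace and norm.\<close>
fun tnn :: "zphi \<Rightarrow> bool" where
  "tnn (ZP a b) \<longleftrightarrow> 0 \<le> 2 * a + b \<and> 0 \<le> a * a + a * b - b * b"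

section \<open>Enumerating and testing one-vertex extensions\<close>

fun dot :: "zphi list \<Rightarrow> zphi list \<Rightarrow> zphi" where
  "dot (x # xs) (y # ys) = x * y + dot xs ys"
| "dot _ _ = 0"

text \<open>One representative of each pair \<open>e\<close>, \<open>-e\<close> among the ring
  elements whose conjugates both lie in [-2, 2]; \<open>in_entries\<close> shows that the nine
  elements of \<open>entries\<close> exhaust them.\<close>

definition entries_pos :: "zphi list" where
  "entries_pos = [ZP 0 0, ZP 1 0, ZP 0 1, ZP 1 (-1), ZP 2 0]"
definition entries :: "zphi list" where
  "entries = [ZP 0 0, ZP 1 0, ZP (-1) 0, ZP 0 1, ZP 0 (-1), ZP 1 (-1), ZP (-1) 1, ZP 2 0, ZP (-2) 0]"

text \<open>The nonzero rows, up to sign, that fit below the row norms still available in \<open>ds\<close> and \<open>s\<close>;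
  the flag records whether the sign has already been fixed by an earlier nonzero entry.\<close>
fun rows_within :: "bool \<Rightarrow> zphi list \<Rightarrow> zphi \<Rightarrow> zphi list list" where
  "rows_within nz [] s = (if nz then [[]] else [])"
| "rows_within nz (d # ds) s = concat (map (\<lambda>e. let q = e * e in
     if tnn (d - q) \<and> tnn (s - q) then map ((#) e) (rows_within (nz \<or> e \<noteq> ZP 0 0) ds (s - q)) else [])
     (if nz then entries else entries_pos))"

text \<open>Unnormalised power iteration, with the squared norm \<open>m\<close> carried along and
  both embeddings tested at once by \<open>tnn\<close>. For symmetric \<open>B\<close> the
  successive norm ratios never decrease, by Cauchy-Schwarz, so each further step is a sharper test.
  The unit list is a step counter for structural recursion.\<close>

fun contracting :: "unit list \<Rightarrow> zphi list list \<Rightarrow> zphi list \<Rightarrow> zphi \<Rightarrow> bool" where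
  "contracting [] B v m = True"
| "contracting (_ # k) B v m =
     (let w = map (\<lambda>r. dot r v) B; t = dot w w in tnn (ZP 4 0 * m - t) \<and> contracting k B w t)"

text \<open>Ten steps of the iteration are just enough to refute every bad one-vertex extension
  occurring in the classification.\<close>
definition admissible :: "zphi list list \<Rightarrow> bool" where
  "admissible B = contracting [(),(),(),(),(),(),(),(),(),()] B
     (ZP 1 0 # map (\<lambda>_. ZP 0 0) (tl B)) (ZP 1 0)"

definition bordered :: "zphi \<Rightarrow> zphi list \<Rightarrow> zphi list list \<Rightarrow> zphi list list" where
  "bordered c x R = (c # x) # map2 (#) x R"

text \<open>\<open>D\<close> is what each old row may still spend of its squared norm 4, and
  \<open>s\<close> what is left for the new row after its charge.\<close>

definition extensions :: "zphi list list \<Rightarrow> zphi list list list" where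
  "extensions R = (let D = map (\<lambda>r. ZP 4 0 - dot r r) R in
     concat (map (\<lambda>c. let s = ZP 4 0 - c * c in
       if tnn s then map (\<lambda>x. bordered c x R) (rows_within False D s) else []) entries))"

section \<open>Irrationality of sqrt 5, conjugation and total nonnegativity\<close>

lemma sqrt5_irrational: "sqrt 5 \<notin> \<rat>"
proof
  assume "sqrt 5 \<in> \<rat>"
  then obtain a b :: int where b: "b > 0" and ab: "coprime a b" "sqrt 5 = of_int a / of_int b"
    by (metis Rats_cases')
  have "(sqrt 5)\<^sup>2 * (of_int b)\<^sup>2 = (of_int a :: real)\<^sup>2"
    using ab b by (simp add: power_divide)
  then have "of_int (5 * b\<^sup>2) = (of_int (a\<^sup>2) :: real)" by simp
  then have eq: "5 * b\<^sup>2 = a\<^sup>2" using of_int_eq_iff by blast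
  have "prime (5::int)" by simp
  with eq have "5 dvd a" by (metis dvd_triv_left prime_dvd_power)
  then obtain c where "a = 5 * c" by blast
  with eq have "b\<^sup>2 = 5 * c\<^sup>2" by (simp add: power2_eq_square)
  with \<open>prime 5\<close> have "5 dvd b" by (metis dvd_triv_left prime_dvd_power)
  with \<open>5 dvd a\<close> ab(1) show False using coprime_common_divisor by fastforce
qed

lemma phi_squared: "phi * phi = phi + 1" and phibar_squared: "phibar * phibar = phibar + 1"
  by (simp_all add: phi_def phibar_def field_simps)

fun emb :: "bool \<Rightarrow> zphi \<Rightarrow> real" where
  "emb c (ZP a b) = of_int a + of_int b * (if c then phibar else phi)"

lemma emb_simps [simp]:
  "emb c 0 = 0" "emb c 1 = 1" "emb c (x + y) = emb c x + emb c y" "emb c (x - y) = emb c x - emb c y"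
  "emb c (- x) = - emb c x" "emb c (x * y) = emb c x * emb c y" "emb c (zcnj x) = emb (\<not> c) x"
proof -
  show "emb c 0 = 0" "emb c 1 = 1" by (simp_all add: zero_zphi_def one_zphi_def)
  show "emb c (x + y) = emb c x + emb c y" "emb c (x - y) = emb c x - emb c y" "emb c (- x) = - emb c x"
    by (cases x; cases y; simp add: algebra_simps)+
  have "of_int (p * r + q * s) + of_int (p * s + q * r + q * s) * t
      = (of_int p + of_int q * t) * (of_int r + of_int s * t)"
    if "t * t = t + 1" for t :: real and p q r s :: int
  proof -
    have "of_int q * of_int s * (t * t) = of_int q * of_int s * (t + 1)" using that by simp
    then show ?thesis by (simp add: algebra_simps)
  qed
  then show "emb c (x * y) = emb c x * emb c y"
    using phi_squared phibar_squared by (cases x; cases y) simp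
  show "emb c (zcnj x) = emb (\<not> c) x"
    by (cases x) (simp add: phi_def phibar_def algebra_simps)
qed

interpretation emb: comm_ring_hom "emb c" for c by standard simp_all

lemma emb_False_eq_of_int:
  assumes "emb False (ZP a b) = of_int n" shows "b = 0"
proof (rule ccontr)
  assume "b \<noteq> 0"
  have "sqrt 5 = of_int (2 * n - 2 * a - b) / of_int b"
    using assms \<open>b \<noteq> 0\<close> by (simp add: phi_def field_simps)
  then have "sqrt 5 \<in> \<rat>" by (metis Rats_divide Rats_of_int)
  with sqrt5_irrational show False ..
qed

lemma emb_False_inj: "emb False x = emb False y \<longleftrightarrow> x = y"
proof
  assume "emb False x = emb False y"
  then have e: "emb False (x - y) = of_int 0" by simp
  obtain a b where ab: "x - y = ZP a b" by (cases "x - y")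
  then have "b = 0" using e emb_False_eq_of_int by metis
  then have "x - y = 0" using e ab by (simp add: zero_zphi_def)
  then show "x = y" by simp
qed simp

lemma emb_eq_0_iff [simp]: "emb c x = 0 \<longleftrightarrow> x = 0"
proof
  have *: "emb False y = 0 \<Longrightarrow> y = 0" for y using emb_False_inj[of y 0] by simp
  assume "emb c x = 0"
  then have "emb False x = 0 \<or> emb False (zcnj x) = 0" by (cases c) simp_all
  then have "x = 0 \<or> zcnj x = 0" using * by blast
  then show "x = 0" by (cases x) (auto simp: zero_zphi_def)
qed simp

lemma Zphi_eq_range: "Zphi = range (emb False)"
proof (intro equalityI subsetI)
  fix x assume "x \<in> Zphi"
  then obtain a b where "x = emb False (ZP a b)" unfolding Zphi_def by auto
  then show "x \<in> range (emb False)" by blast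
next
  fix x assume "x \<in> range (emb False)"
  then obtain y where "x = emb False y" by blast
  then show "x \<in> Zphi" unfolding Zphi_def by (cases y) auto
qed

lemma emb_int_conj:
  assumes "emb False x \<in> \<int>" shows "emb True x = emb False x"
proof -
  obtain a b where x: "x = ZP a b" by (cases x)
  from assms obtain n where "emb False x = of_int n" by (auto elim: Ints_cases)
  then have "b = 0" using emb_False_eq_of_int unfolding x by blast
  then show ?thesis by (simp add: x)
qed

text \<open>\<open>galconj\<close> is a definite description, so the irrationality of sqrt 5 enters
  as the uniqueness of the coefficients.\<close>

lemma galconj_emb: "galconj (emb False x) = emb True x"
  unfolding galconj_def
proof (rule the_equality)
  obtain a b where x: "x = ZP a b" by (cases x)
  define p q :: rat where "p = of_int a + of_int b / 2" and "q = of_int b / 2"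
  have px: "emb False x = of_rat p + of_rat q * sqrt 5" and py: "emb True x = of_rat p - of_rat q * sqrt 5"
    unfolding p_def q_def of_rat_add of_rat_divide
    by (simp_all add: x phi_def phibar_def algebra_simps)
  then show "\<exists>p q. emb False x = of_rat p + of_rat q * sqrt 5 \<and> emb True x = of_rat p - of_rat q * sqrt 5"
    by blast
  fix y
  assume "\<exists>p q. emb False x = of_rat p + of_rat q * sqrt 5 \<and> y = of_rat p - of_rat q * sqrt 5"
  then obtain p' q' where p': "emb False x = of_rat p' + of_rat q' * sqrt 5"
    and y: "y = of_rat p' - of_rat q' * sqrt 5" by blast
  have "q' = q"
  proof (rule ccontr)
    assume "q' \<noteq> q"
    then have ne: "of_rat (q' - q) \<noteq> (0::real)" by simp
    have "of_rat (q' - q) * sqrt 5 = (of_rat (p - p') :: real)"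
      using px p' by (simp add: of_rat_diff algebra_simps)
    then have "sqrt 5 = of_rat ((p - p') / (q' - q))"
      using ne by (simp add: of_rat_divide field_simps)
    then show False using sqrt5_irrational by simp
  qed
  then show "y = emb True x" using px py p' y by simp
qed

text \<open>Two reals are both nonnegative iff their sum and their product are; here these are
  integers.\<close>

lemma tnn_iff: "tnn x \<longleftrightarrow> 0 \<le> emb False x \<and> 0 \<le> emb True x"
proof -
  obtain a b where x: "x = ZP a b" by (cases x)
  let ?u = "emb False x" and ?v = "emb True x"
  have s: "?u + ?v = of_int (2 * a + b)" and p: "?u * ?v = of_int (a * a + a * b - b * b)"
    by (simp_all add: x phi_def phibar_def algebra_simps)
  have "tnn x \<longleftrightarrow> 0 \<le> ?u + ?v \<and> 0 \<le> ?u * ?v"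
    unfolding s p by (simp only: of_int_0_le_iff x tnn.simps)
  also have "\<dots> \<longleftrightarrow> 0 \<le> ?u \<and> 0 \<le> ?v" by (auto simp: zero_le_mult_iff)
  finally show ?thesis .
qed

lemma in_entries:
  assumes "(emb False x)\<^sup>2 \<le> 4" "(emb True x)\<^sup>2 \<le> 4" shows "x \<in> set entries"
proof -
  obtain a b where x: "x = ZP a b" by (cases x)
  have "(emb False x)\<^sup>2 + (emb True x)\<^sup>2 = of_int (2 * a\<^sup>2 + 2 * a * b + 3 * b\<^sup>2)"
    by (simp add: x phi_def phibar_def power2_eq_square algebra_simps)
  then have "(of_int (2 * a\<^sup>2 + 2 * a * b + 3 * b\<^sup>2) :: real) \<le> of_int 8" using assms by linarith
  then have le: "2 * a\<^sup>2 + 2 * a * b + 3 * b\<^sup>2 \<le> 8" by (simp only: of_int_le_iff)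
  \<comment> \<open>Twice and three times the bound, with the square completed in \<open>a\<close>
    and in \<open>b\<close> respectively.\<close>
  have "(2 * a + b)\<^sup>2 + 5 * b\<^sup>2 \<le> 16" "5 * a\<^sup>2 + (a + 3 * b)\<^sup>2 \<le> 24"
    using le by (auto simp: power2_eq_square algebra_simps)
  then have "b\<^sup>2 \<le> 3" "a\<^sup>2 \<le> 4"
    using zero_le_power2[of "2 * a + b"] zero_le_power2[of "a + 3 * b"] by linarith+
  then have "\<bar>b\<bar> < 2" "\<bar>a\<bar> < 3"
    using abs_le_square_iff[of 2 b] abs_le_square_iff[of 3 a] by auto
  then have "a \<in> {-2,-1,0,1,2}" "b \<in> {-1,0,1}" by auto
  moreover have "tnn (ZP 4 0 - x * x)"
    unfolding tnn_iff using assms by (simp add: power2_eq_square)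
  ultimately show ?thesis unfolding x by (elim insertE emptyE) (simp_all add: entries_def)
qed

section \<open>Symmetric contractions and their eigenvectors\<close>

definition apply_on :: "'a set \<Rightarrow> ('a \<Rightarrow> 'a \<Rightarrow> real) \<Rightarrow> ('a \<Rightarrow> real) \<Rightarrow> 'a \<Rightarrow> real" where
  "apply_on V M y i = (\<Sum>j\<in>V. M i j * y j)"

definition contractive :: "'a set \<Rightarrow> ('a \<Rightarrow> 'a \<Rightarrow> real) \<Rightarrow> bool" where
  "contractive V M \<longleftrightarrow> (\<forall>y. (\<Sum>i\<in>V. (apply_on V M y i)\<^sup>2) \<le> 4 * (\<Sum>i\<in>V. (y i)\<^sup>2))"

lemma apply_on_add: "apply_on V M (\<lambda>i. x i + t * y i) i = apply_on V M x i + t * apply_on V M y i"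
  by (simp add: apply_on_def sum.distrib sum_distrib_left algebra_simps)

lemma apply_on_sym:
  assumes "\<And>i j. i \<in> V \<Longrightarrow> j \<in> V \<Longrightarrow> M i j = M j i"
  shows "(\<Sum>i\<in>V. apply_on V M x i * y i) = (\<Sum>i\<in>V. x i * apply_on V M y i)"
proof -
  have "(\<Sum>i\<in>V. apply_on V M x i * y i) = (\<Sum>i\<in>V. \<Sum>j\<in>V. M i j * x j * y i)"
    by (simp add: apply_on_def sum_distrib_right)
  also have "\<dots> = (\<Sum>j\<in>V. \<Sum>i\<in>V. M i j * x j * y i)" by (rule sum.swap)
  also have "\<dots> = (\<Sum>j\<in>V. \<Sum>i\<in>V. x j * (M j i * y i))"
    using assms by (intro sum.cong refl) (simp add: algebra_simps)
  also have "\<dots> = (\<Sum>j\<in>V. x j * apply_on V M y j)" by (simp add: apply_on_def sum_distrib_left)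
  finally show ?thesis .
qed

lemma sum_square_add:
  "(\<Sum>i\<in>V. (x i + t * y i)\<^sup>2) = (\<Sum>i\<in>V. (x i)\<^sup>2) + 2 * t * (\<Sum>i\<in>V. x i * y i) + t\<^sup>2 * (\<Sum>i\<in>V. (y i :: real)\<^sup>2)"
  by (simp add: power2_eq_square algebra_simps sum.distrib sum_distrib_left)

text \<open>The first-order condition at a minimum: a short step \<open>t\<close> against the sign
  of \<open>b\<close> would bring the value down to at most
  \<open>-b^2 / (|c| + 1)^2\<close>.\<close>

lemma linear_coeff_zero:
  fixes b c :: real
  assumes "\<And>t. 0 \<le> t * b + t\<^sup>2 * c" shows "b = 0"
proof (rule ccontr)
  assume "b \<noteq> 0"
  define t where "t = - b / (\<bar>c\<bar> + 1)"
  have pos: "\<bar>c\<bar> + 1 > 0" by simp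
  have "t * b + t\<^sup>2 * c \<le> t * b + t\<^sup>2 * \<bar>c\<bar>" by (simp add: mult_left_mono)
  also have "\<dots> = b\<^sup>2 * (\<bar>c\<bar> / (\<bar>c\<bar> + 1)\<^sup>2 - 1 / (\<bar>c\<bar> + 1))"
    by (simp add: t_def power2_eq_square field_simps)
  also have "\<bar>c\<bar> / (\<bar>c\<bar> + 1)\<^sup>2 - 1 / (\<bar>c\<bar> + 1) = - 1 / (\<bar>c\<bar> + 1)\<^sup>2"
    using pos by (simp add: power2_eq_square divide_simps)
  also have "b\<^sup>2 * \<dots> < 0" using \<open>b \<noteq> 0\<close> pos by (simp add: mult_less_0_iff)
  finally show False using assms[of t] by simp
qed

lemma contractive_column:
  assumes "contractive V M" "finite V" "k \<in> V"
  shows "(\<Sum>i\<in>V. (M i k)\<^sup>2) \<le> 4"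
proof -
  let ?e = "\<lambda>x. if x = k then 1 else 0 :: real"
  have "apply_on V M ?e i = M i k" for i
    using assms by (simp add: apply_on_def if_distrib cong: if_cong)
  moreover have "(\<Sum>i\<in>V. (?e i)\<^sup>2) = 1"
    using assms by (simp add: if_distrib[of "\<lambda>x. x\<^sup>2"] cong: if_cong)
  moreover have "(\<Sum>i\<in>V. (apply_on V M ?e i)\<^sup>2) \<le> 4 * (\<Sum>i\<in>V. (?e i)\<^sup>2)"
    using assms(1) unfolding contractive_def by (rule spec)
  ultimately show ?thesis by simp
qed

text \<open>Setting the functions to 0 off \<open>V\<close> places the sphere in a product of
  intervals, which is compact by Tychonoff; no finite-dimensional type has to be built from
  \<open>V\<close>.\<close>

lemma compact_sphere_on:
  assumes "finite V"
  shows "compact {y :: nat \<Rightarrow> real. (\<forall>i. i \<notin> V \<longrightarrow> y i = 0) \<and> (\<Sum>i\<in>V. (y i)\<^sup>2) = 1}" (is "compact ?S")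
proof -
  have c: "compact (PiE UNIV (\<lambda>i. if i \<in> V then {-1..1} else {0::real}))" (is "compact ?C")
    using compactin_PiE[of "\<lambda>_. euclidean" UNIV "\<lambda>i::nat. if i \<in> V then {-1..1} else {0::real}"]
    by (simp add: euclidean_product_topology)
  have cl: "closed {y :: nat \<Rightarrow> real. (\<Sum>i\<in>V. (y i)\<^sup>2) = 1}"
    by (intro closed_Collect_eq continuous_intros continuous_on_product_coordinates)
  have "?S = ?C \<inter> {y. (\<Sum>i\<in>V. (y i)\<^sup>2) = 1}"
  proof (intro equalityI subsetI)
    fix y assume y: "y \<in> ?S"
    have "y i \<in> {-1..1}" if "i \<in> V" for i
    proof -
      have "(y i)\<^sup>2 \<le> (\<Sum>i\<in>V. (y i)\<^sup>2)" using assms that by (intro member_le_sum) auto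
      then have "(y i)\<^sup>2 \<le> 1" using y by simp
      then show ?thesis using abs_square_le_1[of "y i"] by auto
    qed
    then show "y \<in> ?C \<inter> {y. (\<Sum>i\<in>V. (y i)\<^sup>2) = 1}" using y by (auto simp: PiE_iff)
  next
    fix y assume "y \<in> ?C \<inter> {y. (\<Sum>i\<in>V. (y i)\<^sup>2) = 1}"
    then show "y \<in> ?S" by (auto simp: PiE_iff split: if_splits)
  qed
  then show ?thesis using compact_Int_closed[OF c cl] by simp
qed

text \<open>A maximiser of $|My|$ on the unit sphere is an eigenvector of $M^2$ for some $\mu$, and
  $M^2 - \mu = (M - \sqrt\mu)(M + \sqrt\mu)$.\<close>
lemma not_contractive_eigenvector:
  fixes M :: "nat \<Rightarrow> nat \<Rightarrow> real"
  assumes fin: "finite V" and sym: "\<And>i j. i \<in> V \<Longrightarrow> j \<in> V \<Longrightarrow> M i j = M j i"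
    and nc: "\<not> contractive V M"
  obtains l y where "\<bar>l\<bar> > 2" "\<exists>i\<in>V. y i \<noteq> 0" "\<And>i. i \<in> V \<Longrightarrow> apply_on V M y i = l * y i"
proof -
  let ?A = "apply_on V M"
  let ?N = "\<lambda>y. \<Sum>i\<in>V. (y i)\<^sup>2 :: real"
  define S :: "(nat \<Rightarrow> real) set" where "S = {y. (\<forall>i. i \<notin> V \<longrightarrow> y i = 0) \<and> ?N y = 1}"
  have normalize: "\<exists>u\<in>S. ?N (?A y) = ?N y * ?N (?A u)" if "?N y \<noteq> 0" for y
  proof -
    have pos: "?N y > 0" using that by (simp add: order.not_eq_order_implies_strict sum_nonneg)
    define c where "c = sqrt (?N y)"
    have c: "c > 0" "c\<^sup>2 = ?N y" using pos by (simp_all add: c_def)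
    define u where "u = (\<lambda>i. if i \<in> V then y i / c else 0)"
    have "?N u = ?N y / c\<^sup>2"
      by (simp add: u_def power_divide sum_divide_distrib)
    then have "u \<in> S" using c that by (simp add: S_def u_def)
    moreover have "?A u i = ?A y i / c" for i
      by (simp add: apply_on_def u_def sum_divide_distrib)
    then have "?N (?A u) = ?N (?A y) / c\<^sup>2"
      by (simp add: power_divide sum_divide_distrib)
    then have "?N (?A y) = ?N y * ?N (?A u)" using c that by simp
    ultimately show ?thesis by blast
  qed
  have zero: "?A y i = 0" if "?N y = 0" for y i
    using that fin by (simp add: sum_nonneg_eq_0_iff apply_on_def)
  obtain y0 where y0: "?N (?A y0) > 4 * ?N y0" using nc by (auto simp: contractive_def not_le)
  have "?N y0 \<noteq> 0" using y0 zero[of y0] by auto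
  then obtain u0 where u0: "u0 \<in> S" "?N (?A y0) = ?N y0 * ?N (?A u0)" using normalize by blast
  have "?N y0 > 0" using \<open>?N y0 \<noteq> 0\<close> by (simp add: order.not_eq_order_implies_strict sum_nonneg)
  then have u0': "?N (?A u0) > 4" using y0 u0(2) by (simp add: mult.commute)
  have "continuous_on S (\<lambda>y. ?N (?A y))"
    unfolding apply_on_def by (intro continuous_intros continuous_on_subset[OF continuous_on_product_coordinates] subset_UNIV)
  moreover have "compact S" unfolding S_def by (rule compact_sphere_on[OF fin])
  ultimately obtain x where x: "x \<in> S" "\<And>u. u \<in> S \<Longrightarrow> ?N (?A u) \<le> ?N (?A x)"
    using continuous_attains_sup[of S "\<lambda>y. ?N (?A y)"] u0(1) by blast
  define \<mu> where "\<mu> = ?N (?A x)"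
  have \<mu>: "\<mu> > 4" unfolding \<mu>_def using x(2)[OF u0(1)] u0' by linarith
  have bound: "?N (?A y) \<le> \<mu> * ?N y" for y
  proof (cases "?N y = 0")
    case True then show ?thesis using zero[OF True] by simp
  next
    case False
    then obtain u where "u \<in> S" "?N (?A y) = ?N y * ?N (?A u)" using normalize by blast
    then show ?thesis using x(2) by (simp add: \<mu>_def mult.commute mult_left_mono sum_nonneg)
  qed
  have Nx: "?N x = 1" using x(1) by (simp add: S_def)
  \<comment> \<open>First-order condition at the maximiser \<open>x\<close> in the direction
    \<open>z\<close>.\<close>
  have crit: "\<mu> * (\<Sum>i\<in>V. x i * z i) = (\<Sum>i\<in>V. ?A x i * ?A z i)" for z
  proof -
    have "0 \<le> t * (2 * (\<mu> * (\<Sum>i\<in>V. x i * z i) - (\<Sum>i\<in>V. ?A x i * ?A z i)))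
        + t\<^sup>2 * (\<mu> * ?N z - ?N (?A z))" for t
      using bound[of "\<lambda>i. x i + t * z i"] unfolding apply_on_add sum_square_add
      by (simp add: Nx \<mu>_def algebra_simps)
    from linear_coeff_zero[OF this] show ?thesis by simp
  qed
  have AA: "?A (?A x) i = \<mu> * x i" if i: "i \<in> V" for i
  proof -
    let ?e = "\<lambda>j. if j = i then 1 else 0 :: real"
    have "\<mu> * x i = \<mu> * (\<Sum>j\<in>V. x j * ?e j)" using i fin by (simp add: if_distrib cong: if_cong)
    also have "\<dots> = (\<Sum>j\<in>V. ?A (?A x) j * ?e j)"
      unfolding crit by (rule apply_on_sym[symmetric, OF sym])
    finally show ?thesis using i fin by (simp add: if_distrib cong: if_cong)
  qed
  define r where "r = sqrt \<mu>"
  have r: "r > 2" "r * r = \<mu>" using \<mu> by (simp_all add: r_def real_less_rsqrt)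
  show ?thesis
  \<comment> \<open>Either \<open>M + r\<close> kills \<open>x\<close>, which is then an eigenvector
    for \<open>-r\<close>, or the nonzero vector \<open>(M + r) x\<close> is killed by
    \<open>M - r\<close>.\<close>
  proof (cases "\<forall>i\<in>V. ?A x i + r * x i = 0")
    case True
    have "\<exists>i\<in>V. x i \<noteq> 0" using Nx by (metis (mono_tags, lifting) power_zero_numeral sum.neutral zero_neq_one)
    moreover have "?A x i = - r * x i" if "i \<in> V" for i using True that by (simp add: eq_neg_iff_add_eq_0)
    ultimately show ?thesis using that[of "- r" x] r by simp
  next
    case False
    have "?A (\<lambda>i. ?A x i + r * x i) i = r * (?A x i + r * x i)" if "i \<in> V" for i
      unfolding apply_on_add AA[OF that] using r(2) by (simp add: algebra_simps)
    then show ?thesis using that[of r "\<lambda>i. ?A x i + r * x i"] False r(1) by simp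
  qed
qed

section \<open>From eigenvalues of matrices to contractions and back\<close>

lemma apply_on_mat:
  assumes "A = mat n n (\<lambda>(i,j). M i j)" "i < n"
  shows "(A *\<^sub>v vec n y) $ i = apply_on {..<n} M y i"
  using assms by (simp add: apply_on_def scalar_prod_def atLeast0LessThan)

lemma cyclotomic_contractive:
  assumes over: "matrix_over Zphi A" and cyc: "cyclotomic A" and n: "n = dim_row A"
  obtains Z where "\<And>i j. Z i j = Z j i" "A = mat n n (\<lambda>(i,j). emb False (Z i j))"
    "\<And>c. contractive {..<n} (\<lambda>i j. emb c (Z i j))"
proof -
  have A: "A \<in> carrier_mat n n" using cyc n by (auto simp: cyclotomic_def)
  have symA: "A $$ (i,j) = A $$ (j,i)" if "i < n" "j < n" for i j
    using cyc that A by (metis carrier_matD cyclotomic_def index_transpose_mat(1))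
  \<comment> \<open>Zero outside the index range, so that symmetry holds for all indices. Inside,
    \<open>SOME\<close> respects symmetry because equal entries give the same choice.\<close>
  define Z where "Z i j = (if i < n \<and> j < n then (SOME z. emb False z = A $$ (i,j)) else 0)" for i j
  have Z: "emb False (Z i j) = A $$ (i,j)" if "i < n" "j < n" for i j
  proof -
    have "A $$ (i,j) \<in> range (emb False)"
      using over that A by (simp add: matrix_over_def Zphi_eq_range[symmetric])
    then have "\<exists>z. emb False z = A $$ (i,j)" by (auto simp: image_iff)
    from someI_ex[OF this] show ?thesis using that by (simp add: Z_def)
  qed
  have symZ: "Z i j = Z j i" for i j
    using symA[of i j] by (simp add: Z_def)
  define ZM where "ZM = mat n n (\<lambda>(i,j). Z i j)"
  define E where "E c = mat n n (\<lambda>(i,j). emb c (Z i j))" for c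
  have ZM: "ZM \<in> carrier_mat n n" and E: "E c \<in> carrier_mat n n" "E c = map_mat (emb c) ZM" for c
    by (auto simp: ZM_def E_def)
  have AE: "A = E False" using A Z by (auto simp: E_def)
  have cp: "char_poly (E c) = map_poly (emb c) (char_poly ZM)" for c
    unfolding E(2) by (rule emb.char_poly_hom[OF ZM])
  have "coeff (char_poly (E True)) i = coeff (char_poly (E False)) i" for i
    using cyc emb_int_conj[of "coeff (char_poly ZM) i"] unfolding cp AE cyclotomic_def
    by (simp add: emb.coeff_map_poly_hom)
  then have cpE: "char_poly (E c) = char_poly A" for c
    unfolding AE by (cases c) (auto intro: poly_eqI)
  have "contractive {..<n} (\<lambda>i j. emb c (Z i j))" for c
  proof (rule ccontr)
    assume nc: "\<not> contractive {..<n} (\<lambda>i j. emb c (Z i j))"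
    have "emb c (Z i j) = emb c (Z j i)" for i j by (rule arg_cong[OF symZ])
    then obtain l y where l: "\<bar>l\<bar> > 2" and y: "\<exists>i\<in>{..<n}. y i \<noteq> 0"
      and ev: "\<And>i. i \<in> {..<n} \<Longrightarrow> apply_on {..<n} (\<lambda>i j. emb c (Z i j)) y i = l * y i"
      by (rule not_contractive_eigenvector[OF finite_lessThan _ nc]) blast+
    have "E c *\<^sub>v vec n y = l \<cdot>\<^sub>v vec n y"
    proof (rule eq_vecI)
      fix i assume "i < dim_vec (l \<cdot>\<^sub>v vec n y)"
      then show "(E c *\<^sub>v vec n y) $ i = (l \<cdot>\<^sub>v vec n y) $ i"
        using ev[of i] apply_on_mat[of "E c" n "\<lambda>i j. emb c (Z i j)" i y]
        using E_def by simp
    qed (simp add: E_def)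
    moreover have "vec n y \<noteq> 0\<^sub>v n" using y by (metis index_vec index_zero_vec(1) lessThan_iff)
    ultimately have "eigenvalue (E c) l"
      unfolding eigenvalue_def eigenvector_def using E(1)[of c] by (intro exI[of _ "vec n y"]) auto
    then have "poly (char_poly A) l = 0" using eigenvalue_root_char_poly[OF E(1)] cpE by metis
    then have "poly (map_poly complex_of_real (char_poly A)) (complex_of_real l) = 0" by simp
    then have "eigenvalue (map_mat complex_of_real A) (complex_of_real l)"
      using eigenvalue_root_char_poly[of "map_mat complex_of_real A" n] A
      by (simp add: of_real_hom.char_poly_hom)
    then have "-2 \<le> l \<and> l \<le> 2" using cyc unfolding cyclotomic_def by fastforce
    then show False using l by linarith
  qed
  from symZ AE[unfolded E_def] this show ?thesis by (rule that)
qed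

text \<open>Every eigenvalue is 2 or -2, so the characteristic polynomial is a product of factors
  \<open>x - 2\<close> and \<open>x + 2\<close>. This makes its coefficients integers even when the
  entries are irrational.\<close>

lemma square_four_cyclotomic:
  assumes A: "A \<in> carrier_mat n n" and sym: "A = transpose_mat A" and sq: "A * A = 4 \<cdot>\<^sub>m 1\<^sub>m n"
  shows "cyclotomic A"
proof -
  define C where "C = map_mat complex_of_real A"
  have C: "C \<in> carrier_mat n n" using A by (simp add: C_def)
  have CC: "C * C = 4 \<cdot>\<^sub>m 1\<^sub>m n"
  proof -
    have "C * C = map_mat complex_of_real (A * A)"
      unfolding C_def by (rule of_real_hom.mat_hom_mult[OF A A, symmetric])
    then show ?thesis unfolding sq by (auto simp: of_real_hom.hom_one)
  qed
  have ev: "z = 2 \<or> z = -2" if ez: "eigenvalue C z" for z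
  proof -
    obtain v where v: "v \<in> carrier_vec n" "v \<noteq> 0\<^sub>v n" "C *\<^sub>v v = z \<cdot>\<^sub>v v"
      using ez C unfolding eigenvalue_def eigenvector_def by auto
    have "(C * C) *\<^sub>v v = C *\<^sub>v (C *\<^sub>v v)" by (rule assoc_mult_mat_vec[OF C C v(1)])
    also have "\<dots> = z \<cdot>\<^sub>v (z \<cdot>\<^sub>v v)" using v C by (simp add: mult_mat_vec)
    finally have e: "(4 \<cdot>\<^sub>m 1\<^sub>m n) *\<^sub>v v = z \<cdot>\<^sub>v (z \<cdot>\<^sub>v v)" unfolding CC .
    have "(4 \<cdot>\<^sub>m 1\<^sub>m n) *\<^sub>v v = 4 \<cdot>\<^sub>v (1\<^sub>m n *\<^sub>v v)" using v(1) by auto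
    then have e': "(4 \<cdot>\<^sub>m 1\<^sub>m n) *\<^sub>v v = 4 \<cdot>\<^sub>v v" using v(1) by simp
    obtain i where i: "i < n" "v $ i \<noteq> 0" using v(1,2) by (metis carrier_vecD eq_vecI index_zero_vec)
    have "(4 \<cdot>\<^sub>v v) $ i = (z \<cdot>\<^sub>v (z \<cdot>\<^sub>v v)) $ i" using e e' by simp
    then have "z * z = 4" using i v(1) by simp
    then have "(z - 2) * (z + 2) = 0" by (simp add: algebra_simps)
    then show ?thesis by (auto simp: eq_neg_iff_add_eq_0)
  qed
  obtain as where as: "char_poly C = (\<Prod>a\<leftarrow>as. [:- a, 1:])" using char_poly_factorized[OF C] by blast
  have "a \<in> {2,-2}" if "a \<in> set as" for a
  proof -
    have "poly (char_poly C) a = 0" unfolding as using that by (induction as) auto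
    then show ?thesis using ev eigenvalue_root_char_poly[OF C] by auto
  qed
  then have "set as \<subseteq> {2,-2}" by blast
  then have ints: "coeff (\<Prod>a\<leftarrow>as. [:- a, 1:]) i \<in> \<int>" for i
  proof (induction as arbitrary: i)
    case (Cons a as)
    then have "a \<in> \<int>" and IH: "\<And>i. coeff (\<Prod>a\<leftarrow>as. [:- a, 1:]) i \<in> \<int>" by auto
    then show ?case by (auto simp: coeff_pCons split: nat.split)
  qed (auto simp: coeff_1)
  have "coeff (char_poly A) i \<in> \<int>" for i
  proof -
    have "complex_of_real (coeff (char_poly A) i) = coeff (char_poly C) i"
      unfolding C_def of_real_hom.char_poly_hom[OF A] by simp
    then have "complex_of_real (coeff (char_poly A) i) \<in> \<int>" using ints as by simp
    then show ?thesis by (metis Ints_cases Ints_of_int of_real_eq_iff of_real_of_int_eq)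
  qed
  then show ?thesis using A sym ev unfolding cyclotomic_def C_def by fastforce
qed

lemma rtranclp_exit:
  assumes "R\<^sup>*\<^sup>* x y" "x \<in> X" "y \<notin> X"
  obtains u v where "R u v" "u \<in> X" "v \<notin> X"
  using assms by (induction rule: rtranclp_induct) auto

lemma indecomposable_neighbour:
  assumes "indecomposable A" "n = dim_row A" "u \<in> X" "u < n" "v \<notin> X" "v < n"
  obtains i j where "i < n" "j < n" "i \<in> X" "j \<notin> X" "A $$ (i,j) \<noteq> 0"
proof -
  have "(\<lambda>u v. u < n \<and> v < n \<and> u \<noteq> v \<and> A $$ (u,v) \<noteq> 0)\<^sup>*\<^sup>* u v"
    using assms unfolding indecomposable_def by blast
  then show ?thesis using rtranclp_exit[of _ u v X] assms(3,5) that by blast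
qed

lemma square_four_maximal:
  assumes A: "A \<in> carrier_mat n n" and sym: "A = transpose_mat A" and sq: "A * A = 4 \<cdot>\<^sub>m 1\<^sub>m n"
    and over: "matrix_over Zphi A" and ind: "indecomposable A"
  shows "maximal_indecomposable_cyclotomic Zphi A"
proof -
  have symA: "A $$ (k,l) = A $$ (l,k)" if "k < n" "l < n" for k l
  proof -
    have "A $$ (k,l) = transpose_mat A $$ (k,l)" using sym by simp
    also have "\<dots> = A $$ (l,k)" using A that by simp
    finally show ?thesis .
  qed
  have False if B: "matrix_over Zphi B" "indecomposable B" "cyclotomic B" "proper_principal_submatrix A B" for B
  proof -
    define p where "p = dim_row B"
    obtain Z where symZ: "\<And>i j. Z i j = Z j i" and BZ: "B = mat p p (\<lambda>(i,j). emb False (Z i j))"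
      and con: "\<And>c. contractive {..<p} (\<lambda>i j. emb c (Z i j))"
      using cyclotomic_contractive[OF B(1,3) p_def] by blast
    obtain f where f: "inj_on f {..<n}" "f ` {..<n} \<subseteq> {..<p}"
      "\<And>i j. i < n \<Longrightarrow> j < n \<Longrightarrow> A $$ (i,j) = B $$ (f i, f j)" and np: "n < p"
      using B(4) A unfolding proper_principal_submatrix_def principal_submatrix_def p_def by auto
    have "card (f ` {..<n}) = n" using f(1) by (simp add: card_image)
    then have "\<not> {..<p} \<subseteq> f ` {..<n}" using np by (metis card_lessThan card_mono finite_imageI finite_lessThan leD)
    then obtain v where v: "v < p" "v \<notin> f ` {..<n}" by auto
    have n0: "0 < n" using ind A by (simp add: indecomposable_def)
    then have "f 0 \<in> f ` {..<n}" "f 0 < p" using f(2) by auto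
    then obtain i j where ij: "i < p" "j < p" "i \<in> f ` {..<n}" "j \<notin> f ` {..<n}" "B $$ (i,j) \<noteq> 0"
      using indecomposable_neighbour[OF B(2) p_def _ _ v(2,1)] by blast
    then obtain k where k: "k < n" "i = f k" by auto
    \<comment> \<open>Column \<open>i\<close> of \<open>B\<close> has squared norm 4 already on the
      image of \<open>f\<close>; the neighbour \<open>j\<close> outside the image would push it
      above 4.\<close>
    have le: "(\<Sum>x<p. (emb False (Z x i))\<^sup>2) \<le> 4"
      using contractive_column[OF con[of False]] ij(1) by simp
    have "(\<Sum>x\<in>f ` {..<n}. (emb False (Z x i))\<^sup>2) = (\<Sum>l<n. (A $$ (l,k))\<^sup>2)"
      using f k by (subst sum.reindex[OF f(1)]) (auto simp: BZ subset_iff intro!: sum.cong)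
    also have "\<dots> = (\<Sum>l<n. A $$ (k,l) * A $$ (l,k))"
      using symA k(1) by (intro sum.cong refl) (simp add: power2_eq_square)
    also have "\<dots> = (A * A) $$ (k,k)" using A k(1) by (simp add: scalar_prod_def atLeast0LessThan)
    also have "\<dots> = 4" unfolding sq using k(1) by simp
    finally have four: "(\<Sum>x\<in>f ` {..<n}. (emb False (Z x i))\<^sup>2) = 4" .
    have "(\<Sum>x\<in>insert j (f ` {..<n}). (emb False (Z x i))\<^sup>2) \<le> (\<Sum>x<p. (emb False (Z x i))\<^sup>2)"
      using f(2) ij(2) by (intro sum_mono2) auto
    moreover have "(\<Sum>x\<in>insert j (f ` {..<n}). (emb False (Z x i))\<^sup>2) = (emb False (Z j i))\<^sup>2 + 4"
      using four ij(4) by simp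
    ultimately have "(emb False (Z j i))\<^sup>2 \<le> 0" using le by linarith
    then show False using ij(1,2,5) symZ by (simp add: BZ)
  qed
  then show ?thesis
    using square_four_cyclotomic[OF A sym sq] over ind unfolding maximal_indecomposable_cyclotomic_def by blast
qed

section \<open>Symmetric square roots of 4\<close>

lemma indecomposable_rooted:
  assumes A: "A \<in> carrier_mat n n" and sym: "\<And>i j. i < n \<Longrightarrow> j < n \<Longrightarrow> A $$ (i,j) = A $$ (j,i)" and r: "r < n"
    and reach: "\<And>i. i < n \<Longrightarrow> (\<lambda>u v. u < n \<and> v < n \<and> u \<noteq> v \<and> A $$ (u,v) \<noteq> 0)\<^sup>*\<^sup>* r i"
  shows "indecomposable A"
proof -
  let ?R = "\<lambda>u v. u < n \<and> v < n \<and> u \<noteq> v \<and> A $$ (u,v) \<noteq> 0"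
  have "symp ?R" using sym by (auto simp: symp_def)
  then have "symp ?R\<^sup>*\<^sup>*" by (rule symp_rtranclp)
  then have "?R\<^sup>*\<^sup>* i j" if "i < n" "j < n" for i j
    using reach[OF that(1)] reach[OF that(2)] by (meson rtranclp_trans sympE)
  then show ?thesis using A r unfolding indecomposable_def by auto
qed

text \<open>Cutting a square root of 4 down to a connected component keeps it a square root of 4.\<close>
lemma square_four_completion:
  fixes M :: "nat \<Rightarrow> nat \<Rightarrow> real"
  assumes fin: "finite W" and sym: "\<And>i j. i \<in> W \<Longrightarrow> j \<in> W \<Longrightarrow> M i j = M j i"
    and over: "\<And>i j. i \<in> W \<Longrightarrow> j \<in> W \<Longrightarrow> M i j \<in> Zphi"
    and sq: "\<And>i j. i \<in> W \<Longrightarrow> j \<in> W \<Longrightarrow> (\<Sum>k\<in>W. M i k * M k j) = (if i = j then 4 else 0)"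
    and A: "indecomposable A" "n = dim_row A"
    and f: "inj_on f {..<n}" "f ` {..<n} \<subseteq> W" "\<And>i j. i < n \<Longrightarrow> j < n \<Longrightarrow> A $$ (i,j) = M (f i) (f j)"
  obtains B where "maximal_indecomposable_cyclotomic Zphi B" "principal_submatrix A B"
proof -
  let ?R = "\<lambda>u v. u \<in> W \<and> v \<in> W \<and> u \<noteq> v \<and> M u v \<noteq> 0"
  have Ac: "A \<in> carrier_mat n n" and n0: "0 < n" using A by (auto simp: indecomposable_def)
  define K where "K = {w\<in>W. ?R\<^sup>*\<^sup>* (f 0) w}"
  have K: "finite K" "K \<subseteq> W" using fin by (auto simp: K_def)
  have f0: "f 0 \<in> K" using f(2) n0 by (auto simp: K_def)
  have out: "M u k = 0" if "u \<in> K" "k \<in> W" "k \<notin> K" for u k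
  proof (rule ccontr)
    assume "M u k \<noteq> 0"
    then have "?R u k" using that K(2) by auto
    then have "?R\<^sup>*\<^sup>* (f 0) k" using that(1) unfolding K_def by (auto intro: rtranclp.rtrancl_into_rtrancl)
    then show False using that by (simp add: K_def)
  qed
  have fK: "f ` {..<n} \<subseteq> K"
  proof
    fix w assume "w \<in> f ` {..<n}"
    then obtain i where i: "i < n" "w = f i" by auto
    have "(\<lambda>u v. u < n \<and> v < n \<and> u \<noteq> v \<and> A $$ (u,v) \<noteq> 0)\<^sup>*\<^sup>* 0 i"
      using A i n0 unfolding indecomposable_def by auto
    then have "?R\<^sup>*\<^sup>* (f 0) (f i)"
    proof (induction rule: rtranclp_induct)
      case (step u v)
      then have "?R (f u) (f v)" using f by (auto simp: inj_on_eq_iff)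
      then show ?case using step.IH by (rule rtranclp.rtrancl_into_rtrancl[rotated])
    qed simp
    then show "w \<in> K" using i f(2) by (auto simp: K_def)
  qed
  define m where "m = card K"
  obtain h where h: "bij_betw h {..<m} K"
    using ex_bij_betw_nat_finite[OF K(1)] unfolding m_def atLeast0LessThan by blast
  then have hK: "\<And>i. i < m \<Longrightarrow> h i \<in> K" and hinj: "inj_on h {..<m}" and him: "h ` {..<m} = K"
    by (auto simp: bij_betw_def)
  define g where "g = inv_into {..<m} h"
  have g: "g w < m" "h (g w) = w" if "w \<in> K" for w
    using that hinj by (auto simp: g_def him[symmetric])
  have gh: "g (h i) = i" if "i < m" for i using that hinj by (simp add: g_def)
  define B where "B = mat m m (\<lambda>(i,j). M (h i) (h j))"
  have B: "B \<in> carrier_mat m m" by (simp add: B_def)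
  have Bsym: "B $$ (i,j) = B $$ (j,i)" if "i < m" "j < m" for i j
    using that sym hK K(2) by (auto simp: B_def)
  have BT: "B = transpose_mat B" using B Bsym by (intro eq_matI) auto
  have BB: "B * B = 4 \<cdot>\<^sub>m 1\<^sub>m m"
  proof (rule eq_matI)
    fix i j assume "i < dim_row (4 \<cdot>\<^sub>m 1\<^sub>m m)" "j < dim_col (4 \<cdot>\<^sub>m 1\<^sub>m m)"
    then have ij: "i < m" "j < m" by simp_all
    have "(B * B) $$ (i,j) = (\<Sum>k<m. M (h i) (h k) * M (h k) (h j))"
      using ij by (simp add: B_def scalar_prod_def atLeast0LessThan)
    also have "\<dots> = (\<Sum>k\<in>K. M (h i) k * M k (h j))"
      using sum.reindex_bij_betw[OF h, of "\<lambda>k. M (h i) k * M k (h j)"] by simp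
    \<comment> \<open>No edge leaves the component \<open>K\<close>, so the terms added here
      vanish.\<close>
    also have "\<dots> = (\<Sum>k\<in>W. M (h i) k * M k (h j))"
      using K fin out[OF hK[OF ij(1)]] by (intro sum.mono_neutral_left) auto
    also have "\<dots> = (if h i = h j then 4 else 0)" using sq hK K(2) ij by (meson subsetD)
    also have "\<dots> = (4 \<cdot>\<^sub>m 1\<^sub>m m) $$ (i,j)" using ij hinj by (auto simp: inj_on_eq_iff)
    finally show "(B * B) $$ (i,j) = (4 \<cdot>\<^sub>m 1\<^sub>m m) $$ (i,j)" .
  qed (simp_all add: B_def)
  have Bover: "matrix_over Zphi B" using over hK K(2) by (auto simp: matrix_over_def B_def)
  have "(\<lambda>u v. u < m \<and> v < m \<and> u \<noteq> v \<and> B $$ (u,v) \<noteq> 0)\<^sup>*\<^sup>* (g (f 0)) i" if i: "i < m" for i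
  proof -
    have "?R\<^sup>*\<^sup>* (f 0) (h i)" using hK[OF i] by (simp add: K_def)
    then have "(\<lambda>u v. u < m \<and> v < m \<and> u \<noteq> v \<and> B $$ (u,v) \<noteq> 0)\<^sup>*\<^sup>* (g (f 0)) (g (h i))"
    proof (induction rule: rtranclp_induct)
      case (step u v)
      then have uv: "u \<in> K" "v \<in> K" unfolding K_def by (auto intro: rtranclp.rtrancl_into_rtrancl)
      have "u \<noteq> v" "M u v \<noteq> 0" using step.hyps by auto
      then have "g u < m \<and> g v < m \<and> g u \<noteq> g v \<and> B $$ (g u, g v) \<noteq> 0"
        using g[OF uv(1)] g[OF uv(2)] by (auto simp: B_def)
      then show ?case using step.IH by (rule rtranclp.rtrancl_into_rtrancl[rotated])
    qed simp
    then show ?thesis using gh[OF i] by simp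
  qed
  then have "indecomposable B" using indecomposable_rooted[OF B Bsym g(1)[OF f0]] by blast
  then have "maximal_indecomposable_cyclotomic Zphi B"
    by (rule square_four_maximal[OF B BT BB Bover])
  moreover have "principal_submatrix A B"
    unfolding principal_submatrix_def
  proof (intro conjI exI[of _ "g \<circ> f"] allI impI)
    have fiK: "f i \<in> K" if "i < n" for i using fK that by auto
    show "inj_on (g \<circ> f) {..<dim_row A}"
    proof (rule inj_onI)
      fix i j assume ij: "i \<in> {..<dim_row A}" "j \<in> {..<dim_row A}" "(g \<circ> f) i = (g \<circ> f) j"
      then have "f i = f j" using g(2) fiK A(2) by (metis comp_apply lessThan_iff)
      then show "i = j" using ij f(1) A(2) by (simp add: inj_on_eq_iff)
    qed
    show "(g \<circ> f) ` {..<dim_row A} \<subseteq> {..<dim_row B}" using g(1) fiK A(2) B by auto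
    fix i j assume "i < dim_row A" "j < dim_row A"
    then show "A $$ (i, j) = B $$ ((g \<circ> f) i, (g \<circ> f) j)"
      using g fiK f(3) A(2) by (simp add: B_def)
  qed (use Ac B in auto)
  ultimately show ?thesis by (rule that)
qed

section \<open>Completing a capped integral matrix\<close>

definition bil :: "nat set \<Rightarrow> (nat \<Rightarrow> nat \<Rightarrow> int) \<Rightarrow> (nat \<Rightarrow> real) \<Rightarrow> (nat \<Rightarrow> real) \<Rightarrow> real" where
  "bil V M x y = (\<Sum>i\<in>V. \<Sum>j\<in>V. of_int (M i j) * x i * y j)"

text \<open>$2 + M - a a^T$ and $2 - M - a a^T$ are positive semidefinite.\<close>
definition capped :: "nat set \<Rightarrow> (nat \<Rightarrow> nat \<Rightarrow> int) \<Rightarrow> (nat \<Rightarrow> int) \<Rightarrow> bool" where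
  "capped V M a \<longleftrightarrow> (\<forall>x. (\<Sum>i\<in>V. of_int (a i) * x i)\<^sup>2 + \<bar>bil V M x x\<bar> \<le> 2 * (\<Sum>i\<in>V. (x i)\<^sup>2))"

text \<open>Every connected component of $M$ meets the support of $a$.\<close>
definition anchored :: "nat set \<Rightarrow> (nat \<Rightarrow> nat \<Rightarrow> int) \<Rightarrow> (nat \<Rightarrow> int) \<Rightarrow> bool" where
  "anchored V M a \<longleftrightarrow> (\<forall>X\<subseteq>V. (\<forall>i\<in>X. a i = 0) \<longrightarrow> (\<forall>i\<in>X. \<forall>j\<in>V - X. M j i = 0) \<longrightarrow> X = {})"

text \<open>Such an $N$ acts as a complete half-infinite tube: it kills $a$, and its square is 4 on the
  complement of $a$. Both a further layer and a cap $N + a a^T$ of square 4 can be attached along $a$.\<close>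
definition root_state :: "nat set \<Rightarrow> (nat \<Rightarrow> nat \<Rightarrow> int) \<Rightarrow> (nat \<Rightarrow> int) \<Rightarrow> bool" where
  "root_state W N a \<longleftrightarrow> finite W \<and> (\<forall>i\<in>W. \<forall>j\<in>W. N i j = N j i) \<and> (\<Sum>i\<in>W. (a i)\<^sup>2) = 2 \<and>
     (\<forall>i\<in>W. (\<Sum>j\<in>W. N i j * a j) = 0) \<and>
     (\<forall>i\<in>W. \<forall>j\<in>W. (\<Sum>k\<in>W. N i k * N k j) = (if i = j then 4 else 0) - 2 * a i * a j)"

section \<open>Quadratic forms under a cap\<close>

lemma bil_add:
  assumes "\<And>i j. i \<in> V \<Longrightarrow> j \<in> V \<Longrightarrow> M i j = M j i"
  shows "bil V M (\<lambda>i. x i + t * y i) (\<lambda>i. x i + t * y i) = bil V M x x + 2 * t * bil V M x y + t\<^sup>2 * bil V M y y"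
proof -
  have "bil V M y x = bil V M x y"
    unfolding bil_def by (subst sum.swap) (intro sum.cong refl, simp add: assms mult.commute mult.left_commute)
  moreover have "bil V M (\<lambda>i. x i + t * y i) (\<lambda>i. x i + t * y i)
      = bil V M x x + t * bil V M x y + t * bil V M y x + t\<^sup>2 * bil V M y y"
    by (simp add: bil_def power2_eq_square algebra_simps sum.distrib sum_distrib_left)
  ultimately show ?thesis by simp
qed

lemma cappedD:
  "capped V M a \<Longrightarrow> (\<Sum>i\<in>V. of_int (a i) * x i)\<^sup>2 + \<bar>bil V M x x\<bar> \<le> 2 * (\<Sum>i\<in>V. (x i)\<^sup>2)"
  unfolding capped_def by blast
lemma bil_cong:
 "(\<And>i. i \<in> V \<Longrightarrow> x i = x' i) \<Longrightarrow> (\<And>i. i \<in> V \<Longrightarrow> y i = y' i) \<Longrightarrow> bil V M x y = bil V M x' y'"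
  by (simp add: bil_def)

text \<open>Testing the cap on \<open>a\<close> itself gives \<open>s * s\<close> \<le>
  \<open>2 * s\<close> for the square sum \<open>s\<close>.\<close>

lemma capped_weight_le:
  assumes "capped V M a" shows "(\<Sum>i\<in>V. (a i)\<^sup>2) \<le> 2"
proof -
  let ?s = "\<Sum>i\<in>V. (a i)\<^sup>2"
  have "(\<Sum>i\<in>V. of_int (a i) * of_int (a i))\<^sup>2 + \<bar>bil V M (\<lambda>i. of_int (a i)) (\<lambda>i. of_int (a i))\<bar>
      \<le> 2 * (\<Sum>i\<in>V. (of_int (a i) :: real)\<^sup>2)"
    by (rule cappedD[OF assms])
  then have "(of_int ?s)\<^sup>2 \<le> 2 * (of_int ?s :: real)" by (simp add: power2_eq_square)
  then have "of_int (?s\<^sup>2) \<le> (of_int (2 * ?s) :: real)" by simp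
  then have "?s * ?s \<le> 2 * ?s" unfolding of_int_le_iff by (simp add: power2_eq_square)
  then show ?thesis using mult_strict_right_mono[of 2 ?s ?s] by linarith
qed

text \<open>The form of \<open>2 - M - a a^T\<close> is nonnegative and attains 0 at
  \<open>a\<close>, so its derivative there in the direction of vertex \<open>i\<close>
  vanishes.\<close>

lemma capped_null:
  assumes fin: "finite V" and sym: "\<And>i j. i \<in> V \<Longrightarrow> j \<in> V \<Longrightarrow> M i j = M j i"
    and cap: "capped V M a" and two: "(\<Sum>i\<in>V. (a i)\<^sup>2) = 2" and i: "i \<in> V"
  shows "(\<Sum>j\<in>V. M i j * a j) = 0"
proof -
  let ?a = "\<lambda>i. of_int (a i) :: real"
  have aa: "(\<Sum>i\<in>V. ?a i * ?a i) = 2" "(\<Sum>i\<in>V. (?a i)\<^sup>2) = 2"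
    using two by (simp_all add: power2_eq_square flip: of_int_mult of_int_sum)
  have c: "(\<Sum>i\<in>V. ?a i * x i)\<^sup>2 + \<bar>bil V M x x\<bar> \<le> 2 * (\<Sum>i\<in>V. (x i)\<^sup>2)" for x
    by (rule cappedD[OF cap])
  have z: "bil V M ?a ?a = 0" using c[of ?a] aa by simp
  define e where "e = (\<lambda>j. if j = i then 1 else 0 :: real)"
  have "0 \<le> t * (- 2 * bil V M ?a e) + t\<^sup>2 * (2 * (\<Sum>i\<in>V. (e i)\<^sup>2) - (\<Sum>i\<in>V. ?a i * e i)\<^sup>2 - bil V M e e)" for t
  proof -
    have "(\<Sum>i\<in>V. ?a i * (?a i + t * e i)) = 2 + t * (\<Sum>i\<in>V. ?a i * e i)"
      using aa by (simp add: algebra_simps sum.distrib sum_distrib_left)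
    moreover have "bil V M (\<lambda>i. ?a i + t * e i) (\<lambda>i. ?a i + t * e i)
        = bil V M ?a ?a + 2 * t * bil V M ?a e + t\<^sup>2 * bil V M e e"
      by (rule bil_add) (rule sym)
    ultimately have "(2 + t * (\<Sum>i\<in>V. ?a i * e i))\<^sup>2 + \<bar>2 * t * bil V M ?a e + t\<^sup>2 * bil V M e e\<bar>
       \<le> 2 * (2 + 2 * t * (\<Sum>i\<in>V. ?a i * e i) + t\<^sup>2 * (\<Sum>i\<in>V. (e i)\<^sup>2))"
      using c[of "\<lambda>i. ?a i + t * e i"] unfolding sum_square_add by (simp add: z aa)

    then show ?thesis by (simp add: power2_eq_square algebra_simps)
  qed
  from linear_coeff_zero[OF this] have "bil V M ?a e = 0" by simp
  moreover have "bil V M ?a e = (\<Sum>j\<in>V. of_int (M j i) * ?a j)"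
    using fin i by (simp add: bil_def e_def if_distrib cong: if_cong)
  moreover have "\<dots> = of_int (\<Sum>j\<in>V. M i j * a j)"
    using sym i by (simp add: of_int_sum)
  ultimately have "of_int (\<Sum>j\<in>V. M i j * a j) = (0::real)" by linarith
  then show ?thesis unfolding of_int_eq_0_iff .
qed

lemma sum_two_squares_support:
  fixes a :: "nat \<Rightarrow> int"
  assumes fin: "finite V" and two: "(\<Sum>i\<in>V. (a i)\<^sup>2) = 2"
  obtains u v where "u \<in> V" "v \<in> V" "u \<noteq> v" "a u * a u = 1" "a v * a v = 1" "\<And>i. i \<in> V - {u, v} \<Longrightarrow> a i = 0"
proof -
  have small: "a i * a i \<le> 1" if "i \<in> V" for i
  proof -
    have "(a i)\<^sup>2 \<le> 2" using member_le_sum[of i V "\<lambda>i. (a i)\<^sup>2"] that fin two by simp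
    then have "\<bar>a i\<bar> < 2" using abs_le_square_iff[of 2 "a i"] by auto
    then have "a i \<in> {-1, 0, 1}" by auto
    then show ?thesis by auto
  qed
  define S where "S = {i\<in>V. a i \<noteq> 0}"
  have one: "a i * a i = 1" if "i \<in> S" for i
  proof -
    have "a i * a i \<noteq> 0" "0 \<le> a i * a i" "a i * a i \<le> 1" using that small[of i] by (simp_all add: S_def)
    then show ?thesis by linarith
  qed

  have "(\<Sum>i\<in>V. (a i)\<^sup>2) = (\<Sum>i\<in>S. (a i)\<^sup>2)"
    using fin by (intro sum.mono_neutral_right) (auto simp: S_def)
  also have "\<dots> = (\<Sum>i\<in>S. 1)" using one by (intro sum.cong) (simp_all add: power2_eq_square)
  finally have "card S = 2" using two by simp
  then obtain u v where "S = {u, v}" "u \<noteq> v" by (auto simp: card_2_iff)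
  then show ?thesis using one that[of u v] by (auto simp: S_def)
qed

text \<open>The new vertex \<open>w\<close> copies \<open>v\<close> with the opposite sign, so the
  extended form sees \<open>x v\<close> and \<open>x w\<close> only through their difference, while
  the new cap sees only their sum. The parallelogram law balances the two.\<close>

lemma capped_twin:
  assumes fin: "finite V" and cap: "capped V M a" and v: "v \<in> V" "a v * a v = 1" "\<And>i. i \<in> V - {v} \<Longrightarrow> a i = 0"
    and w: "w \<notin> V"
  defines "p \<equiv> \<lambda>i. if i = w then v else i" and "s \<equiv> \<lambda>i. if i = w then -1 else 1"
  shows "capped (insert w V) (\<lambda>i j. s i * s j * M (p i) (p j)) (a(w := a v))"
  unfolding capped_def
proof
  fix x :: "nat \<Rightarrow> real"
  define y where "y = x(v := x v - x w)"
  have vw: "v \<noteq> w" using v(1) w by auto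
  have push: "(\<Sum>i\<in>insert w V. of_int (s i) * h (p i) * x i) = (\<Sum>i\<in>V. h i * y i)" for h :: "nat \<Rightarrow> real"
  proof -
    have "(\<Sum>i\<in>V. of_int (s i) * h (p i) * x i) = (\<Sum>i\<in>V. h i * x i)"
      using w by (intro sum.cong) (auto simp: s_def p_def)
    also have "\<dots> = h v * x v + (\<Sum>i\<in>V - {v}. h i * x i)" using fin v(1) by (simp add: sum.remove)
    finally have "(\<Sum>i\<in>insert w V. of_int (s i) * h (p i) * x i)
      = h v * (x v - x w) + (\<Sum>i\<in>V - {v}. h i * x i)"
      using fin w by (simp add: s_def p_def algebra_simps)
    also have "\<dots> = h v * y v + (\<Sum>i\<in>V - {v}. h i * y i)" by (simp add: y_def)
    also have "\<dots> = (\<Sum>i\<in>V. h i * y i)" using fin v(1) by (simp add: sum.remove)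
    finally show ?thesis .
  qed
  have "bil (insert w V) (\<lambda>i j. s i * s j * M (p i) (p j)) x x
      = (\<Sum>i\<in>insert w V. of_int (s i) * (\<Sum>j\<in>insert w V. of_int (s j) * of_int (M (p i) (p j)) * x j) * x i)"
    unfolding bil_def by (intro sum.cong refl) (simp add: sum_distrib_left sum_distrib_right mult.assoc mult.left_commute mult.commute)
  also have "\<dots> = (\<Sum>i\<in>insert w V. of_int (s i) * (\<lambda>i. \<Sum>j\<in>V. of_int (M i j) * y j) (p i) * x i)"
    using push[of "\<lambda>k. of_int (M (p i) k)" for i] by simp
  also have "\<dots> = (\<Sum>i\<in>V. (\<Sum>j\<in>V. of_int (M i j) * y j) * y i)" by (rule push)
  also have "\<dots> = bil V M y y" by (simp add: bil_def sum_distrib_left sum_distrib_right mult.assoc mult.left_commute mult.commute)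
  finally have b: "bil (insert w V) (\<lambda>i j. s i * s j * M (p i) (p j)) x x = bil V M y y" .
  have rest: "(\<Sum>i\<in>V - {v}. of_int (a i) * g i) = 0" for g :: "nat \<Rightarrow> real"
    using v(3) by (intro sum.neutral) auto
  have e1: "(\<Sum>i\<in>V. of_int (a i) * y i) = of_int (a v) * (x v - x w)"
    using fin v(1) by (simp add: sum.remove[of V v] rest y_def)
  have l1: "(\<Sum>i\<in>V. of_int (a i) * y i)\<^sup>2 = of_int (a v * a v) * (x v - x w)\<^sup>2"
    unfolding e1 by (simp add: power_mult_distrib power2_eq_square[of "of_int (a v)"])
  have "(\<Sum>i\<in>V. of_int ((a(w := a v)) i) * x i) = (\<Sum>i\<in>V. of_int (a i) * x i)"
    using w by (intro sum.cong) auto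
  also have "\<dots> = of_int (a v) * x v" using fin v(1) by (simp add: sum.remove[of V v] rest)
  finally have e2: "(\<Sum>i\<in>insert w V. of_int ((a(w := a v)) i) * x i) = of_int (a v) * (x v + x w)"
    using fin w by (simp add: algebra_simps)
  have l2: "(\<Sum>i\<in>insert w V. of_int ((a(w := a v)) i) * x i)\<^sup>2 = of_int (a v * a v) * (x v + x w)\<^sup>2"
    unfolding e2 by (simp add: power_mult_distrib power2_eq_square[of "of_int (a v)"])

  have q: "(\<Sum>i\<in>V - {v}. (y i)\<^sup>2) = (\<Sum>i\<in>V - {v}. (x i)\<^sup>2)" by (simp add: y_def)
  have n1: "(\<Sum>i\<in>V. (y i)\<^sup>2) = (x v - x w)\<^sup>2 + (\<Sum>i\<in>V - {v}. (x i)\<^sup>2)"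
    using fin v(1) by (simp add: sum.remove[of V v] q y_def)
  have n2: "(\<Sum>i\<in>insert w V. (x i)\<^sup>2) = (x v)\<^sup>2 + (x w)\<^sup>2 + (\<Sum>i\<in>V - {v}. (x i)\<^sup>2)"
    using fin v(1) w by (simp add: sum.remove[of V v])
  have "(\<Sum>i\<in>V. of_int (a i) * y i)\<^sup>2 + \<bar>bil V M y y\<bar> \<le> 2 * (\<Sum>i\<in>V. (y i)\<^sup>2)"
    by (rule cappedD[OF cap])
  then show "(\<Sum>i\<in>insert w V. of_int ((a(w := a v)) i) * x i)\<^sup>2
      + \<bar>bil (insert w V) (\<lambda>i j. s i * s j * M (p i) (p j)) x x\<bar> \<le> 2 * (\<Sum>i\<in>insert w V. (x i)\<^sup>2)"
    unfolding l1 l2 n1 n2 b v(2) by (simp add: power2_eq_square algebra_simps)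
qed

text \<open>The rows \<open>a\<close> and \<open>-s * t * a\<close> of the new pair add
  \<open>2 a a^T\<close> to the square of \<open>N\<close>, which restores 4 on \<open>W\<close>.
  The combination of these rows with coefficients \<open>s\<close> and \<open>t\<close> is 0, so the
  root moves outward to the new pair.\<close>

lemma root_state_extend:
  assumes W: "root_state W N a" and v: "v \<notin> W" "w \<notin> W" "v \<noteq> w" and s: "s * s = 1" "t * t = (1::int)"
  defines "N' \<equiv> \<lambda>i j. if i \<in> W \<and> j \<in> W then N i j
      else if i = v \<and> j \<in> W then a j else if i = w \<and> j \<in> W then - s * t * a j
      else if j = v \<and> i \<in> W then a i else if j = w \<and> i \<in> W then - s * t * a i else 0"
    and "a' \<equiv> \<lambda>i. if i = v then s else if i = w then t else 0"
  shows "root_state (insert v (insert w W)) N' a'"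
proof -
  have fin: "finite W" and sym: "\<And>i j. i \<in> W \<Longrightarrow> j \<in> W \<Longrightarrow> N i j = N j i"
    and two: "(\<Sum>i\<in>W. a i * a i) = 2" and null: "\<And>i. i \<in> W \<Longrightarrow> (\<Sum>j\<in>W. N i j * a j) = 0"
    and sq: "\<And>i j. i \<in> W \<Longrightarrow> j \<in> W \<Longrightarrow> (\<Sum>k\<in>W. N i k * N k j) = (if i = j then 4 else 0) - 2 * a i * a j"
    using W unfolding root_state_def by (auto simp: power2_eq_square)
  have null': "(\<Sum>j\<in>W. a j * N j i) = 0" if "i \<in> W" for i
  proof -
    have "(\<Sum>j\<in>W. a j * N j i) = (\<Sum>j\<in>W. N i j * a j)"
      using sym[OF that] by (intro sum.cong refl) simp
    then show ?thesis using null[OF that] by simp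
  qed
  have ss: "s * (s * z) = z" "t * (t * z) = z" for z using s by (simp_all flip: mult.assoc)
  have a0: "(\<Sum>i\<in>W. a' i * h i) = 0" "(\<Sum>i\<in>W. h i * a' i) = 0" for h :: "nat \<Rightarrow> int"
    using v by (auto simp: a'_def intro!: sum.neutral)
  have inW: "i \<in> W \<Longrightarrow> i \<noteq> v \<and> i \<noteq> w" for i using v by auto
  have sums: "(\<Sum>k\<in>insert v (insert w W). h k) = h v + h w + (\<Sum>k\<in>W. h k)" for h :: "nat \<Rightarrow> int"
    using fin v by (simp add: add.assoc)
  have N'W: "(\<Sum>k\<in>W. N' i k * h k) = (\<Sum>k\<in>W. N i k * h k)" "(\<Sum>k\<in>W. h k * N' k i) = (\<Sum>k\<in>W. h k * N k i)"
    if "i \<in> W" for i h using that by (auto simp: N'_def intro: sum.cong)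
  have N'v: "(\<Sum>k\<in>W. N' v k * h k) = (\<Sum>k\<in>W. a k * h k)" "(\<Sum>k\<in>W. h k * N' k v) = (\<Sum>k\<in>W. h k * a k)" for h
    using v by (auto simp: N'_def intro!: sum.cong)
  have N'w: "(\<Sum>k\<in>W. N' w k * h k) = - s * t * (\<Sum>k\<in>W. a k * h k)"
      "(\<Sum>k\<in>W. h k * N' k w) = - s * t * (\<Sum>k\<in>W. h k * a k)" for h
    using v by (auto simp: N'_def sum_distrib_left algebra_simps intro!: sum.cong)
  have row: "(\<Sum>k\<in>W. N' i k * N' k j) = (if i \<in> W \<and> j \<in> W then (if i = j then 4 else 0) - 2 * a i * a j
      else if i \<in> W \<or> j \<in> W then 0 else if i = j then 2 else - 2 * s * t)"
    if "i \<in> insert v (insert w W)" "j \<in> insert v (insert w W)" for i j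
  proof -
    have "(\<Sum>k\<in>W. N' i k * N' k j) = (if i = j then 4 else 0) - 2 * a i * a j" if "i \<in> W" "j \<in> W"
      using that sq[OF that] N'W by simp
    moreover have "(\<Sum>k\<in>W. N' i k * N' k j) = 0" if "i \<in> W" "j = v \<or> j = w"
      using that N'v(2) N'w(2) N'W(1) null by auto
    moreover have "(\<Sum>k\<in>W. N' i k * N' k j) = 0" if "j \<in> W" "i = v \<or> i = w"
      using that N'v(1) N'w(1) N'W(2) null' by auto
    moreover have "(\<Sum>k\<in>W. N' i k * N' k j) = (if i = j then 2 else - 2 * s * t)" if "i = v \<or> i = w" "j = v \<or> j = w"
      using that N'v N'w two v(3) by (auto simp: ss algebra_simps)
    ultimately show ?thesis using that inW by auto
  qed
  show ?thesis
    unfolding root_state_def sums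
  proof (intro conjI ballI)
    show "finite (insert v (insert w W))" using fin by simp
    show "(a' v)\<^sup>2 + (a' w)\<^sup>2 + (\<Sum>k\<in>W. (a' k)\<^sup>2) = 2"
      using a0(1)[of a'] v(3) s by (simp add: a'_def power2_eq_square)
  next
    fix i j assume "i \<in> insert v (insert w W)" "j \<in> insert v (insert w W)"
    then show "N' i j = N' j i" unfolding N'_def using sym[of i j] v by (elim insertE) auto
  next
    fix i assume "i \<in> insert v (insert w W)"
    then show "N' i v * a' v + N' i w * a' w + (\<Sum>k\<in>W. N' i k * a' k) = 0"
      unfolding a0 using v by (elim insertE) (auto simp: N'_def a'_def ss algebra_simps)

  next
    fix i j assume ij: "i \<in> insert v (insert w W)" "j \<in> insert v (insert w W)"
    show "N' i v * N' v j + N' i w * N' w j + (\<Sum>k\<in>W. N' i k * N' k j) = (if i = j then 4 else 0) - 2 * a' i * a' j"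
      unfolding row[OF ij] using ij inW v s by (auto simp: N'_def a'_def ss algebra_simps)
  qed
qed

lemma anchoredD:
  assumes "anchored V M b" "X \<subseteq> V" "\<And>i. i \<in> X \<Longrightarrow> b i = 0" "\<And>i j. i \<in> X \<Longrightarrow> j \<in> V - X \<Longrightarrow> M j i = 0"
  shows "X = {}"
  using assms(1)[unfolded anchored_def, THEN spec, of X] assms(2-4) by simp

text \<open>Raises the square sum to 2 without touching the data on \<open>V\<close>, so that a null
  vector becomes available. The twin lies in the support of \<open>b'\<close>, hence creates no
  unanchored component.\<close>

lemma twin_state:

  assumes fin: "finite V" and sym: "\<And>i j. i \<in> V \<Longrightarrow> j \<in> V \<Longrightarrow> M i j = M j i"
    and cap: "capped V M b" and anch: "anchored V M b" and one: "(\<Sum>i\<in>V. (b i)\<^sup>2) = 1" and x: "x \<notin> V"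
  obtains M' b' where "capped (insert x V) M' b'" "anchored (insert x V) M' b'"
    "(\<Sum>i\<in>insert x V. (b' i)\<^sup>2) = 2" "\<And>i. i \<in> V \<Longrightarrow> b' i = b i"
    "\<And>i j. i \<in> V \<Longrightarrow> j \<in> V \<Longrightarrow> M' i j = M i j"
    "\<And>i j. i \<in> insert x V \<Longrightarrow> j \<in> insert x V \<Longrightarrow> M' i j = M' j i"
proof -
  have "\<exists>u\<in>V. b u \<noteq> 0" by (rule ccontr) (use one in simp)
  then obtain u where u: "u \<in> V" "b u \<noteq> 0" by blast
  have "0 < (b u)\<^sup>2" using u(2) by simp
  moreover have "(\<Sum>i\<in>V. (b i)\<^sup>2) = (b u)\<^sup>2 + (\<Sum>i\<in>V - {u}. (b i)\<^sup>2)"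
    using u(1) fin by (simp add: sum.remove)
  moreover have "0 \<le> (\<Sum>i\<in>V - {u}. (b i)\<^sup>2)" by (simp add: sum_nonneg)
  ultimately have bu: "(b u)\<^sup>2 = 1" "(\<Sum>i\<in>V - {u}. (b i)\<^sup>2) = 0" using one by linarith+
  then have b0: "\<And>i. i \<in> V - {u} \<Longrightarrow> b i = 0" using fin by (simp add: sum_nonneg_eq_0_iff)
  define p where "p = (\<lambda>i. if i = x then u else i)"
  define \<sigma> :: "nat \<Rightarrow> int" where "\<sigma> = (\<lambda>i. if i = x then -1 else 1)"
  define M' where "M' = (\<lambda>i j. \<sigma> i * \<sigma> j * M (p i) (p j))"
  define b' where "b' = b(x := b u)"
  have c: "capped (insert x V) M' b'"
    unfolding M'_def b'_def p_def \<sigma>_def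
  proof (rule capped_twin[OF fin cap u(1)])
    show "b u * b u = 1" using bu(1) by (simp add: power2_eq_square)
  qed (rule b0, assumption, rule x)
  have s: "M' i j = M' j i" if "i \<in> insert x V" "j \<in> insert x V" for i j
    using that sym u(1) by (auto simp: M'_def p_def)
  have agree: "b' i = b i" "j \<in> V \<Longrightarrow> M' i j = M i j" if "i \<in> V" for i j
    using that x by (auto simp: b'_def M'_def p_def \<sigma>_def)
  have "(\<Sum>i\<in>V. (b' i)\<^sup>2) = 1" using one agree(1) by simp
  then have t: "(\<Sum>i\<in>insert x V. (b' i)\<^sup>2) = 2" using x fin bu by (simp add: b'_def)
  have "anchored (insert x V) M' b'"
    unfolding anchored_def
  proof (intro allI impI)
    fix X assume X: "X \<subseteq> insert x V" "\<forall>i\<in>X. b' i = 0" "\<forall>i\<in>X. \<forall>j\<in>insert x V - X. M' j i = 0"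
    have "x \<notin> X" using X(2) u(2) by (auto simp: b'_def)
    then have XV: "X \<subseteq> V" using X(1) by auto
    show "X = {}"
    proof (rule anchoredD[OF anch XV])
      show "b i = 0" if "i \<in> X" for i using X(2) XV agree(1) that by force
      show "M j i = 0" if "i \<in> X" "j \<in> V - X" for i j using X(3) XV agree(2)[of j i] that by auto
    qed
  qed
  with c show ?thesis using t agree s by (rule that)
qed

text \<open>\<open>F\<close> reserves names: fresh vertices of the recursive call must avoid the
  deleted pair, which is put back afterwards. The size of \<open>V\<close> drops because two
  vertices are removed and at most one twin is added.\<close>

lemma capped_root_state:
  assumes "finite V" "\<And>i j. i \<in> V \<Longrightarrow> j \<in> V \<Longrightarrow> M i j = M j i" "capped V M a"
    "(\<Sum>i\<in>V. (a i)\<^sup>2) = 2" "anchored V M a" "finite F"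
  shows "\<exists>W N a'. root_state W N a' \<and> V \<subseteq> W \<and> (W - V) \<inter> F = {} \<and>
     (\<forall>i\<in>V. a' i = a i) \<and> (\<forall>i\<in>V. \<forall>j\<in>V. N i j = M i j)"
  using assms
proof (induction "card V" arbitrary: V M a F rule: less_induct)
  case less
  note fin = less.prems(1) and sym = less.prems(2) and cap = less.prems(3) and two = less.prems(4)
    and anch = less.prems(5) and finF = less.prems(6)
  obtain v w where vw: "v \<in> V" "w \<in> V" "v \<noteq> w" "a v * a v = 1" "a w * a w = 1"
    and off: "\<And>i. i \<in> V - {v, w} \<Longrightarrow> a i = 0" using sum_two_squares_support[OF fin two] by blast
  define V' where "V' = V - {v, w}"
  have V: "V = insert v (insert w V')" "v \<notin> V'" "w \<notin> V'" "finite V'" using vw fin by (auto simp: V'_def)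
  have sums: "(\<Sum>k\<in>V. h k) = h v + h w + (\<Sum>k\<in>V'. h k)" for h :: "nat \<Rightarrow> 'x::comm_monoid_add"
    using V vw(3) by (simp add: add.assoc)
  define s t where "s = a v" and "t = a w"
  have st: "s * s = 1" "t * t = 1" using vw by (simp_all add: s_def t_def)
  have ss: "s * (s * z) = z" "t * (t * z) = z" for z using st by (simp_all flip: mult.assoc)
  have rest: "(\<Sum>k\<in>V'. h k * a k) = 0" for h :: "nat \<Rightarrow> int" using off by (intro sum.neutral) (simp add: V'_def)
  have "M i v * s + M i w * t = 0" if "i \<in> V" for i
    using capped_null[OF fin sym cap two that] by (simp add: sums rest s_def t_def)
  then have "(M i v * s + M i w * t) * t = 0" if "i \<in> V" for i using that by simp
  then have Mw: "M i w = - s * t * M i v" if "i \<in> V" for i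
    using that ss(2) by (simp add: algebra_simps eq_neg_iff_add_eq_0)
  define d where "d = M v v"
  define b where "b = M v"
  have bV: "M i v = b i" "M v i = b i" "M i w = - s * t * b i" "M w i = - s * t * b i" if "i \<in> V'" for i
    using that sym Mw[of i] V(1) by (auto simp: b_def)
  have corner: "M v v = d" "M v w = - s * t * d" "M w v = - s * t * d" "M w w = d"
    using Mw[of v] Mw[of w] sym[of w v] vw by (simp_all add: d_def ss algebra_simps)
  have rs1: "of_int s * of_int s = (1::real)" "of_int t * of_int t = (1::real)"
    using st by (metis of_int_1 of_int_mult)+
  have rs: "of_int s * (of_int s * z) = z" "of_int t * (of_int t * z) = z" for z :: real
    using rs1 by (simp_all flip: mult.assoc)
  \<comment> \<open>The test vector takes values on the pair that make it orthogonal to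
    \<open>a\<close>, so the cap contributes nothing. What remains is the form on \<open>V'\<close>
    coupled to one real variable \<open>z\<close>.\<close>
  have key: "\<bar>bil V' M y y + 4 * z * (\<Sum>i\<in>V'. of_int (b i) * y i) + 4 * of_int d * z\<^sup>2\<bar> \<le> 2 * (\<Sum>i\<in>V'. (y i)\<^sup>2) + 4 * z\<^sup>2"
    for y :: "nat \<Rightarrow> real" and z
  proof -
    define x where "x = (\<lambda>i. if i = v then z else if i = w then - of_int s * of_int t * z else y i)"
    have xv: "x v = z" "x w = - of_int s * of_int t * z" using vw(3) by (auto simp: x_def)
    have xy: "x i = y i" if "i \<in> V'" for i using that V by (auto simp: x_def)
    have "(\<Sum>i\<in>V'. of_int (a i) * x i) = 0" using off by (intro sum.neutral) (simp add: V'_def)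
    then have l: "(\<Sum>i\<in>V. of_int (a i) * x i) = 0"
      by (simp add: sums xv s_def[symmetric] t_def[symmetric] rs rs1 algebra_simps)

    have n: "(\<Sum>i\<in>V. (x i)\<^sup>2) = 2 * z\<^sup>2 + (\<Sum>i\<in>V'. (y i)\<^sup>2)"
      using xy by (simp add: sums xv rs rs1 power2_eq_square algebra_simps)
    let ?b = "\<Sum>i\<in>V'. of_int (b i) * y i"
    have r1: "(\<Sum>j\<in>V'. of_int (M v j) * x v * x j) = z * ?b" "(\<Sum>j\<in>V'. of_int (M w j) * x w * x j) = z * ?b"
      "(\<Sum>i\<in>V'. of_int (M i v) * x i * x v) = z * ?b" "(\<Sum>i\<in>V'. of_int (M i w) * x i * x w) = z * ?b"
      by (simp_all add: bV xv xy rs rs1 sum_distrib_left algebra_simps)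
    have "bil V M x x = bil V' M y y + 4 * z * ?b + 4 * of_int d * z\<^sup>2"
      unfolding bil_def sums sum.distrib r1 using xy
      unfolding xv corner by (simp add: rs rs1 power2_eq_square algebra_simps)
    then show ?thesis using cappedD[OF cap, of x] unfolding l n by simp
  qed
  have closed: "X = {}" if "X \<subseteq> V'" "\<And>i. i \<in> X \<Longrightarrow> b i = 0" "\<And>i j. i \<in> X \<Longrightarrow> j \<in> V' - X \<Longrightarrow> M j i = 0" for X
  proof -
    have "\<forall>i\<in>X. a i = 0" using that(1) off by (auto simp: V'_def)
    moreover have "\<forall>i\<in>X. \<forall>j\<in>V - X. M j i = 0"
      using that bV V(1) by (auto simp: subset_iff)
    ultimately show ?thesis using anch that(1) V(1) unfolding anchored_def by (meson subset_insertI2)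
  qed
  show ?case
  proof (cases "d = 0")
    \<comment> \<open>A charged pair. Taking y = 0 bounds the charge \<open>d\<close> by 1 in
      absolute value, and then the inequality is tight at y = 0, so its linear term vanishes. Hence
      \<open>b\<close> = 0, and \<open>anchored\<close> leaves no vertex beyond the pair.\<close>
    case False
    have "\<bar>of_int d\<bar> \<le> (1::real)" using key[of "\<lambda>_. 0" 1] by (simp add: bil_def)
    then have "\<bar>d\<bar> \<le> 1" by linarith
    then have dcase: "d = 1 \<or> d = -1" using False by linarith
    then have dd: "d * d = 1" by auto
    have rd: "of_int d * (of_int d * z) = z" for z :: real using dcase by auto
    have "b k = 0" if k: "k \<in> V'" for k
    proof -
      define e where "e = (\<lambda>j. if j = k then 1 else 0 :: real)"
      have be: "(\<Sum>i\<in>V'. of_int (b i) * e i) = of_int (b k)"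
        using V(4) k by (simp add: e_def if_distrib cong: if_cong)
      have "0 \<le> r * (- 4 * of_int d * of_int (b k)) + r\<^sup>2 * (2 * (\<Sum>i\<in>V'. (e i)\<^sup>2) - of_int d * bil V' M e e)" for r
      proof -
        have x: "bil V' M (\<lambda>i. r * e i) (\<lambda>i. r * e i) = r\<^sup>2 * bil V' M e e"
          "(\<Sum>i\<in>V'. of_int (b i) * (r * e i)) = r * of_int (b k)"
          "(\<Sum>i\<in>V'. (r * e i)\<^sup>2) = r\<^sup>2 * (\<Sum>i\<in>V'. (e i)\<^sup>2)"
          unfolding be[symmetric] by (simp_all add: bil_def sum_distrib_left power_mult_distrib power2_eq_square algebra_simps)
        have "\<bar>r\<^sup>2 * bil V' M e e + 4 * r * of_int (b k) + 4 * of_int d\<bar> \<le> 2 * r\<^sup>2 * (\<Sum>i\<in>V'. (e i)\<^sup>2) + 4"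
          using key[of "\<lambda>i. r * e i" 1] unfolding x by (simp add: algebra_simps)
        then have "of_int d * (r\<^sup>2 * bil V' M e e + 4 * r * of_int (b k) + 4 * of_int d) \<le> 2 * r\<^sup>2 * (\<Sum>i\<in>V'. (e i)\<^sup>2) + 4"
          using dcase by auto
        then show ?thesis using dcase by (auto simp: algebra_simps)

      qed
      from linear_coeff_zero[OF this] show ?thesis using False by simp
    qed
    then have "V' = {}" using closed[of V'] by auto
    then have "root_state V M a"
      unfolding root_state_def V(1) using vw st dd corner
      by (auto simp: s_def[symmetric] t_def[symmetric] ss power2_eq_square algebra_simps)

    then show ?thesis by blast
  next
    case d: True
    have cap': "capped V' M b"
      unfolding capped_def
    proof
      fix y :: "nat \<Rightarrow> real"
      let ?b = "\<Sum>i\<in>V'. of_int (b i) * y i"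
      show "?b\<^sup>2 + \<bar>bil V' M y y\<bar> \<le> 2 * (\<Sum>i\<in>V'. (y i)\<^sup>2)"
        \<comment> \<open>Half of \<open>?b\<close> and its negative are the optimal values of the
          eliminated variable for the two forms.\<close>
        using key[of y "?b / 2"] key[of y "- ?b / 2"] d by (simp add: power2_eq_square field_simps)
    qed
    have anch': "anchored V' M b" unfolding anchored_def using closed by blast
    have sym': "M i j = M j i" if "i \<in> V'" "j \<in> V'" for i j using that sym V(1) by blast
    have cV: "card V = card V' + 2" using V vw(3) by simp
    have "\<exists>W N b'. root_state W N b' \<and> V' \<subseteq> W \<and> (W - V') \<inter> (F \<union> {v, w}) = {} \<and>
       (\<forall>i\<in>V'. b' i = b i) \<and> (\<forall>i\<in>V'. \<forall>j\<in>V'. N i j = M i j)"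
    proof -
      have "0 \<le> (\<Sum>i\<in>V'. (b i)\<^sup>2)" by (simp add: sum_nonneg)
      then consider "(\<Sum>i\<in>V'. (b i)\<^sup>2) = 0" | "(\<Sum>i\<in>V'. (b i)\<^sup>2) = 1" | "(\<Sum>i\<in>V'. (b i)\<^sup>2) = 2"
        using capped_weight_le[OF cap'] by linarith
      then show ?thesis
      proof cases
        case 1
        then have "V' = {}" using closed[of V'] V(4) by (auto simp: sum_nonneg_eq_0_iff)
        have "finite (F \<union> {v, w})" using finF by simp
        from ex_new_if_finite[OF infinite_UNIV_nat this] obtain x where x: "x \<notin> F \<union> {v, w}" by (rule exE)
        have "finite (F \<union> {v, w, x})" using finF by simp
        from ex_new_if_finite[OF infinite_UNIV_nat this] obtain y where y: "y \<notin> F \<union> {v, w, x}" by (rule exE)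
        \<comment> \<open>Nothing lies below the pair, so the tube is closed by the smallest state:
          two fresh vertices of charge 1 joined by an edge of weight -1.\<close>
        have "root_state {x, y} (\<lambda>i j. if i = j then 1 else -1) (\<lambda>_. 1)"
          using y by (auto simp: root_state_def)
        then show ?thesis using x y \<open>V' = {}\<close>
          by (intro exI[of _ "{x, y}"] exI[of _ "\<lambda>i j. if i = j then 1 else -1"] exI[of _ "\<lambda>_. 1"]) auto
      next
        case 2
        have "finite (F \<union> {v, w} \<union> V')" using finF V(4) by simp
        from ex_new_if_finite[OF infinite_UNIV_nat this] obtain x where x: "x \<notin> F \<union> {v, w} \<union> V'" by (rule exE)
        then have xV: "x \<notin> V'" by blast
        obtain M2 b2 where M2: "capped (insert x V') M2 b2" "anchored (insert x V') M2 b2"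
          "(\<Sum>i\<in>insert x V'. (b2 i)\<^sup>2) = 2" "\<And>i. i \<in> V' \<Longrightarrow> b2 i = b i"
          "\<And>i j. i \<in> V' \<Longrightarrow> j \<in> V' \<Longrightarrow> M2 i j = M i j"
          "\<And>i j. i \<in> insert x V' \<Longrightarrow> j \<in> insert x V' \<Longrightarrow> M2 i j = M2 j i"
          by (rule twin_state[
OF V(4) sym' cap' anch' 2 xV]) (assumption | rule that)+
        have "card (insert x V') < card V" using cV xV V(4) by simp
        then obtain W N b' where "root_state W N b'" "insert x V' \<subseteq> W" "(W - insert x V') \<inter> (F \<union> {v, w}) = {}"
          "\<forall>i\<in>insert x V'. b' i = b2 i" "\<forall>i\<in>insert x V'. \<forall>j\<in>insert x V'. N i j = M2 i j"
          using less.hyps[of "insert x V'" M2 b2 "F \<union> {v, w}"] V(4) finF M2 by auto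
        then show ?thesis using x M2(4,5) by (intro exI[of _ W] exI[of _ N] exI[of _ b']) auto
      next
        case 3
        then show ?thesis using less.hyps[of V' M b "F \<union> {v, w}"] V(4) sym' cap' anch' finF cV by auto
      qed
    qed
    then obtain W N b' where W: "root_state W N b'" "V' \<subseteq> W" "(W - V') \<inter> (F \<union> {v, w}) = {}"
      "\<forall>i\<in>V'. b' i = b i" "\<forall>i\<in>V'. \<forall>j\<in>V'. N i j = M i j" by blast
    have vwW: "v \<notin> W" "w \<notin> W" using W(3) V by auto
    define N' where "N' = (\<lambda>i j. if i \<in> W \<and> j \<in> W then N i j
      else if i = v \<and> j \<in> W then b' j else if i = w \<and> j \<in> W then - s * t * b' j
      else if j = v \<and> i \<in> W then b' i else if j = w \<and> i \<in> W then - s * t * b' i else 0)"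
    define a' where "a' = (\<lambda>i. if i = v then s else if i = w then t else 0)"
    have "root_state (insert v (insert w W)) N' a'"
      unfolding N'_def a'_def by (rule root_state_extend[OF W(1) vwW vw(3) st])
    moreover have "V \<subseteq> insert v (insert w W)" using W(2) V(1) by auto
    moreover have "(insert v (insert w W) - V) \<inter> F = {}" using W(3) V by auto
    moreover have "\<forall>i\<in>V. a' i = a i" using off by (simp add: a'_def s_def t_def)
    moreover have "N' i j = M i j" if "i \<in> V" "j \<in> V" for i j
    proof -
      have "i = v \<or> i = w \<or> i \<in> V'" "j = v \<or> j = w \<or> j \<in> V'" using that V(1) by auto
      moreover have "k \<in> V' \<Longrightarrow> k \<in> W" for k using W(2) by auto
      ultimately show ?thesis
        using W(4,5) vwW V(2,3) vw(3) bV corner d by (elim disjE) (simp_all add: N'_def)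
    qed
    ultimately show ?thesis by blast
  qed
qed

text \<open>Closing with the root vector itself could change \<open>M\<close> on \<open>V\<close>.
  One more layer is therefore attached, and the closing term \<open>c c^T\<close> lives on its two
  fresh vertices. As \<open>N' c = 0\<close> and \<open>c\<close> has square sum 2, the square of
  \<open>N' + c c^T\<close> is \<open>(4 - 2 c c^T) + 2 c c^T\<close>.\<close>

lemma capped_square_four:
  assumes fin: "finite V" and sym: "\<And>i j. i \<in> V \<Longrightarrow> j \<in> V \<Longrightarrow> M i j = M j i"
    and cap: "capped V M a" and anch: "anchored V M a" and one: "(\<Sum>i\<in>V. (a i)\<^sup>2) = 1"
  obtains W N where "finite W" "V \<subseteq> W" "\<And>i j. i \<in> V \<Longrightarrow> j \<in> V \<Longrightarrow> N i j = M i j"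
    "\<And>i j. i \<in> W \<Longrightarrow> j \<in> W \<Longrightarrow> N i j = N j i"
    "\<And>i j. i \<in> W \<Longrightarrow> j \<in> W \<Longrightarrow> (\<Sum>k\<in>W. N i k * N k j) = (if i = j then 4 else 0 :: int)"
proof -
  from ex_new_if_finite[OF infinite_UNIV_nat fin] obtain x where x: "x \<notin> V" by (rule exE)
  obtain M1 b1 where M1: "capped (insert x V) M1 b1" "anchored (insert x V) M1 b1"
    "(\<Sum>i\<in>insert x V. (b1 i)\<^sup>2) = 2" "\<And>i. i \<in> V \<Longrightarrow> b1 i = a i" "\<And>i j. i \<in> V \<Longrightarrow> j \<in> V \<Longrightarrow> M1 i j = M i j"
    "\<And>i j. i \<in> insert x V \<Longrightarrow> j \<in> insert x V \<Longrightarrow> M1 i j = M1 j i"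
    by (rule twin_state[OF fin sym cap anch one x]) (assumption | rule that)+
  have "finite (insert x V)" using fin by simp
  from capped_root_state[OF this M1(6,1,3,2), of "{}"] obtain W N a' where
    W: "root_state W N a'" "insert x V \<subseteq> W" "\<forall>i\<in>insert x V. \<forall>j\<in>insert x V. N i j = M1 i j" by auto
  have finW: "finite W" using W(1) by (simp add: root_state_def)
  from ex_new_if_finite[OF infinite_UNIV_nat finW] obtain v where v: "v \<notin> W" by (rule exE)
  have "finite (insert v W)" using finW by simp
  from ex_new_if_finite[OF infinite_UNIV_nat this] obtain w where w: "w \<notin> insert v W" by (rule exE)
  define W' where "W' = insert v (insert w W)"
  define N' where "N' = (\<lambda>i j. if i \<in> W \<and> j \<in> W then N i j
      else if i = v \<and> j \<in> W then a' j else if i = w \<and> j \<in> W then - 1 * 1 * a' j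
      else if j = v \<and> i \<in> W then a' i else if j = w \<and> i \<in> W then - 1 * 1 * a' i else 0)"
  define c :: "nat \<Rightarrow> int" where "c = (\<lambda>i. if i = v then 1 else if i = w then 1 else 0)"
  have rs: "root_state W' N' c"
    unfolding W'_def N'_def c_def by (rule root_state_extend[OF W(1) v]) (use w in auto)
  then have finW': "finite W'" and symN': "\<And>i j. i \<in> W' \<Longrightarrow> j \<in> W' \<Longrightarrow> N' i j = N' j i"
    and two: "(\<Sum>i\<in>W'. c i * c i) = 2" and null: "\<And>i. i \<in> W' \<Longrightarrow> (\<Sum>j\<in>W'. N' i j * c j) = 0"
    and sq: "\<And>i j. i \<in> W' \<Longrightarrow> j \<in> W' \<Longrightarrow> (\<Sum>k\<in>W'. N' i k * N' k j) = (if i = j then 4 else 0) - 2 * c i * c j"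
    unfolding root_state_def by (auto simp: power2_eq_square)
  show ?thesis
  proof (rule that[of W' "\<lambda>i j. N' i j + c i * c j"])
    show "finite W'" by (rule finW')
    show "V \<subseteq> W'" using W(2) by (auto simp: W'_def)
  next
    fix i j assume "i \<in> V" "j \<in> V"
    then show "N' i j + c i * c j = M i j"
      using W(2,3) M1(5)[of i j]
 v w by (auto simp: N'_def c_def)
  next
    fix i j assume ij: "i \<in> W'" "j \<in> W'"
    show "N' i j + c i * c j = N' j i + c j * c i" using symN'[OF ij] by simp
  next
    fix i j assume ij: "i \<in> W'" "j \<in> W'"
    have n2: "(\<Sum>k\<in>W'. c k * N' k j) = 0"
    proof -
      have "(\<Sum>k\<in>W'. c k * N' k j) = (\<Sum>k\<in>W'. N' j k * c k)"
        using symN'[OF ij(2)] by (intro sum.cong refl) simp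
      then show ?thesis using null[OF ij(2)] by simp
    qed
    have "(\<Sum>k\<in>W'. (N' i k + c i * c k) * (N' k j + c k * c j))
        = (\<Sum>k\<in>W'. N' i k * N' k j) + c j * (\<Sum>k\<in>W'. N' i k * c k)
          + c i * (\<Sum>k\<in>W'. c k * N' k j) + c i * c j * (\<Sum>k\<in>W'. c k * c k)"
      by (simp add: sum.distrib sum_distrib_left algebra_simps)
    then show "(\<Sum>k\<in>W'. (N' i k + c i * c k) * (N' k j + c k * c j)) = (if i = j then 4 else 0)"
      unfolding sq[OF ij] null[OF ij(1)] n2 two by simp
  qed
qed

section \<open>Long geodesics in large extensions\<close>

lemma bil_insert:
  assumes "finite V" "j \<notin> V" "i \<in> V" and sym: "\<And>i j. M i j = M j i" and far: "\<And>z. z \<in> V \<Longrightarrow> z \<noteq> i \<Longrightarrow> M z j = 0"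
  shows "bil (insert j V) M x x = bil V M x x + 2 * of_int (M i j) * x i * x j + of_int (M j j) * (x j)\<^sup>2"
proof -
  have "(\<Sum>z\<in>V. of_int (M z j) * x z * x j) = (\<Sum>z\<in>V. if z = i then of_int (M i j) * x i * x j else 0)"
    using far by (intro sum.cong refl) auto
  also have "\<dots> = of_int (M i j) * x i * x j" using assms(1,3) by simp
  finally have 1: "(\<Sum>z\<in>V. of_int (M z j) * x z * x j) = of_int (M i j) * x i * x j" .
  have "(\<Sum>z\<in>V. of_int (M j z) * x j * x z) = (\<Sum>z\<in>V. of_int (M z j) * x z * x j)"
    by (intro sum.cong refl) (simp add: sym[of j] algebra_simps)
  then show ?thesis
    using assms(1,2) 1 by (simp add: bil_def sum.distrib power2_eq_square algebra_simps)
qed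

text \<open>Expand the nonnegative squared norm of \<open>(A + t) z\<close> at t = 2 and t = -2, and
  bound the squared norm of \<open>A z\<close> by contractivity.\<close>

lemma contractive_bil:
  assumes con: "contractive U (\<lambda>i j. of_int (M i j))" and U: "finite U" "S \<subseteq> U"
  shows "\<bar>bil S M x x\<bar> \<le> 2 * (\<Sum>i\<in>S. (x i)\<^sup>2)"
proof -
  define z where "z i = (if i \<in> S then x i else 0)" for i
  let ?A = "apply_on U (\<lambda>i j. of_int (M i j)) z"
  have "(\<Sum>i\<in>U. z i * ?A i) = (\<Sum>i\<in>S. x i * ?A i)"
    using U by (intro sum.mono_neutral_cong_right) (auto simp: z_def)
  also have "\<dots> = bil S M x x"
    unfolding bil_def apply_on_def sum_distrib_left
    using U by (intro sum.cong refl sum.mono_neutral_cong_right) (auto simp: z_def algebra_simps)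
  finally have b: "(\<Sum>i\<in>U. z i * ?A i) = bil S M x x" .
  have n: "(\<Sum>i\<in>U. (z i)\<^sup>2) = (\<Sum>i\<in>S. (x i)\<^sup>2)"
    using U by (intro sum.mono_neutral_cong_right) (auto simp: z_def)
  have "(\<Sum>i\<in>U. (?A i)\<^sup>2) \<le> 4 * (\<Sum>i\<in>S. (x i)\<^sup>2)"
    using con n unfolding contractive_def by metis
  moreover have "0 \<le> (\<Sum>i\<in>U. (?A i + t * z i)\<^sup>2)" for t by (simp add: sum_nonneg)
  then have "0 \<le> (\<Sum>i\<in>U. (?A i)\<^sup>2) + 2 * t * bil S M x x + t\<^sup>2 * (\<Sum>i\<in>S. (x i)\<^sup>2)" for t
    unfolding sum_square_add n b[symmetric] by (simp add: mult.commute)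
  from this[of 2] this[of "-2"] have "0 \<le> (\<Sum>i\<in>U. (?A i)\<^sup>2) + 4 * bil S M x x + 4 * (\<Sum>i\<in>S. (x i)\<^sup>2)"
    "0 \<le> (\<Sum>i\<in>U. (?A i)\<^sup>2) - 4 * bil S M x x + 4 * (\<Sum>i\<in>S. (x i)\<^sup>2)" by simp_all
  ultimately show ?thesis by linarith
qed

definition attached :: "(nat \<Rightarrow> nat \<Rightarrow> int) \<Rightarrow> nat set \<Rightarrow> (nat \<Rightarrow> nat) \<Rightarrow> nat \<Rightarrow> bool" where
  "attached M V u k \<longleftrightarrow> u 0 \<in> V \<and> (\<forall>j<k. u (Suc j) \<notin> V \<union> u ` {..j} \<and>
     M (u j) (u (Suc j)) * M (u j) (u (Suc j)) = 1 \<and>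
     (\<forall>z\<in>V \<union> u ` {..j}. z \<noteq> u j \<longrightarrow> M z (u (Suc j)) = 0))"

text \<open>Edge signs along a path can be switched away, so all edge terms of a test vector can be
  given the same sign \<open>t\<close>. The two values of \<open>t\<close> let one \<open>w\<close>
  serve both \<open>2 - M\<close> and \<open>2 + M\<close>; \<open>s\<close> is the sign accumulated
  so far, recorded for the induction.\<close>

lemma attached_form:
  fixes w :: "nat \<Rightarrow> real"
  assumes "finite V" and sym: "\<And>i j. M i j = M j i" and "attached M V u k" and t: "t * t = 1" and "w 0 = y (u 0)"
  shows "\<exists>x s. s * s = 1 \<and> x (u k) = s * w k \<and> (\<forall>z\<in>V. x z = y z) \<and>
    bil (V \<union> u ` {..k}) M x x = bil V M y y +
      (\<Sum>j<k. 2 * t * w j * w (Suc j) + of_int (M (u (Suc j)) (u (Suc j))) * (w (Suc j))\<^sup>2) \<and>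
    (\<Sum>i\<in>V \<union> u ` {..k}. (x i)\<^sup>2) = (\<Sum>i\<in>V. (y i)\<^sup>2) + (\<Sum>j<k. (w (Suc j))\<^sup>2)"
  using assms(3)
proof (induction k)
  case 0
  have V: "V \<union> u ` {..0} = V" using 0 by (auto simp: attached_def)
  have "(\<lambda>s x. s * s = 1 \<and> x (u 0) = s * w 0) 1 y" using assms(5) by simp
  then show ?case unfolding V by (intro exI[of _ y] exI[of _ 1]) simp
next
  case (Suc k)
  let ?V = "V \<union> u ` {..k}" and ?n = "u (Suc k)"
  define m :: real where "m = of_int (M (u k) ?n)"
  have k: "?n \<notin> ?V" and far: "\<And>z. z \<in> ?V \<Longrightarrow> z \<noteq> u k \<Longrightarrow> M z ?n = 0" and fin: "finite ?V"
    and mm: "M (u k) ?n * M (u k) ?n = 1"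
    using Suc.prems assms(1) by (auto simp: attached_def)
  have m: "m * m = 1" using mm unfolding m_def by (metis of_int_1 of_int_mult)
  have "attached M V u k" using Suc.prems by (simp add: attached_def)
  with Suc.IH obtain x s where x: "s * s = 1" "x (u k) = s * w k" "\<forall>z\<in>V. x z = y z"
    "bil ?V M x x = bil V M y y + (\<Sum>j<k. 2 * t * w j * w (Suc j) + of_int (M (u (Suc j)) (u (Suc j))) * (w (Suc j))\<^sup>2)"
    "(\<Sum>i\<in>?V. (x i)\<^sup>2) = (\<Sum>i\<in>V. (y i)\<^sup>2) + (\<Sum>j<k. (w (Suc j))\<^sup>2)" by blast
  define r where "r = t * s * m"
  have "r * r = (t * t) * (s * s) * (m * m)" by (simp add: r_def)
  then have r: "r * r = 1" using x(1) t m by simp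
  define x' where "x' = x(?n := r * w (Suc k))"
  have x': "x' z = x z" if "z \<in> ?V" for z using that k by (auto simp: x'_def)
  have uk: "u k \<in> ?V" by auto
  have V: "V \<union> u ` {..Suc k} = insert ?n ?V" by (auto simp: atMost_Suc)
  have "bil (insert ?n ?V) M x' x' = bil ?V M x' x' + 2 * m * x' (u k) * x' ?n + of_int (M ?n ?n) * (x' ?n)\<^sup>2"
    unfolding m_def by (rule bil_insert[OF fin k uk]) (rule sym, rule far)
  also have "bil ?V M x' x' = bil ?V M x x" by (rule bil_cong) (simp_all only: x')
  also have "2 * m * x' (u k) * x' ?n = 2 * (m * m) * (s * s) * t * w k * w (Suc k)"
    by (simp add: x'[OF uk] x(2)) (simp add: x'_def r_def)
  also have "\<dots> = 2 * t * w k * w (Suc k)" using m x(1) by simp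
  also have "(x' ?n)\<^sup>2 = (r * r) * (w (Suc k))\<^sup>2" by (simp add: x'_def power2_eq_square)
  finally have b: "bil (insert ?n ?V) M x' x' = bil ?V M x x + 2 * t * w k * w (Suc k) + of_int (M ?n ?n) * (w (Suc k))\<^sup>2"
    using r by simp
  have "(\<Sum>i\<in>insert ?n ?V. (x' i)\<^sup>2) = (x' ?n)\<^sup>2 + (\<Sum>i\<in>?V. (x' i)\<^sup>2)" using fin k by simp
  also have "(\<Sum>i\<in>?V. (x' i)\<^sup>2) = (\<Sum>i\<in>?V. (x i)\<^sup>2)" by (intro sum.cong refl) (simp only: x')
  also have "(x' ?n)\<^sup>2 = (r * r) * (w (Suc k))\<^sup>2" by (simp add: x'_def power2_eq_square)
  finally have n: "(\<Sum>i\<in>insert ?n ?V. (x' i)\<^sup>2) = (w (Suc k))\<^sup>2 + (\<Sum>i\<in>?V. (x i)\<^sup>2)" using r by simp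
  have "\<forall>z\<in>V. x' z = y z" using x' x(3) by simp
  moreover have "x' ?n = r * w (Suc k)" by (simp add: x'_def)
  ultimately show ?case
    unfolding V using r by (intro exI[of _ x'] exI[of _ r]) (simp add: b n x(4,5))
qed

lemma attached_bound:
  fixes w :: "nat \<Rightarrow> real"
  assumes con: "contractive U (\<lambda>i j. of_int (M i j))" and U: "finite U" "V \<subseteq> U" "u ` {..k} \<subseteq> U"
    and sym: "\<And>i j. M i j = M j i" and att: "attached M V u k" and t: "t * t = 1" and w: "w 0 = y (u 0)"
  shows "\<bar>bil V M y y + (\<Sum>j<k. 2 * t * w j * w (Suc j) + of_int (M (u (Suc j)) (u (Suc j))) * (w (Suc j))\<^sup>2)\<bar>
    \<le> 2 * (\<Sum>i\<in>V. (y i)\<^sup>2) + 2 * (\<Sum>j<k. (w (Suc j))\<^sup>2)"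
proof -
  have "finite V" using U by (auto intro: finite_subset)
  from attached_form[where M = M and y = y and w = w, OF this sym att t w] obtain x where
    "bil (V \<union> u ` {..k}) M x x = bil V M y y +
      (\<Sum>j<k. 2 * t * w j * w (Suc j) + of_int (M (u (Suc j)) (u (Suc j))) * (w (Suc j))\<^sup>2)"
    "(\<Sum>i\<in>V \<union> u ` {..k}. (x i)\<^sup>2) = (\<Sum>i\<in>V. (y i)\<^sup>2) + (\<Sum>j<k. (w (Suc j))\<^sup>2)" by blast
  moreover have "\<bar>bil (V \<union> u ` {..k}) M x x\<bar> \<le> 2 * (\<Sum>i\<in>V \<union> u ` {..k}. (x i)\<^sup>2)"
    using contractive_bil[OF con U(1)] U by simp
  ultimately show ?thesis by (simp only: distrib_left)
qed

text \<open>Two test vectors on the path, one for $2 - M$ and one for $2 + M$, whose squares differ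
  only at the middle vertex; the total energy 180 is beaten by a charge of weight $15^2 - 5^2$.\<close>
lemma path_middle_uncharged:
  assumes con: "contractive U (\<lambda>i j. of_int (M i j))" and U: "finite U" "u ` {..10} \<subseteq> U"
    and sym: "\<And>i j. M i j = M j i" and att: "attached M {u 0} u 10"
  shows "M (u 5) (u 5) = 0"
proof -
  define w where "w m k = [2, 4, 6, 8, 10, m, 10, 8, 6, 4, 2 :: real] ! k" for m k
  have b: "\<bar>bil {u 0} M (\<lambda>_. 2) (\<lambda>_. 2) + (\<Sum>j<10. 2 * t * w m j * w m (Suc j) + of_int (M (u (Suc j)) (u (Suc j))) * (w m (Suc j))\<^sup>2)\<bar>
    \<le> 2 * (\<Sum>i\<in>{u 0}. 2\<^sup>2) + 2 * (\<Sum>j<10. (w m (Suc j))\<^sup>2)" if "t * t = 1" for t m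
    using that U by (intro attached_bound[where M = M, OF con U(1) _ U(2) sym att]) (auto simp: w_def)
  define c :: "nat \<Rightarrow> real" where "c j = of_int (M (u j) (u j))" for j
  have "\<bar>4 * c 0 + 16 * c 1 + 36 * c 2 + 64 * c 3 + 100 * c 4 + m\<^sup>2 * c 5 + 100 * c 6 + 64 * c 7 + 36 * c 8
      + 16 * c 9 + 4 * c 10 + t * (640 + 40 * m)\<bar> \<le> 2 * (440 + m\<^sup>2)" if "t * t = 1" for t m
    using b[OF that, of m] by (simp add: bil_def w_def c_def eval_nat_numeral algebra_simps)
  \<comment> \<open>At both m = 15 and m = 5, symmetric about the minimum m = 10, the slack
    \<open>2 * (440 + m^2) - (640 + 40 * m)\<close> is 90. The two charge sums differ by
    \<open>200 * c 5\<close> and each is at most 90 in absolute value.\<close>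
  from this[of 1 15] this[of "-1" 15] this[of 1 5] this[of "-1" 5]
  have "\<bar>c 5\<bar> < 1" by (simp add: abs_le_iff)
  then show ?thesis unfolding c_def by linarith
qed

text \<open>A linearly decreasing test vector on the path reduces the energy at its root by nearly 1.\<close>
lemma attached_capped:
  assumes con: "contractive U (\<lambda>i j. of_int (M i j))" and U: "finite U" "V \<subseteq> U" "u ` {..k} \<subseteq> U"
    and sym: "\<And>i j. M i j = M j i" and att: "attached M V u k"
    and unch: "\<And>j. j < k \<Longrightarrow> M (u (Suc j)) (u (Suc j)) = 0"
  shows "\<bar>bil V M y y\<bar> + (y (u 0))\<^sup>2 \<le> 2 * (\<Sum>i\<in>V. (y i)\<^sup>2) + (y (u 0))\<^sup>2 / real (Suc k)"
proof -
  define d where "d = y (u 0) / real (Suc k)"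
  define w where "w j = y (u 0) - real j * d" for j
  have w: "w 0 = y (u 0)" by (simp add: w_def)
  \<comment> \<open>Telescopes by \<open>2 q^2 - 2 p q = (p - q)^2 + q^2 - p^2\<close> with constant
    difference \<open>d\<close>. The weights would reach 0 one step beyond the end of the
    path.\<close>
  have "(\<Sum>j<m. 2 * (w (Suc j))\<^sup>2 - 2 * w j * w (Suc j)) = real m * d\<^sup>2 + (w m)\<^sup>2 - (y (u 0))\<^sup>2" for m
    by (induction m) (simp_all add: w_def power2_eq_square algebra_simps)
  moreover have y0: "y (u 0) = real (Suc k) * d" by (simp add: d_def)
  then have "w k = d" by (simp add: w_def algebra_simps)
  moreover have "(y (u 0))\<^sup>2 / real (Suc k) = real (Suc k) * d\<^sup>2"
    unfolding y0 by (simp add: power2_eq_square)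
  ultimately have e: "(\<Sum>j<k. 2 * (w (Suc j))\<^sup>2 - 2 * w j * w (Suc j)) = (y (u 0))\<^sup>2 / real (Suc k) - (y (u 0))\<^sup>2"
    by (simp add: algebra_simps)
  have "(\<Sum>j<k. 2 * t * w j * w (Suc j) + of_int (M (u (Suc j)) (u (Suc j))) * (w (Suc j))\<^sup>2)
      = t * (\<Sum>j<k. 2 * w j * w (Suc j))" for t
    unfolding sum_distrib_left using unch by (intro sum.cong refl) simp
  then have "\<bar>bil V M y y + t * (\<Sum>j<k. 2 * w j * w (Suc j))\<bar> \<le> 2 * (\<Sum>i\<in>V. (y i)\<^sup>2) + 2 * (\<Sum>j<k. (w (Suc j))\<^sup>2)"
    if "t * t = 1" for t using attached_bound[where M = M and y = y and w = w, OF con U sym att that w] by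
 simp
  from this[of 1] this[of "-1"]
  have "\<bar>bil V M y y\<bar> + (\<Sum>j<k. 2 * w j * w (Suc j)) \<le> 2 * (\<Sum>i\<in>V. (y i)\<^sup>2) + 2 * (\<Sum>j<k. (w (Suc j))\<^sup>2)"
    by simp
  then show ?thesis using e by (simp add: sum_subtractf sum_distrib_left)
qed

section \<open>Balls, spheres and geodesics\<close>

fun reach :: "(nat \<Rightarrow> nat \<Rightarrow> int) \<Rightarrow> nat \<Rightarrow> nat set \<Rightarrow> nat \<Rightarrow> nat set" where
  "reach M p S 0 = S"
| "reach M p S (Suc k) = reach M p S k \<union> (\<Union>i\<in>reach M p S k. {j\<in>{..<p}. M j i \<noteq> 0})"

lemma reach_mono: "k \<le> l \<Longrightarrow> reach M p S k \<subseteq> reach M p S l"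
  by (induction rule: dec_induct) auto

lemma reach_bounded: "S \<subseteq> {..<p} \<Longrightarrow> reach M p S k \<subseteq> {..<p}"
  by (induction k) auto

lemma contractive_degree:
  fixes M :: "nat \<Rightarrow> nat \<Rightarrow> int"
  assumes "contractive {..<p} (\<lambda>i j. of_int (M i j))" "i < p"
  shows "(\<Sum>j<p. (M j i)\<^sup>2) \<le> 4" "card {j\<in>{..<p}. M j i \<noteq> 0} \<le> 4"
proof -
  have "of_int (\<Sum>j<p. (M j i)\<^sup>2) \<le> (of_int 4 :: real)"
    using contractive_column[OF assms(1) finite_lessThan, of i] assms(2) by simp
  then show s: "(\<Sum>j<p. (M j i)\<^sup>2) \<le> 4" unfolding of_int_le_iff .
  have "int (card {j\<in>{..<p}. M j i \<noteq> 0}) = (\<Sum>j\<in>{j\<in>{..<p}. M j i \<noteq> 0}. 1)" by simp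
  also have "\<dots> \<le> (\<Sum>j\<in>{j\<in>{..<p}. M j i \<noteq> 0}. (M j i)\<^sup>2)"
  proof (rule sum_mono)
    fix j assume "j \<in> {j\<in>{..<p}. M j i \<noteq> 0}"
    then have "0 < (M j i)\<^sup>2" by simp
    then show "1 \<le> (M j i)\<^sup>2" by linarith
  qed
  also have "\<dots> \<le> (\<Sum>j<p. (M j i)\<^sup>2)" by (rule sum_mono2) auto
  finally show "card {j\<in>{..<p}. M j i \<noteq> 0} \<le> 4" using s by linarith
qed

text \<open>A column has at most four nonzero entries, so each step enlarges a ball at most
  fivefold.\<close>

lemma reach_card:
  assumes con: "contractive {..<p} (\<lambda>i j. of_int (M i j))" and S: "S \<subseteq> {..<p}"
  shows "card (reach M p S k) \<le> card S * 5 ^ k"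
proof (induction k)
  case (Suc k)
  have fin: "finite (reach M p S k)" using reach_bounded[OF S] by (rule finite_subset) simp
  have "card (\<Union>i\<in>reach M p S k. {j\<in>{..<p}. M j i \<noteq> 0}) \<le> (\<Sum>i\<in>reach M p S k. card {j\<in>{..<p}. M j i \<noteq> 0})"
    using fin by (rule card_UN_le)
  also have "\<dots> \<le> (\<Sum>i\<in>reach M p S k. 4)"
    using contractive_degree(2)[OF con] reach_bounded[OF S] by (intro sum_mono) blast
  finally have "card (reach M p S (Suc k)) \<le> card (reach M p S k) + card (reach M p S k) * 4"
    using card_Un_le[of "reach M p S k" "\<Union>i\<in>reach M p S k. {j\<in>{..<p}. M j i \<noteq> 0}"] by simp
  then show ?case using Suc.IH by simp
qed simp

definition layer :: "(nat \<Rightarrow> nat \<Rightarrow> int) \<Rightarrow> nat \<Rightarrow> nat set \<Rightarrow> nat \<Rightarrow> nat set" where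
  "layer M p S k = (case k of 0 \<Rightarrow> S | Suc l \<Rightarrow> reach M p S k - reach M p S l)"

text \<open>Backtracking: a vertex first reached at step \<open>Suc L\<close> has a neighbour first
  reached at step \<open>L\<close>, since an earlier neighbour would have reached it sooner.\<close>

lemma layer_path:
  assumes "v \<in> layer M p S L"
  shows "\<exists>u. u L = v \<and> (\<forall>k\<le>L. u k \<in> layer M p S k) \<and> (\<forall>k<L. M (u (Suc k)) (u k) \<noteq> 0)"
  using assms
proof (induction L arbitrary: v)
  case 0
  then show ?case by (intro exI[of _ "\<lambda>_. v"]) simp
next
  case (Suc L)
  then have v: "v \<in> reach M p S (Suc L)" "v \<notin> reach M p S L" by (simp_all add: layer_def del: reach.simps)
  then obtain i where i: "i \<in> reach M p S L" "v < p" "M v i \<noteq> 0"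
    unfolding reach.simps by blast
  have "i \<in> layer M p S L"
  proof (cases L)
    case (Suc l)
    then have "i \<notin> reach M p S l" using v(2) i(2,3) by auto
    then show ?thesis using i(1) Suc by (simp add: layer_def)
  qed (use i in \<open>simp add: layer_def\<close>)
  then obtain u where u: "u L = i" "\<forall>k\<le>L. u k \<in> layer M p S k" "\<forall>k<L. M (u (Suc k)) (u k) \<noteq> 0"
    using Suc.IH by blast
  show ?case
  proof (rule exI[of _ "u(Suc L := v)"], intro conjI allI impI)
    show "(u(Suc L := v)) (Suc L) = v" by simp
    fix k
    show "k \<le> Suc L \<Longrightarrow> (u(Suc L := v)) k \<in> layer M p S k" using u(2) Suc.prems by (auto simp: le_Suc_eq)
    show "k < Suc L \<Longrightarrow> M ((u(Suc L := v)) (Suc k)) ((u(Suc L := v)) k) \<noteq> 0"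
      using u(1,3) i(3) by (auto simp: less_Suc_eq)
  qed
qed

lemma layer_nonempty:
  assumes con: "contractive {..<p} (\<lambda>i j. of_int (M i j))" and S: "S \<subseteq> {..<p}" "S \<noteq> {}"
    and conn: "\<And>X. S \<subseteq> X \<Longrightarrow> X \<subseteq> {..<p} \<Longrightarrow> X \<noteq> {..<p} \<Longrightarrow> \<exists>i\<in>X. \<exists>j\<in>{..<p} - X. M j i \<noteq> 0"
    and big: "card S * 5 ^ L < p"
  shows "layer M p S L \<noteq> {}"
proof (cases L)
  case 0 then show ?thesis using S(2) by (simp add: layer_def)
next
  case (Suc l)
  have "card (reach M p S l) \<le> card S * 5 ^ l" by (rule reach_card[OF con S(1)])
  also have "\<dots> \<le> card S * 5 ^ L" using Suc by (simp add: power_increasing)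
  finally have "card (reach M p S l) < p" using big by simp
  then have "reach M p S l \<noteq> {..<p}" by (intro notI) simp
  moreover have "S \<subseteq> reach M p S l" using reach_mono[of 0 l M p S] by simp
  ultimately obtain i j where "i \<in> reach M p S l" "j \<in> {..<p} - reach M p S l" "M j i \<noteq> 0"
    using conn[of "reach M p S l"] reach_bounded[OF S(1)] by blast
  then have "j \<in> reach M p S (Suc l) - reach M p S l" by auto
  then show ?thesis using Suc by (auto simp: layer_def)
qed

text \<open>A geodesic of length $l + 12$ leaving $S$ has no charge at distance 6 or more from either of
  its ends, hence an uncharged tail of length $l$ behind its sixth vertex.\<close>
lemma large_extension:
  assumes con: "contractive {..<p} (\<lambda>i j. of_int (M i j))" and sym: "\<And>i j. M i j = M j i"
    and S: "S \<subseteq> {..<p}" "S \<noteq> {}"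
    and conn: "\<And>X. S \<subseteq> X \<Longrightarrow> X \<subseteq> {..<p} \<Longrightarrow> X \<noteq> {..<p} \<Longrightarrow> \<exists>i\<in>X. \<exists>j\<in>{..<p} - X. M j i \<noteq> 0"
    and big: "card S * 5 ^ (l + 12) < p"
  obtains u where "u 0 \<in> S" "inj_on u {1..6}" "u ` {1..6} \<subseteq> {..<p} - S" "\<And>k. k < 6 \<Longrightarrow> M (u k) (u (Suc k)) \<noteq> 0"
    "\<And>y. \<bar>bil (S \<union> u ` {1..6}) M y y\<bar> + (y (u 6))\<^sup>2
       \<le> 2 * (\<Sum>i\<in>S \<union> u ` {1..6}. (y i)\<^sup>2) + (y (u 6))\<^sup>2 / real (Suc l)"
proof -
  let ?L = "l + 12"
  obtain v where "v \<in> layer M p S ?L" using layer_nonempty[OF con S conn big] by blast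
  from layer_path[OF this] obtain u where u: "\<And>k. k \<le> ?L \<Longrightarrow> u k \<in> layer M p S k"
    and edge: "\<And>k. k < ?L \<Longrightarrow> M (u (Suc k)) (u k) \<noteq> 0" by blast
  have in_reach: "u k \<in> reach M p S j" if "k \<le> j" "k \<le> ?L" for j k
  proof -
    have "u k \<in> reach M p S k" using u[OF that(2)] by (cases k) (auto simp: layer_def)
    then show ?thesis using reach_mono[OF that(1)] by blast
  qed
  have not_reach: "u k \<notin> reach M p S j" if jk: "j < k" "k \<le> ?L" for j k
  proof -
    obtain m where m: "k = Suc m" "j \<le> m" using jk(1) by (cases k) auto
    then have "u k \<notin> reach M p S m" using u[OF jk(2)] by (simp add: layer_def)
    then show ?thesis using reach_mono[OF m(2)] by blast
  qed
  have up: "u k < p" if "k \<le> ?L" for k using in_reach[OF le_refl that] reach_bounded[OF S(1)] by blast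
  have far: "M z (u k) = 0" if "z \<in> reach M p S j" "Suc j < k" "k \<le> ?L" for z j k
  proof (rule ccontr)
    assume "M z (u k) \<noteq> 0"
    then have "u k \<in> reach M p S (Suc j)" using that up sym[of z "u k"] by auto
    then show False using not_reach[OF that(2,3)] by blast
  qed
  have neq: "u i \<noteq> u j" if "i < j" "j \<le> ?L" for i j
    using in_reach[of i i] not_reach[of i j] that by auto
  \<comment> \<open>The next edge of the path takes at least 1 from the squared column norm 4 of
    \<open>?m\<close>, which excludes weight 2 for the edge back to \<open>u j\<close>.\<close>
  have unit: "M (u j) (u (Suc j)) * M (u j) (u (Suc j)) = 1" if "Suc j < ?L" for j
  proof -
    let ?m = "u (Suc j)"
    have m: "?m < p" using up that by simp
    have "u j \<noteq> u (Suc (Suc j))" using neq that by simp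
    moreover have "(\<Sum>i\<in>{u j, u (Suc (Suc j))}. (M i ?m)\<^sup>2) \<le> (\<Sum>i<p. (M i ?m)\<^sup>2)"
      using up that by (intro sum_mono2) auto
    ultimately have le: "(M (u j) ?m)\<^sup>2 + (M (u (Suc (Suc j))) ?m)\<^sup>2 \<le> 4"
      using contractive_degree(1)[OF con m] by simp
    have "M (u (Suc (Suc j))) ?m \<noteq> 0" "M (u j) ?m \<noteq> 0"
      using edge[of j] edge[of "Suc j"] that sym[of "u j" ?m] by simp_all
    then have "0 < (M (u (Suc (Suc j))) ?m)\<^sup>2" "M (u j) ?m \<noteq> 0" by simp_all
    then have "(M (u j) ?m)\<^sup>2 < 4" using le by linarith
    then have "\<bar>M (u j) ?m\<bar> < 2" using abs_le_square_iff[of 2 "M (u j) ?m"] by auto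
    then have "M (u j) ?m = 1 \<or> M (u j) ?m = -1" using \<open>M (u j) ?m \<noteq> 0\<close> by linarith
    then show ?thesis by auto
  qed
  have att: "attached M V (\<lambda>i. u (a + i)) k"
    if V: "V \<subseteq> reach M p S a" "u a \<in> V" and V': "\<And>z. z \<in> V \<Longrightarrow> z \<noteq> u a \<Longrightarrow> M z (u (Suc a)) = 0"
      and ak: "a + k < ?L" for V a k
    unfolding attached_def
  proof (intro conjI allI impI ballI)
    show "u (a + 0) \<in> V" using V(2) by simp
    fix j assume j: "j < k"
    have "u (a + Suc j) \<notin> V" using not_reach[of a "a + Suc j"] V(1) j ak by auto
    moreover have "u (a + Suc j) \<notin> (\<lambda>i. u (a + i)) ` {..j}"
    proof
      assume "u (a + Suc j) \<in> (\<lambda>i. u (a + i)) ` {..j}"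
      then obtain i where "i \<le> j" "u (a + Suc j) = u (a + i)" by auto
      then show False using neq[of "a + i" "a + Suc j"] j ak by simp
    qed
    ultimately show "u (a + Suc j) \<notin> V \<union> (\<lambda>i. u (a + i)) ` {..j}" by simp
    show "M (u (a + j)) (u (a + Suc j)) * M (u (a + j)) (u (a + Suc j)) = 1" using unit[of "a + j"] j ak by simp
    fix z assume z: "z \<in> V \<union> (\<lambda>i. u (a + i)) ` {..j}" "z \<noteq> u (a + j)"
    show "M z (u (a + Suc j)) = 0"
    proof (cases "z \<in> V")
      case True
      show ?thesis
      proof (cases "j = 0")
        case True with V'[OF \<open>z \<in> V\<close>] z(2) show ?thesis by simp
      next
        case False
        then show ?thesis using far[of z a "a + Suc j"] True V(1) j ak by auto
      qed
    next
      case False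
      then obtain i where i: "i \<le> j" "z = u (a + i)" using z(1) by auto
      then have "i < j" using z(2) by (cases "i = j") auto
      then show ?thesis using far[of z "a + i" "a + Suc j"] in_reach[of "a + i" "a + i"] i j ak by simp
    qed
  qed
  have unch: "M (u k) (u k) = 0" if "6 \<le> k" "k + 6 \<le> ?L" for k
  proof -
    \<comment> \<open>\<open>u k\<close> is the middle of the eleven vertices starting at
      \<open>u (k - 5)\<close>. The strict bound keeps one more geodesic vertex beyond this window,
      as \<open>unit\<close> demands.\<close>
    have k: "k - 5 + 5 = k" "k - 5 + 10 < ?L" "k - 5 \<le> ?L" using that by simp_all
    have "attached M {u (k - 5)} (\<lambda>i. u (k - 5 + i)) 10"
      using k in_reach[of "k - 5" "k - 5"] by (intro att) simp_all
    then have "M ((\<lambda>i. u (k - 5 + i)) 5) ((\<lambda>i. u (k - 5 + i)) 5) = 0"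
      using up k by (intro path_middle_uncharged[OF con _ _ sym]) auto
    then show ?thesis unfolding k(1) by simp
  qed
  \<comment> \<open>Charges on the first five vertices of the geodesic are not controlled, so the
    initial stretch is kept in the neighbourhood and only the tail behind \<open>u 6\<close> is
    eliminated.\<close>
  define V where "V = S \<union> u ` {1..6}"
  have V: "V \<subseteq> reach M p S 6" using in_reach[of _ 6] reach_mono[of 0 6 M p S] by (auto simp: V_def)
  have V': "M z (u (Suc 6)) = 0" if z: "z \<in> V" "z \<noteq> u 6" for z
  proof (cases "z \<in> S")
    case True then show ?thesis using far[of z 0 7] by simp
  next
    case False
    then obtain i where i: "1 \<le> i" "i \<le> 6" "z = u i" using z(1) by (auto simp: V_def)
    then have "i \<noteq> 6" using z(2) by auto
    then show ?thesis using far[of z i 7] in_reach[of i i] i by simp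

  qed
  have att6: "attached M V (\<lambda>i. u (6 + i)) l" using V V' by (intro att) (auto simp: V_def)
  have Vp: "V \<subseteq> {..<p}" using V reach_bounded[OF S(1)] by blast
  have path: "(\<lambda>i. u (6 + i)) ` {..l} \<subseteq> {..<p}" using up by auto
  have unch6: "M (u (6 + Suc j)) (u (6 + Suc j)) = 0" if "j < l" for j using unch[of "6 + Suc j"] that by simp
  have cap: "\<bar>bil V M y y\<bar> + (y (u 6))\<^sup>2 \<le> 2 * (\<Sum>i\<in>V. (y i)\<^sup>2) + (y (u 6))\<^sup>2 / real (Suc l)" for y
    using attached_capped[where M = M and u = "\<lambda>i. u (6 + i)" and y = y, OF con finite_lessThan Vp path sym att6 unch6]
    by simp
  show ?thesis
  proof (rule that[of u])
    show "u 0 \<in> S" using u[of 0] by (simp add: layer_def)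
    show "inj_on u {1..6}"
    proof (rule inj_onI)
      fix i j assume "i \<in> {1..6::nat}" "j \<in> {1..6::nat}" "u i = u j"
      then show "i = j" using neq[of i j] neq[of j i] by (cases i j rule: linorder_cases) auto
    qed
    show "u ` {1..6} \<subseteq> {..<p} - S" using not_reach[of 0] up by auto
    show "M (u k) (u (Suc k)) \<noteq> 0" if "k < 6" for k using edge[of k] that sym[of "u k"] by simp
    show "\<bar>bil (S \<union> u ` {1..6}) M y y\<bar> + (y (u 6))\<^sup>2
       \<le> 2 * (\<Sum>i\<in>S \<union> u ` {1..6}. (y i)\<^sup>2) + (y (u 6))\<^sup>2 / real (Suc l)" for y
      using cap[of y] by (simp add: V_def)
  qed
qed

section \<open>The limit over longer and longer paths\<close>

lemma le_limit:
  fixes a b c :: real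
  assumes "\<And>l. a \<le> b + c / real (Suc l)" shows "a \<le> b"
proof -
  have "(\<lambda>l. b + c / real (Suc l)) \<longlonglongrightarrow> b + 0"
    by (intro tendsto_intros LIMSEQ_Suc lim_const_over_n)
  then show ?thesis using assms by (intro LIMSEQ_le_const[of _ b a]) auto
qed

lemma of_int_Zphi: "of_int k \<in> Zphi"
  unfolding Zphi_def by (rule CollectI, rule exI[of _ k], rule exI[of _ 0]) simp

text \<open>The finite stage of \<open>capped\<close> for the unit vector at n + 5. Indices below n
  are for \<open>A\<close>, and n to n + 5 for the first six vertices of a geodesic; this common
  index set makes neighbourhoods from different extensions comparable.\<close>

definition almost_capped :: "real mat \<Rightarrow> nat \<Rightarrow> (nat \<Rightarrow> nat \<Rightarrow> int) \<Rightarrow> nat \<Rightarrow> bool" where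
  "almost_capped A n R l \<longleftrightarrow> (\<forall>i<n. \<forall>j<n. A $$ (i,j) = of_int (R i j)) \<and>
     (\<forall>i<n+6. \<forall>j<n+6. R i j = R j i) \<and> anchored {..<n+6} R (\<lambda>i. if i = n + 5 then 1 else 0) \<and>
     (\<forall>y. \<bar>bil {..<n+6} R y y\<bar> + (y (n + 5))\<^sup>2 \<le> 2 * (\<Sum>i<n+6. (y i)\<^sup>2) + (y (n + 5))\<^sup>2 / real (Suc l))"

lemma almost_capped_exists:
  fixes M :: "nat \<Rightarrow> nat \<Rightarrow> int"
  assumes A: "indecomposable A" "n = dim_row A"
    and con: "contractive {..<p} (\<lambda>i j. of_int (M i j))" and sym: "\<And>i j. M i j = M j i"
    and f: "inj_on f {..<n}" "f ` {..<n} \<subseteq> {..<p}" "\<And>i j. i < n \<Longrightarrow> j < n \<Longrightarrow> A $$ (i,j) = of_int (M (f i) (f j))"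
    and conn: "\<And>X. X \<noteq> {} \<Longrightarrow> X \<subseteq> {..<p} \<Longrightarrow> X \<noteq> {..<p} \<Longrightarrow> \<exists>i\<in>X. \<exists>j\<in>{..<p} - X. M j i \<noteq> 0"
    and big: "n * 5 ^ (l + 12) < p"
  shows "\<exists>R\<in>PiE {..<n+6} (\<lambda>_. PiE {..<n+6} (\<lambda>_. {-2..2})). almost_capped A n R l"
proof -
  have n0: "0 < n" using A by (simp add: indecomposable_def)
  define S where "S = f ` {..<n}"
  have S: "S \<subseteq> {..<p}" "S \<noteq> {}" "card S = n" using f n0 by (auto simp: S_def card_image)
  have big': "card S * 5 ^ (l + 12) < p" using big S(3) by simp
  have conn': "\<exists>i\<in>X. \<exists>j\<in>{..<p} - X. M j i \<noteq> 0" if "S \<subseteq> X" "X \<subseteq> {..<p}" "X \<noteq> {..<p}" for X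
    using conn[of X] that S(2) by auto
  obtain u where u: "u 0 \<in> S" "inj_on u {1..6}" "u ` {1..6} \<subseteq> {..<p} - S" "\<And>k. k < 6 \<Longrightarrow> M (u k) (u (Suc k)) \<noteq> 0"
    and cap: "\<And>y. \<bar>bil (S \<union> u ` {1..6}) M y y\<bar> + (y (u 6))\<^sup>2
       \<le> 2 * (\<Sum>i\<in>S \<union> u ` {1..6}. (y i)\<^sup>2) + (y (u 6))\<^sup>2 / real (Suc l)"
    using large_extension[where M = M, OF con sym S(1,2) conn' big'] by blast
  define g where "g i = (if i < n then f i else u (i - n + 1))" for i
  define V where "V = S \<union> u ` {1..6}"
  have gn: "g (n + k) = u (Suc k)" for k by (simp add: g_def)
  have gV: "g ` {..<n+6} = V"
  proof -
    have "{..<n+6} = {..<n} \<union> (\<lambda>k. n + k) ` {0..5}"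
    proof (intro equalityI subsetI)
      fix i assume "i \<in> {..<n+6}"
      then show "i \<in> {..<n} \<union> (\<lambda>k. n + k) ` {0..5}" by (cases "i < n") (auto intro!: image_eqI[of _ _ "i - n"])
    qed auto
    then have "g ` {..<n+6} = g ` {..<n} \<union> (\<lambda>k. u (Suc k)) ` {0..5}"
      by (simp only: image_Un image_image gn)
    also have "(\<lambda>k. u (Suc k)) ` {0..5} = u ` {1..6}"
      using image_image[of u Suc "{0..5}"] by (simp add: image_Suc_atLeastAtMost)
    also have "g ` {..<n} = S" by (auto simp: S_def g_def)
    finally show ?thesis by (simp add: V_def)
  qed
  have ginj: "inj_on g {..<n+6}"
  proof (rule inj_onI)
    fix i j assume ij: "i \<in> {..<n+6}" "j \<in> {..<n+6}" "g i = g j"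
    have out: "g k \<notin> S" if "k < n + 6" "\<not> k < n" for k
    proof -
      have "k - n + 1 \<in> {1..6}" using that by auto
      then have "u (k - n + 1) \<notin> S" using u(3) by blast
      then show ?thesis using that(2) by (simp add: g_def)
    qed
    have into: "g k \<in> S" if "k < n" for k using that by (simp add: g_def S_def)
    show "i = j"
    proof (cases "i < n")
      case True
      then have "j < n" using out[of j] into[of i] ij by auto
      then show ?thesis using True ij f(1) by (simp add: g_def inj_on_eq_iff)
    next
      case False
      then have "\<not> j < n" using out[of i] into[of j] ij by auto
      then have "u (i - n + 1) = u (j - n + 1)" using False ij(3) by (simp add: g_def)
      moreover have "i - n + 1 \<in> {1..6}" "j - n + 1 \<in> {1..6}" using ij(1,2) False \<open>\<not> j < n\<close> by simp_all
      ultimately have "i - n + 1 = j - n + 1" by (rule inj_onD[OF u(2)])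
      then show ?thesis using False \<open>\<not> j < n\<close> by simp
    qed
  qed
  have bij: "bij_betw g {..<n+6} V" using ginj gV by (simp add: bij_betw_def)
  have gp: "g i < p" if "i < n + 6" for i using gV that S(1) u(3) by (auto simp: V_def)
  \<comment> \<open>Made extensional, so that \<open>R\<close> belongs to a finite function
    space.\<close>
  define R where "R = (\<lambda>i\<in>{..<n+6}. \<lambda>j\<in>{..<n+6}. M (g i) (g j))"
  have R: "R i j = M (g i) (g j)" if "i < n + 6" "j < n + 6" for i j using that by (simp add: R_def)
  have Rf: "R i j = M (f i) (f j)" if "i < n" "j < n" for i j using that R[of i j] by (simp add: g_def)
  have small: "M i j \<in> {-2..2}" if "i < p" "j < p" for i j
  proof -
    have "(M i j)\<^sup>2 \<le> (\<Sum>i<p. (M i j)\<^sup>2)" using that(1) by (intro member_le_sum) auto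
    then have "(M i j)\<^sup>2 \<le> 4" using contractive_degree(1)[OF con that(2)] by linarith
    then have "\<bar>M i j\<bar> \<le> 2" using abs_le_square_iff[of "M i j" 2] by simp
    then show ?thesis by auto
  qed
  have "R \<in> PiE {..<n+6} (\<lambda>_. PiE {..<n+6} (\<lambda>_. {-2..2}))"
    using small gp by (auto simp: R_def)
  moreover have "almost_capped A n R l"
    unfolding almost_capped_def
  proof (intro conjI allI impI)
    show "A $$ (i, j) = of_int (R i j)" if "i < n" "j < n" for i j using f(3) Rf that by simp
    show "R i j = R j i" if "i < n + 6" "j < n + 6" for i j using R that sym by simp
    show "anchored {..<n + 6} R (\<lambda>i. if i = n + 5 then 1 else 0)"
      unfolding anchored_def
    proof (intro allI impI)
      fix X assume X: "X \<subseteq> {..<n+6}" and off: "\<forall>i\<in>X. (if i = n + 5 then 1 else 0 :: int) = 0"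
        and closed: "\<forall>i\<in>X. \<forall>j\<in>{..<n+6} - X. R j i = 0"
      \<comment> \<open>Nonzero edges carry absence from \<open>X\<close> backwards along the path,
        from its end n + 5 to n; from there it spreads over the connected matrix
        \<open>A\<close>.\<close>
      have tail: "n + (5 - d) \<notin> X" if "d \<le> 5" for d
        using that
      proof (induction d)
        case 0 then show ?case using off by auto
      next
        case (Suc d)
        define k where "k = 5 - Suc d"
        have k: "k < 5" "5 - d = Suc k" using Suc.prems by (auto simp: k_def)
        have "n + Suc k \<notin> X" using Suc k by simp
        moreover have "R (n + Suc k) (n + k) \<noteq> 0"
          using u(4)[of "Suc k"] k(1) sym[of "u (Suc (Suc k))"] gn[of k] gn[of "Suc k"] by (simp add: R)
        ultimately show ?case using closed k(1) unfolding k_def[symmetric] by force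
      qed
      have "n \<notin> X" using tail[of 5] by simp
      obtain i0 where i0: "i0 < n" "f i0 = u 0" using u(1) by (auto simp: S_def)
      have "R n i0 \<noteq> 0" using i0 u(4)[of 0] sym gn[of 0] by (simp add: R) (simp add: g_def)
      then have "i0 \<notin> X" using closed \<open>n \<notin> X\<close> by force
      have "i \<notin> X" if i: "i < n" for i
      proof
        assume "i \<in> X"
        then obtain i' j' where ij: "i' < n" "j' < n" "i' \<in> X" "j' \<notin> X" "A $$ (i', j') \<noteq> 0"
          using indecomposable_neighbour[OF A \<open>i \<in> X\<close> i \<open>i0
 \<notin> X\<close> i0(1)] by blast
        then have "R j' i' \<noteq> 0" using f(3) Rf sym by simp
        then show False using closed ij by force
      qed
      moreover have "i \<notin> X" if "n \<le> i" "i < n + 6" for i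
        using tail[of "5 - (i - n)"] that by simp
      ultimately show "X = {}" using X by (meson equals0I lessThan_iff not_le subsetD)
    qed
    fix y :: "nat \<Rightarrow> real"
    define z where "z = (\<lambda>v. y (inv_into {..<n+6} g v))"
    have z: "z (g i) = y i" if "i < n + 6" for i using that ginj by (simp add: z_def)
    have re: "(\<Sum>i\<in>V. h i) = (\<Sum>i<n+6. h (g i))" for h :: "nat \<Rightarrow> real"
      using sum.reindex_bij_betw[OF bij, of h] by simp
    have "bil V M z z = bil {..<n+6} R y y"
      unfolding bil_def re using z R by (intro sum.cong refl) simp
    moreover have "(\<Sum>i\<in>V. (z i)\<^sup>2) = (\<Sum>i<n+6. (y i)\<^sup>2)"
      unfolding re using z by (intro sum.cong refl) simp
    moreover have "z (u 6) = y (n + 5)" using z[of "n + 5"] gn[of 5] by simp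
    ultimately show "\<bar>bil {..<n + 6} R y y\<bar> + (y (n + 5))\<^sup>2
        \<le> 2 * (\<Sum>i<n + 6. (y i)\<^sup>2) + (y (n + 5))\<^sup>2 / real (Suc l)"
      using cap[of z] unfolding V_def[symmetric] by simp
  qed
  ultimately show ?thesis by blast
qed

text \<open>Pigeonhole: the condition gets stronger as \<open>l\<close> grows and only finitely many
  \<open>R\<close> compete, so one of them satisfies it for every \<open>l\<close>. Its error term
  then tends to 0.\<close>

lemma almost_capped_completion:
  assumes A: "indecomposable A" "n = dim_row A"
    and ex: "\<And>l. \<exists>R\<in>PiE {..<n+6} (\<lambda>_. PiE {..<n+6} (\<lambda>_. {-2..2})). almost_capped A n R l"
  obtains B where "maximal_indecomposable_cyclotomic Zphi B" "principal_submatrix A B"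
proof -
  let ?F = "PiE {..<n+6} (\<lambda>_. PiE {..<n+6} (\<lambda>_. {-2..2::int}))"
  have fin: "finite ?F" by (intro finite_PiE) auto
  have mono: "almost_capped A n R l" if ac: "almost_capped A n R l'" and le: "l \<le> l'" for R l l'
  proof -
    have "a + b\<^sup>2 / real (Suc l') \<le> a + b\<^sup>2 / real (Suc l)" for a b :: real
      using le by (intro add_left_mono divide_left_mono) auto
    then show ?thesis using ac unfolding almost_capped_def by (meson order_trans)
  qed
  have "\<exists>R\<in>?F. \<forall>l. almost_capped A n R l"
  proof (rule ccontr)
    assume "\<not> ?thesis"
    then obtain b where b: "\<And>R. R \<in> ?F \<Longrightarrow> \<not> almost_capped A n R (b R)" by metis
    obtain R where R: "R \<in> ?F" "almost_capped A n R (Max (b ` ?F))" using ex by blast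
    then have "b R \<le> Max (b ` ?F)" using fin by simp
    then show False using mono[OF R(2)] b[OF R(1)] by blast
  qed
  then obtain R where R: "\<And>l. almost_capped A n R l" by blast
  define a :: "nat \<Rightarrow> int" where "a = (\<lambda>i. if i = n + 5 then 1 else 0)"
  have sym: "R i j = R j i" if "i \<in> {..<n+6}" "j \<in> {..<n+6}" for i j
    using R[of 0] that unfolding almost_capped_def by auto
  have anch: "anchored {..<n+6} R a" using R[of 0] unfolding almost_capped_def a_def by blast
  have "(\<Sum>i<n+6. (a i)\<^sup>2) = (\<Sum>i<n+6. if i = n + 5 then 1 else 0)"
    by (intro sum.cong) (auto simp: a_def)
  then have one: "(\<Sum>i<n+6. (a i)\<^sup>2) = 1" by simp
  have cap: "capped {..<n+6} R a"
    unfolding capped_def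
  proof
    fix y :: "nat \<Rightarrow> real"
    have "\<bar>bil {..<n+6} R y y\<bar> + (y (n + 5))\<^sup>2 \<le> 2 * (\<Sum>i<n+6. (y i)\<^sup>2) + (y (n + 5))\<^sup>2 / real (Suc l)" for l
      using R[of l] unfolding almost_capped_def by blast
    then have "\<bar>bil {..<n+6} R y y\<bar> + (y (n + 5))\<^sup>2 \<le> 2 * (\<Sum>i<n+6. (y i)\<^sup>2)" by (rule le_limit)
    moreover have "(\<Sum>i<n+6. of_int (a i) * y i) = (\<Sum>i<n+6. if i = n + 5 then y i else 0)"
      by (intro sum.cong) (auto simp: a_def)
    then have "(\<Sum>i<n+6. of_int (a i) * y i) = y (n + 5)" by simp
    ultimately show "(\<Sum>i<n+6. of_int (a i) * y i)\<^sup>2 + \<bar>bil {..<n+6} R y y\<bar> \<le> 2 * (\<Sum>i<n+6. (y i)\<^sup>2)"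
      by simp
  qed
  obtain W N where W: "finite W" "{..<n+6} \<subseteq> W" and NR: "\<And>i j. i \<in> {..<n+6} \<Longrightarrow> j \<in> {..<n+6} \<Longrightarrow> N i j = R i j"
    and symN: "\<And>i j. i \<in> W \<Longrightarrow> j \<in> W \<Longrightarrow> N i j = N j i"
    and sq: "\<And>i j. i \<in> W \<Longrightarrow> j \<in> W \<Longrightarrow> (\<Sum>k\<in>W. N i k * N k j) = (if i = j then 4 else 0 :: int)"
    by (rule capped_square_four[where M = R, OF finite_lessThan sym cap anch one]) (assumption | rule that)+
  show ?thesis
  proof (rule square_four_completion[where M = "\<lambda>i j. of_int (N i j)" and f = id and W = W, OF W(1) _ _ _ A])
    show "of_int (N i j) = (of_int (N j i) :: real)" if "i \<in> W" "j \<in> W" for i j using symN[OF that] by simp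
    show "of_int (N i j) \<in> Zphi" for i j by (rule of_int_Zphi)
    show "(\<Sum>k\<in>W. of_int (N i k) * of_int (N k j)) = (if i = j then 4 else 0 :: real)" if "i \<in> W" "j \<in> W" for i j
    proof -
      have "(\<Sum>k\<in>W. of_int (N i k) * of_int (N k j)) = (of_int (\<Sum>k\<in>W. N i k * N k j) :: real)" by simp
      also have "\<dots> = of_int (if i = j then 4 else 0)" by (simp only: sq[OF that])
      finally show ?thesis by simp
    qed
    show "inj_on id {..<n}" by simp
    show "id ` {..<n} \<subseteq> W" using W(2) by auto
    show "A $$ (i, j) = of_int (N (id i) (id j))" if "i < n" "j < n" for i j
      using R[of 0] that NR[of i j] unfolding almost_capped_def by simp
  qed (rule that)
qed

section \<open>Containment in a maximal matrix, given the irrational case\<close>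

lemma principal_submatrix_trans:
  assumes "principal_submatrix A B" "principal_submatrix B C" shows "principal_submatrix A C"
proof -
  obtain f where f: "inj_on f {..<dim_row A}" "f ` {..<dim_row A} \<subseteq> {..<dim_row B}"
    "\<forall>i<dim_row A. \<forall>j<dim_row A. A $$ (i,j) = B $$ (f i, f j)" using assms(1) unfolding principal_submatrix_def by blast
  obtain g where g: "inj_on g {..<dim_row B}" "g ` {..<dim_row B} \<subseteq> {..<dim_row C}"
    "\<forall>i<dim_row B. \<forall>j<dim_row B. B $$ (i,j) = C $$ (g i, g j)" using assms(2) unfolding principal_submatrix_def by blast
  have "inj_on (g \<circ> f) {..<dim_row A}" using f g by (meson comp_inj_on inj_on_subset)
  moreover have "(g \<circ> f) ` {..<dim_row A} \<subseteq> {..<dim_row C}" using f(2) g(2) by auto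
  moreover have "f i < dim_row B" if "i < dim_row A" for i using f(2) that by auto
  then have "\<forall>i<dim_row A. \<forall>j<dim_row A. A $$ (i,j) = C $$ ((g \<circ> f) i, (g \<circ> f) j)" using f(3) g(3) by simp
  ultimately show ?thesis using assms unfolding principal_submatrix_def by blast
qed

lemma emb_in_Zring: "emb False z \<in> Zring \<Longrightarrow> \<exists>k. z = ZP k 0"
proof -
  assume "emb False z \<in> Zring"
  then obtain k where "emb False z = of_int k" by (auto simp: Zring_def)
  then have "emb False z = emb False (ZP k 0)" by simp
  then show ?thesis unfolding emb_False_inj by blast
qed

text \<open>Were there no maximal matrix above \<open>A\<close>, proper extensions could be iterated
  without bound. By \<open>irr\<close> none of these is irrational, so integral extensions of every
  size are at hand for \<open>almost_capped_exists\<close>.\<close>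

lemma contained_in_maximal:
  assumes A: "matrix_over Zphi A" "indecomposable A" "cyclotomic A"
    and irr: "\<And>B. matrix_over Zphi B \<Longrightarrow> indecomposable B \<Longrightarrow> cyclotomic B \<Longrightarrow> \<not> matrix_over Zring B \<Longrightarrow>
       \<exists>C. maximal_indecomposable_cyclotomic Zphi C \<and> principal_submatrix B C"
  shows "\<exists>B. maximal_indecomposable_cyclotomic Zphi B \<and> principal_submatrix A B"
proof (rule ccontr)
  assume no: "\<not> ?thesis"
  define n where "n = dim_row A"
  have Ad: "dim_row A = dim_col A" using A(2) by (simp add: indecomposable_def)
  have "\<exists>B. matrix_over Zphi B \<and> indecomposable B \<and> cyclotomic B \<and> principal_submatrix A B \<and> N \<le> dim_row B" for N
  proof (induction N)
    case 0
    have "principal_submatrix A A" unfolding principal_submatrix_def using Ad by (intro conjI exI[of _ id]) auto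
    then show ?case using A by blast
  next
    case (Suc N)
    then obtain B where B: "matrix_over Zphi B" "indecomposable B" "cyclotomic B" "principal_submatrix A B" "N \<le> dim_row B" by blast
    then obtain C where "matrix_over Zphi C" "indecomposable C" "cyclotomic C" "proper_principal_submatrix B C"
      using no unfolding maximal_indecomposable_cyclotomic_def by blast
    then show ?case using B(4,5) principal_submatrix_trans[OF B(4), of C]
      unfolding proper_principal_submatrix_def by (metis Suc_leI le_less_trans)
  qed
  then have big: "\<exists>B. matrix_over Zphi B \<and> indecomposable B \<and> cyclotomic B \<and> principal_submatrix A B \<and> N < dim_row B" for N
    by (meson Suc_le_lessD)
  have "\<exists>R\<in>PiE {..<n+6} (\<lambda>_. PiE {..<n+6} (\<lambda>_. {-2..2})). almost_capped A n R l" for l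
  proof -
    obtain B where B: "matrix_over Zphi B" "indecomposable B" "cyclotomic B" "principal_submatrix A B"
      and p: "n * 5 ^ (l + 12) < dim_row B" using big by blast
    define p where "p = dim_row B"
    have Bint: "matrix_over Zring B" using irr[OF B(1-3)] no principal_submatrix_trans[OF B(4)] by blast
    obtain Z where symZ: "\<And>i j. Z i j = Z j i" and BZ: "B = mat p p (\<lambda>(i,j). emb False (Z i j))"
      and con: "\<And>c. contractive {..<p} (\<lambda>i j. emb c (Z i j))"
      using cyclotomic_contractive[OF B(1,3) p_def] by blast
    define M where "M i j = (case Z i j of ZP a b \<Rightarrow> a)" for i j
    have symM: "M i j = M j i" for i j unfolding M_def by (subst symZ) (rule refl)
    have M: "of_int (M i j) = emb False (Z i j)" if "i < p" "j < p" for i j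
    proof -
      have "emb False (Z i j) \<in> Zring" using Bint that unfolding BZ matrix_over_def by simp
      then obtain k where "Z i j = ZP k 0" using emb_in_Zring by blast
      then show ?thesis by (simp add: M_def)
    qed
    have BM: "B $$ (i,j) = of_int (M i j)" if "i < p" "j < p" for i j using M[OF that] that unfolding BZ by simp
    have "apply_on {..<p} (\<lambda>i j. of_int (M i j)) y i = apply_on {..<p} (\<lambda>i j. emb False (Z i j)) y i" if "i < p" for y i
      using M that by (simp add: apply_on_def)
    then have conM: "contractive {..<p} (\<lambda>i j. of_int (M i j))"
      using con[of False] unfolding contractive_def by simp
    obtain f where f: "inj_on f {..<n}" "f ` {..<n} \<subseteq> {..<p}" "\<forall>i<n. \<forall>j<n. A $$ (i,j) = B $$ (f i, f j)"
      using B(4) unfolding principal_submatrix_def n_def p_def by blast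
    have fA: "A $$ (i,j) = of_int (M (f i) (f j))" if "i < n" "j < n" for i j
      using f(2,3) that BM by (simp add: image_subset_iff)
    have conn: "\<exists>i\<in>X. \<exists>j\<in>{..<p} - X. M j i \<noteq> 0" if X: "X \<noteq> {}" "X \<subseteq> {..<p}" "X \<noteq> {..<p}" for X
    proof -
      obtain v w where "v \<in> X" "v < p" "w \<notin> X" "w < p" using X by auto
      then obtain i j where "i < p" "j < p" "i \<in> X" "j \<notin> X" "B $$ (i,j) \<noteq> 0"
        using indecomposable_neighbour[OF B(2) p_def] by blast
      then show ?thesis using BM symM[of i j] by (intro bexI[of _ i] bexI[of _ j]) auto
    qed
    show ?thesis
      by (rule almost_capped_exists[where M = M and f = f, OF A(2) n_def conM symM f(1,2) fA conn])
        (use p in \<open>simp_all add: p_def\<close>)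
  qed
  then show False using almost_capped_completion[OF A(2) n_def] no by blast
qed

section \<open>The classification of irrational matrices\<close>

text \<open>The exact counterpart of \<open>wgraph\<close>, recursive in the edge list so that it
  can be evaluated.\<close>

fun weight :: "zphi list \<Rightarrow> (nat \<times> nat \<times> zphi) list \<Rightarrow> nat \<Rightarrow> nat \<Rightarrow> zphi" where
  "weight cs [] i j = (if i = j then cs ! i else 0)"
| "weight cs ((u, v, w) # es) i j = (if i = j then cs ! i else
     (if u = i \<and> v = j \<or> u = j \<and> v = i then w else 0) + weight cs es i j)"

type_synonym cert = "nat \<times> bool \<times> bool \<times> (nat \<times> bool) list"

text \<open>Conjugation and negation act globally, the flags in \<open>ps\<close> switch signs at
  vertices, and all signs combine by exclusive or.\<close>

definition signed_minor :: "bool \<Rightarrow> bool \<Rightarrow> (nat \<times> bool) list \<Rightarrow> (nat \<Rightarrow> nat \<Rightarrow> zphi) \<Rightarrow> zphi list list" where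
  "signed_minor cj ng ps F = map (\<lambda>(t, s). map (\<lambda>(u, s'). twist cj (ng \<noteq> (s \<noteq> s')) (F t u)) ps) ps"

definition graph_mat :: "zphi list \<times> (nat \<times> nat \<times> zphi) list \<Rightarrow> zphi list list" where
  "graph_mat G = (case G of (cs, es) \<Rightarrow> map (\<lambda>i. map (weight cs es i) [0..<length cs]) [0..<length cs])"

definition graphs :: "(zphi list \<times> (nat \<times> nat \<times> zphi) list) list" where
  "graphs = [
    ([ZP 0 1, ZP 1 (-1), ZP 1 0],
     [(0, 2, ZP 1 (-1)), (2, 1, ZP 0 1), (0, 1, ZP 1 0)]),
    ([ZP 1 0, ZP (-1) 0, ZP (-1) 0, ZP 1 0],
     [(0, 1, ZP 0 1), (0, 2, ZP 1 (-1)), (1, 3, ZP 1 (-1)), (2, 3, ZP 0 (-1))]),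
    ([ZP 0 1, ZP 0 (-1), ZP 0 (-1), ZP 0 1],
     [(0, 2, ZP 1 (-1)), (1, 3, ZP 1 (-1)), (0, 1, ZP 1 0), (2, 3, ZP (-1) 0)]),
    ([ZP 0 0, ZP 0 1, ZP 1 (-1), ZP (-1) 0],
     [(0, 1, ZP 1 (-1)), (0, 2, ZP 0 1), (1, 3, ZP 1 0), (2, 3, ZP 1 0), (0, 3, ZP 1 0)]),
    ([ZP 0 0, ZP 0 0, ZP 0 0, ZP 0 0, ZP 0 0, ZP 0 0],
     [(0, 1, ZP 0 1), (2, 3, ZP 0 1), (4, 5, ZP 0 1), (1, 4, ZP 1 (-1)), (0, 3, ZP 1 (-1)),
      (2, 5, ZP 1 (-1)), (1, 2, ZP 1 0), (3, 4, ZP 1 0), (0, 5, ZP 1 0)]),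
    ([ZP 0 0, ZP 0 0, ZP 0 0, ZP 0 0, ZP 0 0, ZP 0 0, ZP 0 0, ZP 0 0],
     [(0, 1, ZP 1 (-1)), (4, 5, ZP 1 (-1)), (6, 7, ZP 1 (-1)), (2, 3, ZP (-1) 1), (2, 6, ZP 0 1),
      (0, 4, ZP 0 1), (3, 7, ZP 0 1), (1, 5, ZP 0 (-1)), (1, 3, ZP 1 0), (5, 7, ZP 1 0),
      (0, 2, ZP 1 0), (4, 6, ZP (-1) 0)]),
    ([ZP 0 0, ZP 0 0, ZP 0 0, ZP 0 0, ZP 0 0, ZP 0 0, ZP 0 0, ZP 0 0],
     [(0, 1, ZP 0 1), (2, 6, ZP 0 1), (5, 7, ZP 0 1), (1, 5, ZP 1 (-1)), (6, 7, ZP 1 (-1)),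
      (0, 2, ZP 1 (-1)), (4, 5, ZP 1 0), (2, 3, ZP 1 0), (1, 3, ZP 1 0), (4, 6, ZP 1 0),
      (0, 4, ZP 1 0), (3, 7, ZP 1 0), (3, 4, ZP (-1) 0)])]"

text \<open>A cell \<open>(k, vs)\<close> is the principal submatrix of the \<open>k\<close>-th graph on the vertices \<open>vs\<close>. The cells
  represent all connected irrational principal submatrices of the graphs, up to equivalence.\<close>
definition cells :: "(nat \<times> nat list) list" where
  "cells = [
    (4, [0, 1]), (3, [0, 2]), (1, [0, 1]), (0, [1, 2]), (2, [0, 2]), (0, [0]), (4, [0, 4, 5]),
    (4, [0, 2, 3]), (3, [0, 2, 3]), (3, [0, 1, 2]), (1, [0, 2, 3]), (0, [0, 1, 2]),
    (2, [0, 1, 3]), (3, [1, 3]), (2, [0, 1]), (0, [0, 1]), (4, [0, 2, 3, 4]),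
    (5, [0, 1, 5, 7]), (6, [0, 4, 5, 7]), (6, [0, 1, 3, 4]), (6, [0, 2, 4, 6]),
    (5, [0, 2, 4, 6]), (4, [0, 1, 2, 3]), (5, [0, 1, 3, 7]), (4, [0, 3, 4, 5]),
    (6, [0, 2, 6, 7]), (5, [0, 1, 4, 5]), (3, [0, 1, 2, 3]), (1, [0, 1, 2, 3]),
    (2, [0, 1, 2, 3]), (3, [1, 2, 3]), (5, [0, 2, 4, 6, 7]), (6, [0, 2, 4, 6, 7]),
    (6, [1, 3, 4, 5, 7]), (4, [0, 1, 2, 3, 5]), (5, [0, 1, 4, 5, 7]), (5, [0, 1, 3, 6, 7]),
    (5, [0, 2, 3, 5, 7]), (6, [0, 3, 4, 5, 7]), (6, [0, 2, 4, 5, 6]), (6, [0, 2, 3, 5, 7]),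
    (6, [0, 1, 5, 6, 7]), (5, [0, 1, 2, 3, 5, 7]), (5, [0, 1, 3, 4, 5, 7]),
    (5, [0, 1, 3, 5, 6, 7]), (6, [0, 1, 4, 5, 6, 7]), (6, [0, 1, 2, 3, 4, 5]),
    (6, [0, 1, 3, 5, 6, 7]), (6, [0, 3, 4, 5, 6, 7]), (4, [0, 1, 2, 3, 4, 5]),
    (5, [0, 2, 3, 5, 6, 7]), (5, [0, 2, 3, 4, 5, 7]), (6, [0, 2, 3, 4, 5, 7]),
    (6, [0, 1, 2, 5, 6, 7]), (5, [0, 1, 3, 4, 5, 6, 7]), (6, [0, 1, 3, 4, 5, 6, 7]),
    (6, [0, 1, 2, 3, 5, 6, 7]), (5, [0, 1, 2, 3, 4, 5, 6, 7]), (6, [0, 1, 2, 3, 4, 5, 6, 7])]"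

text \<open>A certificate \<open>(r, cj, ng, ps)\<close> claims that a matrix becomes the \<open>r\<close>-th cell after conjugation
  (if \<open>cj\<close>), negation (if \<open>ng\<close>), and the reindexing and sign changes in \<open>ps\<close>. There is one certificate
  for each admissible matrix on two vertices with edge $\varphi$ (\<open>edge_cert\<close>), and one for each
  admissible extension of each cell (\<open>ext_cert\<close>), in the order of enumeration.\<close>
definition edge_cert :: "cert list" where
  "edge_cert = [
    (0,False,False,[(0,False),(1,False)]), (1,False,False,[(0,False),(1,False)]),
    (1,False,True,[(0,False),(1,True)]), (2,False,False,[(0,False),(1,False)]),
    (3,False,False,[(1,False),(0,False)]), (2,False,False,[(1,False),(0,False)]),
    (3,False,True,[(1,False),(0,True)]), (1,False,False,[(1,False),(0,False)]),
    (3,False,False,[(0,False),(1,False)]), (4,True,False,[(0,False),(1,False)]),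
    (1,False,True,[(1,False),(0,True)]), (3,False,True,[(0,False),(1,True)]),
    (4,True,False,[(1,False),(0,False)])]"

definition ext_cert :: "cert list list" where
  "ext_cert = [
    [(6,False,False,[(0,False),(1,False),(2,False)]),
    (7,False,False,[(0,False),(1,False),(2,False)]),
    (6,False,False,[(0,False),(2,False),(1,False)]),
    (7,False,False,[(0,False),(2,False),(1,False)])],
    [(8,False,False,[(1,False),(2,False),(0,False)]),
    (9,False,False,[(1,False),(0,False),(2,False)])],
    [(10,False,False,[(0,False),(2,False),(1,True)]),
    (10,False,True,[(0,False),(1,True),(2,True)])],
    [(11,False,False,[(0,False),(1,False),(2,False)])],
    [(12,False,False,[(0,False),(2,False),(1,False)]),
    (12,False,True,[(0,False),(1,True),(2,False)])],
    [(1,True,False,[(0,False),(1,False)]), (3,True,False,[(1,False),(0,False)]),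
    (13,False,False,[(1,False),(0,False)]), (14,False,False,[(1,False),(0,False)]),
    (4,False,False,[(1,False),(0,False)]), (15,False,False,[(1,False),(0,False)])],
    [(16,False,False,[(0,False),(2,False),(3,False),(1,False)]),
    (17,False,False,[(0,False),(2,False),(3,True),(1,True)]),
    (18,False,False,[(0,False),(1,False),(3,False),(2,False)]),
    (19,False,False,[(2,False),(3,False),(1,False),(0,True)]),
    (20,False,False,[(0,False),(2,False),(1,False),(3,False)]),
    (21,False,False,[(0,False),(2,True),(1,False),(3,True)]),
    (22,False,False,[(0,False),(1,False),(3,False),(2,False)]),
    (23,False,False,[(0,False),(1,False),(3,False),(2,False)]),
    (24,False,False,[(0,False),(1,False),(3,False),(2,False)])],
    [(16,False,False,[(1,False),(2,False),(3,False),(0,False)]),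
    (17,False,False,[(1,False),(3,False),(2,True),(0,True)]),
    (25,False,False,[(0,False),(2,False),(3,False),(1,False)]),
    (17,True,False,[(2,False),(3,False),(1,True),(0,True)]),
    (20,False,False,[(1,False),(3,False),(0,False),(2,False)]),
    (22,True,False,[(2,False),(0,False),(1,False),(3,False)]),
    (25,True,False,[(0,False),(1,False),(3,False),(2,False)]),
    (22,False,False,[(1,False),(0,False),(2,False),(3,False)]),
    (26,False,False,[(0,False),(2,True),(1,False),(3,False)])],
    [(27,False,False,[(1,False),(0,False),(2,False),(3,False)])],
    [(27,False,False,[(1,False),(2,False),(3,False),(0,False)])],
    [(28,False,False,[(1,False),(0,False),(2,False),(3,False)])],
    [],
    [(29,False,False,[(1,False),(2,False),(0,False),(3,False)])],
    [(8,True,False,[(0,False),(1,False),(2,False)]),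
    (30,False,False,[(1,False),(0,False),(2,False)])],
    [(12,False,False,[(1,False),(2,False),(0,False)]),
    (12,False,True,[(2,False),(1,True),(0,False)])],
    [(11,False,False,[(1,False),(2,False),(0,False)])],
    [(31,False,False,[(0,False),(2,False),(4,True),(3,False),(1,False)]),
    (32,False,False,[(0,False),(2,False),(4,False),(3,False),(1,False)]),
    (31,True,False,[(0,False),(1,False),(4,True),(3,False),(2,False)]),
    (33,False,False,[(1,False),(0,False),(4,False),(3,False),(2,False)]),
    (34,False,False,[(0,False),(4,False),(3,False),(2,False),(1,False)]),
    (32,True,False,[(0,False),(1,False),(4,False),(3,False),(2,False)]),
    (34,False,False,[(3,False),(2,False),(0,False),(1,False),(4,False)]),
    (35,False,False,[(0,False),(2,True),(1,False),(3,False),(4,False)])],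
    [(36,False,False,[(0,False),(4,False),(3,False),(1,True),(2,True)]),
    (31,False,False,[(4,False),(3,False),(0,False),(2,True),(1,True)]),
    (37,False,False,[(0,False),(1,False),(2,True),(4,False),(3,False)]),
    (35,False,False,[(1,False),(2,False),(0,False),(3,False),(4,False)])],
    [(38,False,False,[(1,False),(0,True),(2,False),(3,False),(4,False)]),
    (39,False,False,[(0,False),(4,False),(2,False),(1,False),(3,False)]),
    (32,True,False,[(1,False),(0,False),(2,False),(3,False),(4,False)]),
    (40,False,False,[(0,False),(1,False),(2,False),(4,False),(3,False)])],
    [(38,False,False,[(0,False),(3,False),(4,False),(1,False),(2,False)]),
    (38,False,False,[(0,False),(4,False),(3,False),(2,False),(1,False)]),
    (33,False,False,[(0,False),(4,False),(3,False),(2,False),(1,False)]),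
    (33,False,False,[(0,False),(3,False),(4,False),(1,False),(2,False)])],
    [(32,False,False,[(1,False),(2,False),(3,False),(4,False),(0,False)]),
    (39,False,False,[(1,False),(2,False),(3,False),(0,False),(4,False)]),
    (33,False,False,[(1,False),(3,False),(0,False),(2,False),(4,False)]),
    (32,True,False,[(4,False),(2,False),(3,False),(1,False),(0,False)])],
    [(31,False,False,[(1,False),(2,False),(3,False),(4,False),(0,False)]),
    (31,False,False,[(2,False),(1,False),(4,False),(3,False),(0,False)]),
    (31,False,False,[(3,False),(4,True),(1,False),(2,True),(0,True)]),
    (31,False,False,[(4,False),(3,True),(2,False),(1,True),(0,True)])],
    [(34,False,False,[(4,False),(3,False),(2,False),(1,False),(0,False)]),
    (34,False,False,[(1,False),(2,False),(3,False),(4,False),(0,False)])],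
    [(36,False,False,[(1,False),(2,False),(3,False),(0,False),(4,False)]),
    (31,False,False,[(4,False),(0,True),(3,False),(2,True),(1,True)]),
    (31,True,False,[(1,False),(0,False),(2,False),(3,True),(4,True)]),
    (36,True,False,[(4,False),(3,False),(2,False),(0,False),(1,False)])],
    [(34,False,False,[(4,False),(3,False),(2,False),(0,False),(1,False)]),
    (34,False,False,[(3,False),(4,False),(1,False),(0,False),(2,False)])],
    [(41,False,False,[(0,False),(4,False),(3,False),(1,False),(2,False)]),
    (32,False,False,[(4,False),(3,False),(0,False),(2,False),(1,False)]),
    (32,False,False,[(1,False),(2,False),(0,False),(3,False),(4,False)]),
    (41,False,False,[(0,False),(1,False),(2,False),(4,False),(3,False)])],
    [(35,False,False,[(1,False),(2,False),(3,False),(4,False),(0,False)]),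
    (35,False,False,[(2,False),(1,False),(4,True),(3,True),(0,True)]),
    (35,False,False,[(3,False),(4,False),(1,False),(2,False),(0,False)]),
    (35,False,False,[(4,False),(3,False),(2,True),(1,True),(0,True)])],
    [],
    [],
    [],
    [(27,False,False,[(0,False),(1,False),(2,False),(3,False)])],
    [(42,False,False,[(0,False),(3,False),(5,False),(4,True),(1,True),(2,True)]),
    (43,False,False,[(0,False),(2,False),(1,False),(5,True),(4,True),(3,False)]),
    (44,False,False,[(0,False),(1,False),(2,False),(3,True),(5,False),(4,False)])],
    [(45,False,False,[(0,False),(5,False),(3,False),(4,False),(1,False),(2,False)]),
    (46,False,False,[(2,False),(4,False),(1,False),(3,False),(0,False),(5,False)]),
    (47,False,False,[(0,False),(1,False),(3,False),(2,False),(5,False),(4,False)])],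
    [(46,False,False,[(4,False),(5,False),(1,False),(2,False),(3,False),(0,False)]),
    (48,False,False,[(0,False),(3,False),(2,False),(5,False),(1,False),(4,False)]),
    (46,True,False,[(1,False),(4,False),(0,False),(3,False),(2,False),(5,False)])],
    [(49,False,False,[(0,False),(5,False),(1,False),(2,False),(3,False),(4,False)])],
    [(43,True,False,[(1,False),(3,False),(0,False),(2,False),(4,True),(5,True)]),
    (43,False,False,[(1,False),(2,False),(0,False),(3,False),(4,False),(5,False)]),
    (50,False,False,[(0,False),(1,False),(2,True),(5,False),(3,False),(4,False)])],
    [(44,False,False,[(1,False),(2,False),(3,False),(0,True),(4,False),(5,False)]),
    (43,True,False,[(4,False),(0,False),(1,False),(5,False),(3,False),(2,False)]),
    (51,False,False,[(0,False),(4,True),(5,False),(1,False),(2,False),(3,False)])],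
    [(50,False,False,[(1,False),(2,False),(3,False),(4,False),(0,False),(5,False)]),
    (51,False,False,[(1,False),(2,False),(3,False),(0,False),(4,False),(5,False)]),
    (42,False,False,[(1,False),(0,False),(2,False),(3,False),(4,False),(5,False)])],
    [(48,False,False,[(1,False),(2,False),(3,False),(4,False),(0,False),(5,False)]),
    (46,True,False,[(0,False),(4,False),(1,False),(3,False),(2,False),(5,False)]),
    (52,False,False,[(0,False),(1,False),(3,False),(2,False),(5,False),(4,False)])],
    [(45,False,False,[(4,False),(0,False),(3,False),(5,False),(1,False),(2,False)]),
    (48,False,False,[(4,False),(0,False),(3,False),(5,False),(1,False),(2,False)]),
    (45,False,False,[(5,False),(2,False),(3,False),(1,False),(4,False),(0,False)])],
    [(47,False,False,[(4,False),(5,False),(3,False),(0,False),(1,False),(2,False)]),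
    (52,False,False,[(1,False),(2,False),(3,False),(0,False),(4,False),(5,False)]),
    (45,False,False,[(5,False),(4,False),(3,False),(0,False),(2,False),(1,False)])],
    [(47,False,False,[(1,False),(2,False),(0,False),(3,False),(4,False),(5,False)]),
    (45,False,False,[(1,False),(2,False),(0,False),(3,False),(4,False),(5,False)]),
    (53,False,False,[(0,False),(4,False),(1,False),(5,False),(2,False),(3,False)])],
    [(54,False,False,[(0,False),(6,False),(5,False),(3,False),(4,True),(1,True),(2,True)]),
    (54,False,False,[(0,False),(5,False),(6,False),(1,False),(2,False),(3,True),(4,False)])],
    [(54,False,False,[(1,False),(2,False),(3,False),(4,False),(5,False),(0,True),(6,False)]),
    (54,False,False,[(4,False),(5,False),(6,False),(1,False),(2,False),(0,True),(3,False)])],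
    [(54,False,False,[(5,False),(6,False),(4,False),(0,False),(3,True),(1,True),(2,True)]),
    (54,False,False,[(1,False),(2,False),(3,False),(0,False),(4,False),(5,False),(6,False)])],
    [(55,False,False,[(1,False),(2,False),(0,False),(3,False),(4,False),(5,False),(6,False)]),
    (56,False,False,[(0,False),(5,False),(1,False),(3,False),(6,False),(2,False),(4,False)])],
    [(55,False,False,[(0,False),(6,False),(5,False),(4,False),(2,False),(3,False),(1,False)]),
    (55,False,False,[(0,False),(3,False),(4,False),(5,False),(1,False),(6,False),(2,False)])],
    [(55,False,False,[(1,False),(2,False),(3,False),(0,False),(4,False),(5,False),(6,False)]),
    (56,False,False,[(1,False),(2,False),(0,False),(3,False),(4,False),(5,False),(6,False)])],
    [(55,False,False,[(1,False),(0,False),(2,False),(3,False),(4,False),(5,False),(6,False)]),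
    (55,False,False,[(4,False),(6,False),(2,False),(3,False),(5,False),(1,False),(0,False)])],
    [],
    [(54,False,False,[(3,False),(2,True),(1,True),(6,False),(5,False),(4,True),(0,True)]),
    (54,False,False,[(5,False),(6,False),(4,False),(2,False),(3,True),(1,True),(0,True)])],
    [(54,False,False,[(3,False),(2,True),(1,True),(6,False),(0,False),(5,True),(4,True)]),
    (54,False,False,[(4,False),(5,False),(6,False),(1,False),(0,False),(2,True),(3,False)])],
    [(55,False,False,[(5,False),(6,False),(3,False),(4,False),(0,False),(1,False),(2,False)]),
    (55,False,False,[(6,False),(5,False),(4,False),(3,False),(0,False),(2,False),(1,False)])],
    [(56,False,False,[(1,False),(2,False),(3,False),(0,False),(4,False),(5,False),(6,False)]),
    (56,False,False,[(2,False),(1,False),(4,False),(0,False),(3,False),(6,False),(5,False)])],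
    [(57,False,False,[(0,False),(3,True),(1,False),(2,True),(6,False),(7,False),(4,False),(5,False)])],
    [(58,False,False,[(0,False),(6,False),(1,False),(4,False),(3,False),(7,False),(2,False),(5,False)])],
    [(58,False,False,[(1,False),(2,False),(3,False),(4,False),(0,False),(5,False),(6,False),(7,False)])],
    [],
    []]"


section \<open>Checking the certificates by evaluation\<close>

definition cell_mats :: "zphi list list list" where
  "cell_mats = map (\<lambda>(k, vs). map (\<lambda>i. map (\<lambda>j. graph_mat (graphs ! k) ! i ! j) vs) vs) cells"

text \<open>The list of cells is an argument so that the checks run against its value from
  \<open>cell_mats_eval\<close>, instead of computing it again for each certificate.\<close>

definition matches :: "zphi list list list \<Rightarrow> zphi list list \<Rightarrow> cert \<Rightarrow> bool" where
  "matches Cs B c = (case c of (r, cj, ng, ps) \<Rightarrow> r < length Cs \<and>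
      list_all (\<lambda>(t, _). t < length B) ps \<and> distinct (map fst ps) \<and> length ps = length B \<and>
      Cs ! r = signed_minor cj ng ps (\<lambda>t u. B ! t ! u))"

definition edge_mats :: "zphi list list list" where
  "edge_mats = concat (map (\<lambda>c. map (\<lambda>d. [[c, ZP 0 1], [ZP 0 1, d]]) entries) entries)"

text \<open>Rows are multiplied with rows, which computes the square because the graph matrices are
  symmetric.\<close>

definition squares_to_four :: "zphi list list \<Rightarrow> bool" where
  "squares_to_four B = list_all (\<lambda>i. list_all (\<lambda>j.
     dot (B ! i) (B ! j) = (if i = j then ZP 4 0 else ZP 0 0)) [0..<length B]) [0..<length B]"

schematic_goal cell_mats_eval: "cell_mats = ?Cs" by code_simp

lemma edge_cert_correct: "list_all2 (matches cell_mats) (filter admissible edge_mats) edge_cert"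
  unfolding cell_mats_eval by code_simp

lemma ext_cert_correct:
  "list_all2 (\<lambda>R cs. list_all2 (matches cell_mats) (filter admissible (extensions R)) cs) cell_mats ext_cert"
  unfolding cell_mats_eval by code_simp

lemma cells_correct: "list_all (\<lambda>(k, vs). k < length graphs \<and> distinct vs \<and>
    list_all (\<lambda>v. v < length (fst (graphs ! k))) vs) cells"
  by code_simp

lemma graphs_square: "list_all (\<lambda>G. squares_to_four (graph_mat G)) graphs"
  by code_simp

lemma graphs_connected: "list_all (\<lambda>G. list_all (\<lambda>i. list_ex (\<lambda>j. weight (fst G) (snd G) j i \<noteq> ZP 0 0) [0..<i])
    [1..<length (fst G)]) graphs"
  by code_simp

text \<open>The seed for an irrational charge; \<open>edge_cert\<close> supplies the seeds for an
  irrational edge.\<close>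

lemma phi_cell: "[[ZP 0 1]] \<in> set cell_mats"
  unfolding cell_mats_eval by code_simp

section \<open>Signed minors under the two embeddings\<close>

definition sgn_of :: "bool \<Rightarrow> real" where "sgn_of b = (if b then -1 else 1)"

lemma sgn_of_simps: "sgn_of a * sgn_of a = 1" "sgn_of (a \<noteq> b) = sgn_of a * sgn_of b" "(sgn_of a)\<^sup>2 = 1"
  by (auto simp: sgn_of_def)

lemma sgn_of_nonzero [simp]: "sgn_of a \<noteq> 0"
  by (simp add: sgn_of_def)

lemma emb_twist: "emb c (twist cj ng z) = sgn_of ng * emb (c \<noteq> cj) z"
  by (cases cj; cases ng) (simp_all add: twist_def sgn_of_def Let_def)

lemma zcnj_zcnj: "zcnj (zcnj z) = z" and zcnj_minus: "zcnj (- z) = - zcnj z"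
  by (cases z; simp)+

lemma twist_twist: "twist a b (twist c d z) = twist (a \<noteq> c) (b \<noteq> d) z"
  by (cases a; cases b; cases c; cases d) (simp_all add: twist_def Let_def zcnj_zcnj zcnj_minus)

lemma length_signed_minor [simp]: "length (signed_minor cj ng ps F) = length ps"
  by (simp add: signed_minor_def)

lemma nth_signed_minor:
  assumes "t < length ps" "u < length ps"
  shows "signed_minor cj ng ps F ! t ! u = twist cj (ng \<noteq> (snd (ps ! t) \<noteq> snd (ps ! u))) (F (fst (ps ! t)) (fst (ps ! u)))"
  using assms by (simp add: signed_minor_def case_prod_beta)

lemma emb_nth_signed_minor:
  assumes "t < length ps" "u < length ps"
  shows "emb c (signed_minor cj ng ps F ! t ! u)
    = sgn_of ng * sgn_of (snd (ps ! t)) * sgn_of (snd (ps ! u)) * emb (c \<noteq> cj) (F (fst (ps ! t)) (fst (ps ! u)))"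
  unfolding nth_signed_minor[OF assms] emb_twist sgn_of_simps(2) by (simp only: mult.assoc)

lemma length_nth_signed_minor [simp]: "t < length ps \<Longrightarrow> length (signed_minor cj ng ps F ! t) = length ps"
  by (simp add: signed_minor_def case_prod_beta)

text \<open>Turns a certificate about a minor of \<open>Z\<close> into one about \<open>Z\<close>
  itself.\<close>

lemma signed_minor_signed_minor:
  assumes "\<And>t s. (t, s) \<in> set qs \<Longrightarrow> t < length ps"
  shows "signed_minor a b qs (\<lambda>t u. signed_minor cj ng ps F ! t ! u)
    = signed_minor (a \<noteq> cj) (b \<noteq> ng) (map (\<lambda>(t, s). (fst (ps ! t), s \<noteq> snd (ps ! t))) qs) F"
    (is "?L = signed_minor _ _ ?qs F")
proof (rule nth_equalityI)
  show "length ?L = length (signed_minor (a \<noteq> cj) (b \<noteq> ng) ?qs F)" by simp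
  fix t assume "t < length ?L"
  then have t: "t < length qs" by simp
  show "?L ! t = signed_minor (a \<noteq> cj) (b \<noteq> ng) ?qs F ! t"
  proof (rule nth_equalityI)
    show "length (?L ! t) = length (signed_minor (a \<noteq> cj) (b \<noteq> ng) ?qs F ! t)" using t by simp
    fix u assume "u < length (?L ! t)"
    then have u: "u < length qs" using t by simp
    have l: "fst (qs ! t) < length ps" "fst (qs ! u) < length ps"
      using assms[of "fst (qs ! t)" "snd (qs ! t)"] assms[of "fst (qs ! u)" "snd (qs ! u)"] t u by simp_all
    have "((b \<noteq> (p \<noteq> q)) \<noteq> (ng \<noteq> (r \<noteq> s))) = ((b \<noteq> ng) \<noteq> ((p \<noteq> r) \<noteq> (q \<noteq> s)))" for p q r s :: bool
      by blast
    then show "?L ! t ! u = signed_minor (a \<noteq> cj) (b \<noteq> ng) ?qs F ! t ! u"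
      using t u l by (simp add: nth_signed_minor twist_twist case_prod_beta)
  qed
qed

lemma emb_dot:
  "length xs = length ys \<Longrightarrow> emb c (dot xs ys) = (\<Sum>u<length xs. emb c (xs ! u) * emb c (ys ! u))"
proof (induction xs ys rule: list_induct2)
  case (Cons x xs y ys)
  then show ?case by (simp add: sum.lessThan_Suc_shift del: sum.lessThan_Suc)
qed simp

lemma le_imp_tnn: "emb False x \<le> emb False y \<Longrightarrow> emb True x \<le> emb True y \<Longrightarrow> tnn (y - x)"
  by (simp add: tnn_iff)

lemma emb_ZP_four [simp]: "emb c (ZP 4 0) = 4" by simp

lemma bij_betw_fst_nth:
  assumes "distinct (map fst qs)"
  shows "bij_betw (\<lambda>t. fst (qs ! t)) {..<length qs} (set (map fst qs))"
proof -
  have "bij_betw (\<lambda>t. fst (qs ! t)) {..<length qs} (set (map fst qs))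
      = bij_betw ((!) (map fst qs)) {..<length qs} (set (map fst qs))"
    by (rule bij_betw_cong) simp
  then show ?thesis using bij_betw_nth[OF assms _ refl, of "{..<length qs}"] by simp
qed

lemma signed_minor_contractive:
  fixes cj ng :: bool
  assumes fin: "finite V" and con: "\<And>c. contractive V (\<lambda>i j. emb c (Z i j))"
    and qs: "distinct (map fst qs)" "set (map fst qs) \<subseteq> V" and v: "length v = length qs"
  defines "B \<equiv> signed_minor cj ng qs Z"
  shows "tnn (ZP 4 0 * dot v v - dot (map (\<lambda>r. dot r v) B) (map (\<lambda>r. dot r v) B))"
proof -
  let ?n = "length qs"
  let ?f = "\<lambda>t. fst (qs ! t)" and ?s = "\<lambda>t. sgn_of (snd (qs ! t))"
  have bij: "bij_betw ?f {..<?n} (set (map fst qs))"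
    by (rule bij_betw_fst_nth[OF qs(1)])
  have inV: "?f t \<in> V" if "t < ?n" for t using qs(2) that by (auto simp: subset_iff)
  have inj: "?f t = ?f u \<longleftrightarrow> t = u" if "t < ?n" "u < ?n" for t u
    using bij that inj_on_eq_iff[of ?f "{..<?n}" t u] by (simp add: bij_betw_def)
  have le: "emb c (dot (map (\<lambda>r. dot r v) B) (map (\<lambda>r. dot r v) B)) \<le> 4 * emb c (dot v v)" for c
  proof -
    define e where "e u = emb c (v ! u)" for u
    \<comment> \<open>The signed extension of \<open>e\<close> by zero to \<open>V\<close>; the
      listed vertices are distinct, so at most one summand is nonzero.\<close>
    define y where "y j = (\<Sum>u<?n. if ?f u = j then ?s u * e u else 0)" for j
    have yf: "y (?f t) = ?s t * e t" if "t < ?n" for t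
    proof -
      have "y (?f t) = (\<Sum>u<?n. if u = t then ?s t * e t else 0)"
        unfolding y_def using inj that by (intro sum.cong refl) auto
      then show ?thesis using that by simp
    qed
    have y0: "y j = 0" if "j \<notin> set (map fst qs)" for j
      unfolding y_def using that by (intro sum.neutral) auto
    have "(\<Sum>j\<in>V. (y j)\<^sup>2) = (\<Sum>j\<in>set (map fst qs). (y j)\<^sup>2)"
      using fin qs(2) y0 by (intro sum.mono_neutral_right) auto
    also have "\<dots> = (\<Sum>t<?n. (y (?f t))\<^sup>2)" using sum.reindex_bij_betw[OF bij, of "\<lambda>j. (y j)\<^sup>2"] by simp
    also have "\<dots> = (\<Sum>t<?n. (e t)\<^sup>2)" using yf by (intro sum.cong refl) (simp add: power_mult_distrib sgn_of_simps)
    also have "\<dots> = emb c (dot v v)" using v by (simp add: emb_dot e_def power2_eq_square)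
    finally have ny: "(\<Sum>j\<in>V. (y j)\<^sup>2) = emb c (dot v v)" .
    let ?A = "apply_on V (\<lambda>i j. emb (c \<noteq> cj) (Z i j)) y"
    have A: "?A i = (\<Sum>u<?n. emb (c \<noteq> cj) (Z i (?f u)) * (?s u * e u))" for i
    proof -
      have "?A i = (\<Sum>j\<in>set (map fst qs). emb (c \<noteq> cj) (Z i j) * y j)"
        unfolding apply_on_def using fin qs(2) y0 by (intro sum.mono_neutral_right) auto
      also have "\<dots> = (\<Sum>u<?n. emb (c \<noteq> cj) (Z i (?f u)) * y (?f u))"
        using sum.reindex_bij_betw[OF bij, of "\<lambda>j. emb (c \<noteq> cj) (Z i j) * y j"] by simp
      also have "\<dots> = (\<Sum>u<?n. emb (c \<noteq> cj) (Z i (?f u)) * (?s u * e u))" using yf by simp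
      finally show ?thesis .
    qed
    have row: "emb c (dot (B ! t) v) = sgn_of ng * ?s t * ?A (?f t)" if t: "t < ?n" for t
    proof -
      have "length (B ! t) = length v" using v t by (simp add: B_def signed_minor_def case_prod_beta)
      then have "emb c (dot (B ! t) v) = (\<Sum>u<?n. emb c (B ! t ! u) * e u)" using v by (simp add: emb_dot e_def)
      also have "\<dots> = (\<Sum>u<?n. sgn_of ng * ?s t * (emb (c \<noteq> cj) (Z (?f t) (?f u)) * (?s u * e u)))"
        using t by (intro sum.cong refl) (simp add: B_def emb_nth_signed_minor)
      finally show ?thesis unfolding A sum_distrib_left .
    qed
    have lB: "length B = ?n" by (simp add: B_def)
    have "emb c (dot (map (\<lambda>r. dot r v) B) (map (\<lambda>r. dot r v) B)) = (\<Sum>t<?n. (?A (?f t))\<^sup>2)"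
      unfolding emb_dot[OF refl] using lB row
      by (simp add: power2_eq_square[symmetric] power_mult_distrib sgn_of_simps)
    also have "\<dots> = (\<Sum>i\<in>set (map fst qs). (?A i)\<^sup>2)" using sum.reindex_bij_betw[OF bij, of "\<lambda>j. (?A j)\<^sup>2"] by simp
    also have "\<dots> \<le> (\<Sum>i\<in>V. (?A i)\<^sup>2)" using fin qs(2) by (intro sum_mono2) auto
    also have "\<dots> \<le> 4 * (\<Sum>i\<in>V. (y i)\<^sup>2)" using con[of "c \<noteq> cj"] unfolding contractive_def by blast
    finally show ?thesis unfolding ny .
  qed
  show ?thesis by (rule le_imp_tnn) (use le in simp_all)
qed

lemma contracting_if:
  assumes "\<And>v. length v = length B \<Longrightarrow> tnn (ZP 4 0 * dot v v - dot (map (\<lambda>r. dot r v) B) (map (\<lambda>r. dot r v) B))"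
    and "length v = length B" and "m = dot v v"
  shows "contracting k B v m"
  using assms(2,3)
proof (induction k arbitrary: v m)
  case (Cons a k)
  then show ?case using assms(1)[of v] by (simp add: Let_def)
qed simp

lemma dot_unit: "dot (ZP 1 0 # map (\<lambda>_. ZP 0 0) xs) (ZP 1 0 # map (\<lambda>_. ZP 0 0) xs) = ZP 1 0"
proof -
  have "dot (map (\<lambda>_. ZP 0 0) xs) (map (\<lambda>_. ZP 0 0) xs) = 0"
    by (induction xs) (simp_all add: zero_zphi_def)
  then show ?thesis by (simp add: zero_zphi_def)
qed

lemma admissible_signed_minor:
  assumes "finite V" "\<And>c. contractive V (\<lambda>i j. emb c (Z i j))"
    and "distinct (map fst qs)" "set (map fst qs) \<subseteq> V" "qs \<noteq> []"
  shows "admissible (signed_minor cj ng qs Z)"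
  unfolding admissible_def
proof (rule contracting_if)
  let ?B = "signed_minor cj ng qs Z"
  show "tnn (ZP 4 0 * dot v v - dot (map (\<lambda>r. dot r v) ?B) (map (\<lambda>r. dot r v) ?B))" if "length v = length ?B" for v
    using signed_minor_contractive[OF assms(1-4), of v cj ng] that by simp
  show "length (ZP 1 0 # map (\<lambda>_. ZP 0 0) (tl ?B)) = length ?B" using assms(5) by (cases qs) (simp_all add: signed_minor_def)
  show "ZP 1 0 = dot (ZP 1 0 # map (\<lambda>_. ZP 0 0) (tl ?B)) (ZP 1 0 # map (\<lambda>_. ZP 0 0) (tl ?B))" by (simp only: dot_unit)
qed

text \<open>The bounds under which the enumeration is complete; symmetry converts the column bound
  of a contraction into a row bound.\<close>

lemma signed_minor_row:
  assumes fin: "finite V" and con: "\<And>c. contractive V (\<lambda>i j. emb c (Z i j))" and sym: "\<And>i j. Z i j = Z j i"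
    and qs: "distinct (map fst qs)" "set (map fst qs) \<subseteq> V" and r: "r \<in> set (signed_minor cj ng qs Z)"
  shows "tnn (ZP 4 0 - dot r r)" "set r \<subseteq> set entries"
proof -
  let ?n = "length qs" and ?f = "\<lambda>t. fst (qs ! t)"
  obtain t where t: "t < ?n" "r = signed_minor cj ng qs Z ! t" using r by (metis in_set_conv_nth length_signed_minor)
  have bij: "bij_betw ?f {..<?n} (set (map fst qs))"
    by (rule bij_betw_fst_nth[OF qs(1)])
  have lr: "length r = ?n" using t by (simp add: signed_minor_def case_prod_beta)
  have inV: "?f t \<in> V" using qs(2) t by (auto simp: subset_iff)
  have le: "emb c (dot r r) \<le> 4" for c
  proof -
    have "emb c (dot r r) = (\<Sum>u<?n. (emb (c \<noteq> cj) (Z (?f u) (?f t)))\<^sup>2)"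
      unfolding emb_dot[OF refl] lr
    proof (intro sum.cong refl)
      fix u assume "u \<in> {..<?n}"
      then have "emb c (r ! u) = sgn_of ng * sgn_of (snd (qs ! t)) * sgn_of (snd (qs ! u)) * emb (c \<noteq> cj) (Z (?f u) (?f t))"
        using t by (simp add: emb_nth_signed_minor sym[of "?f t"])
      then show "emb c (r ! u) * emb c (r ! u) = (emb (c \<noteq> cj) (Z (?f u) (?f t)))\<^sup>2"
        by (simp add: power2_eq_square[symmetric] power_mult_distrib sgn_of_simps(3))
    qed
    also have "\<dots> = (\<Sum>i\<in>set (map fst qs). (emb (c \<noteq> cj) (Z i (?f t)))\<^sup>2)"
      using sum.reindex_bij_betw[OF bij, of "\<lambda>i. (emb (c \<noteq> cj) (Z i (?f t)))\<^sup>2"] by simp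
    also have "\<dots> \<le> (\<Sum>i\<in>V. (emb (c \<noteq> cj) (Z i (?f t)))\<^sup>2)" using fin qs(2) by (intro sum_mono2) auto
    also have "\<dots> \<le> 4" by (rule contractive_column[OF con fin inV])
    finally show ?thesis .
  qed
  show "tnn (ZP 4 0 - dot r r)" by (rule le_imp_tnn) (use le in simp_all)
  show "set r \<subseteq> set entries"
  proof
    fix e assume "e \<in> set r"
    then obtain u where u: "u < length r" "e = r ! u" by (auto simp: in_set_conv_nth)
    have "(emb c e)\<^sup>2 \<le> 4" for c
    proof -
      have "emb c (r ! u) * emb c (r ! u) \<le> (\<Sum>u<length r. emb c (r ! u) * emb c (r ! u))"
        using u(1) by (intro member_le_sum) auto
      then show ?thesis using le[of c] unfolding emb_dot[OF refl] u(2) power2_eq_square by linarith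
    qed
    from this this show "e \<in> set entries" by (rule in_entries)
  qed
qed

section \<open>Completeness of the enumeration\<close>

fun lead_pos :: "zphi list \<Rightarrow> bool" where
  "lead_pos [] = False"
| "lead_pos (e # es) = (if e = 0 then lead_pos es else e \<in> set entries_pos)"

text \<open>Switching the sign of the new vertex negates its whole row, so this justifies a search
  up to sign.\<close>

lemma lead_pos_or:
  assumes "set x \<subseteq> set entries" "\<exists>e\<in>set x. e \<noteq> 0"
  shows "lead_pos x \<or> lead_pos (map uminus x)"
  using assms
proof (induction x)
  case (Cons e x)
  have "e = 0 \<or> e \<in> set entries_pos \<or> - e \<in> set entries_pos"
    using Cons.prems(1) by (auto simp: entries_def entries_pos_def zero_zphi_def)
  then show ?case using Cons by (cases "e = 0") auto
qed simp

lemma dot_self_nonneg: "0 \<le> emb c (dot x x)"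
  unfolding emb_dot[OF refl] by (intro sum_nonneg) simp

text \<open>Pruning on the remainder of \<open>s\<close> loses nothing: what the rest of the row
  spends is totally nonnegative, so every partial remainder is too.\<close>

lemma rows_within_complete:
  assumes "list_all2 (\<lambda>e d. e \<in> set entries \<and> tnn (d - e * e)) x ds" "tnn (s - dot x x)" "nz \<or> lead_pos x"
  shows "x \<in> set (rows_within nz ds s)"
  using assms
proof (induction x ds arbitrary: nz s rule: list_all2_induct)
  case Nil then show ?case by simp
next
  case (Cons e x d ds)
  have e: "e \<in> set entries" "tnn (d - e * e)" using Cons.hyps by simp_all
  have s: "tnn (s - e * e - dot x x)" using Cons.prems(1) by (simp add: algebra_simps)
  then have "0 \<le> emb c (s - e * e)" for c
    using dot_self_nonneg[of c x] by (cases c) (auto simp: tnn_iff)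
  then have s': "tnn (s - e * e)" by (simp add: tnn_iff)
  have "(nz \<or> e \<noteq> ZP 0 0) \<or> lead_pos x" using Cons.prems(2) by (auto simp: zero_zphi_def split: if_splits)
  from Cons.IH[OF s this] have IH: "x \<in> set (rows_within (nz \<or> e \<noteq> ZP 0 0) ds (s - e * e))" .
  have "e \<in> set (if nz then entries else entries_pos)"
    using Cons.prems(2) e(1) by (auto simp: zero_zphi_def entries_pos_def split: if_splits)
  then show ?case using e(2) s' IH by (auto simp: Let_def intro!: bexI[of _ e])
qed

section \<open>Growing a vertex set that carries a cell\<close>

definition realized :: "(nat \<Rightarrow> nat \<Rightarrow> zphi) \<Rightarrow> nat set \<Rightarrow> bool" where
  "realized Z W \<longleftrightarrow> (\<exists>cj ng ps. distinct (map fst ps) \<and> set (map fst ps) = W \<and> signed_minor cj ng ps Z \<in> set cell_mats)"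

lemma realized_if_matches:
  assumes "distinct (map fst qs)" "matches cell_mats (signed_minor cj ng qs Z) c"
  shows "realized Z (set (map fst qs))"
proof -
  let ?B = "signed_minor cj ng qs Z"
  obtain r a b ps where c: "c = (r, a, b, ps)" by (cases c)
  have r: "r < length cell_mats" "\<And>t s. (t, s) \<in> set ps \<Longrightarrow> t < length qs" "distinct (map fst ps)" "length ps = length qs"
    "cell_mats ! r = signed_minor a b ps (\<lambda>t u. ?B ! t ! u)"
    using assms(2) by (auto simp: matches_def c list_all_iff)
  define ps' where "ps' = map (\<lambda>(t, s). (fst (qs ! t), s \<noteq> snd (qs ! t))) ps"
  have eq: "cell_mats ! r = signed_minor (a \<noteq> cj) (b \<noteq> ng) ps' Z"
    unfolding r(5) ps'_def by (rule signed_minor_signed_minor[OF r(2)])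
  have fst: "map fst ps' = map (\<lambda>t. map fst qs ! t) (map fst ps)"
    using r(2) by (force simp: ps'_def)
  have sub: "set (map fst ps) \<subseteq> {..<length qs}" using r(2) by auto
  \<comment> \<open>As many distinct indices as \<open>qs\<close> has entries, so \<open>ps\<close>
    is a permutation and no vertex is lost.\<close>
  have "card (set (map fst ps)) = length qs" using r(3,4) by (metis distinct_card length_map)
  then have all: "set (map fst ps) = {..<length qs}" using sub by (simp add: card_subset_eq)
  have "inj_on ((!) (map fst qs)) (set (map fst ps))"
    unfolding all using assms(1) by (intro inj_on_nth) simp_all
  then have "distinct (map fst ps')"
    unfolding fst distinct_map[of _ "map fst ps"] using r(3) by blast
  moreover have "set (map fst ps') = set (map fst qs)"
    unfolding fst set_map[of _ "map fst ps"] all set_conv_nth[of "map fst qs"]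
    unfolding length_map by blast
  ultimately show ?thesis unfolding realized_def using eq r(1) by (metis nth_mem)
qed

lemma list_all2_mem1: "list_all2 P xs ys \<Longrightarrow> x \<in> set xs \<Longrightarrow> \<exists>y\<in>set ys. P x y"
  by (induction rule: list_all2_induct) auto

text \<open>\<open>w\<close> is put at the head because the iteration in \<open>admissible\<close>
  starts from the first basis vector. Adjacency to \<open>W\<close> makes the new row nonzero, the
  only kind \<open>rows_within\<close> produces.\<close>

lemma realized_step:
  assumes fin: "finite V" and con: "\<And>c. contractive V (\<lambda>i j. emb c (Z i j))" and sym: "\<And>i j. Z i j = Z j i"
    and W: "realized Z W" "W \<subseteq> V" and w: "w \<in> V" "w \<notin> W" and adj: "\<exists>v\<in>W. Z w v \<noteq> 0"
  shows "realized Z (insert w W)"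
proof -
  obtain cj ng ps where ps: "distinct (map fst ps)" "set (map fst ps) = W" "signed_minor cj ng ps Z \<in> set cell_mats"
    using W(1) by (auto simp: realized_def)
  let ?C = "signed_minor cj ng ps Z"
  define x where "x b = map (\<lambda>(u, s'). twist cj (ng \<noteq> (b \<noteq> s')) (Z w u)) ps" for b
  define c where "c = twist cj ng (Z w w)"
  have B: "signed_minor cj ng ((w, b) # ps) Z = bordered c (x b) ?C" for b
  proof -
    have swap: "twist cj (ng \<noteq> (s \<noteq> b)) (Z t w) = twist cj (ng \<noteq> (b \<noteq> s)) (Z w t)" for s t
    proof -
      have "(s \<noteq> b) = (b \<noteq> s)" by blast
      then show ?thesis by (simp only: sym[of t w])
    qed
    have "(ng \<noteq> (b \<noteq> b)) = ng" by simp
    then show ?thesis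
      by (simp only: signed_minor_def bordered_def x_def c_def list.map case_prod_beta map2_map_map fst_conv snd_conv swap)
        (simp add: case_prod_beta)
  qed
  have qs: "distinct (map fst ((w, b) # ps))" "set (map fst ((w, b) # ps)) \<subseteq> V" "set (map fst ((w, b) # ps)) = insert w W" for b
    using ps W(2) w by auto
  note row = signed_minor_row[OF fin con sym qs(1,2), of _ cj ng]
  have lx: "length (x b) = length ?C" for b by (simp add: x_def)
  have top: "c # x b \<in> set (signed_minor cj ng ((w, b) # ps) Z)" for b unfolding B bordered_def by simp
  have "set (x False) \<subseteq> set entries" using row(2)[OF top[of False]] by auto
  moreover have "\<exists>e\<in>set (x False). e \<noteq> 0"
  proof -
    obtain v where v: "v \<in> W" "Z w v \<noteq> 0" using adj by blast
    then obtain s where "(v, s) \<in> set ps" using ps(2) by auto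
    then have "twist cj (ng \<noteq> (False \<noteq> s)) (Z w v) \<in> set (x False)" by (force simp: x_def)
    moreover have "twist cj (ng \<noteq> (False \<noteq> s)) (Z w v) \<noteq> 0"
    proof
      assume "twist cj (ng \<noteq> (False \<noteq> s)) (Z w v) = 0"
      then have "emb False (twist cj (ng \<noteq> (False \<noteq> s)) (Z w v)) = 0" by simp
      then show False using v(2) unfolding emb_twist by (simp add: sgn_of_def split: if_splits)
    qed
    ultimately show ?thesis by blast
  qed
  ultimately have "lead_pos (x False) \<or> lead_pos (map uminus (x False))" by (rule lead_pos_or)
  moreover have "map uminus (x False) = x True" by (auto simp: x_def twist_def Let_def)
  ultimately obtain b where b: "lead_pos (x b)" by metis
  have ent: "c \<in> set entries" "set (x b) \<subseteq> set entries" using row(2)[OF top[of b]] by auto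
  have tot: "tnn (ZP 4 0 - c * c - dot (x b) (x b))" using row(1)[OF top[of b]] by (simp add: algebra_simps)
  then have "0 \<le> emb a (ZP 4 0 - c * c)" for a
    using dot_self_nonneg[of a "x b"] by (cases a) (auto simp: tnn_iff)
  then have tc: "tnn (ZP 4 0 - c * c)" by (simp add: tnn_iff)
  have "list_all2 (\<lambda>e d. e \<in> set entries \<and> tnn (d - e * e)) (x b) (map (\<lambda>r. ZP 4 0 - dot r r) ?C)"
    unfolding list_all2_conv_all_nth
  proof (intro conjI allI impI)
    show "length (x b) = length (map (\<lambda>r. ZP 4 0 - dot r r) ?C)" using lx by simp
    fix i assume i: "i < length (x b)"
    then show "x b ! i \<in> set entries" using ent(2) by (auto simp: subset_iff)
    have "(x b ! i) # (?C ! i) \<in> set (signed_minor cj ng ((w, b) # ps) Z)"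
      unfolding B bordered_def using i lx by (force simp: set_zip)
    from row(1)[OF this] show "tnn (map (\<lambda>r. ZP 4 0 - dot r r) ?C ! i - x b ! i * x b ! i)"
      using i lx by (simp add: algebra_simps)
  qed
  then have "x b \<in> set (rows_within False (map (\<lambda>r. ZP 4 0 - dot r r) ?C) (ZP 4 0 - c * c))"
    using tot b by (intro rows_within_complete) auto
  then have "bordered c (x b) ?C \<in> set (extensions ?C)"
    unfolding extensions_def Let_def using ent(1) tc by (auto intro!: bexI[of _ c])
  moreover have "admissible (bordered c (x b) ?C)"
    unfolding B[symmetric] by (rule admissible_signed_minor[OF fin con qs(1,2)]) simp
  ultimately have mem: "bordered c (x b) ?C \<in> set (filter admissible (extensions ?C))" by simp
  obtain cs where cs: "list_all2 (matches cell_mats) (filter admissible (extensions ?C)) cs"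
    using list_all2_mem1[OF ext_cert_correct ps(3)] by blast
  from list_all2_mem1[OF cs mem] obtain ct where "matches cell_mats (bordered c (x b) ?C) ct" by blast

  then have "realized Z (set (map fst ((w, b) # ps)))"
    unfolding B[symmetric] by (rule realized_if_matches[OF qs(1)])
  then show ?thesis unfolding qs(3) .
qed

lemma entry_cases:
  assumes "e \<in> set entries"
  obtains k where "e = ZP k 0" | cj ng where "twist cj ng e = ZP 0 1"
proof -
  have "(\<exists>k. e = ZP k 0) \<or> e \<in> {ZP 0 1, ZP 0 (-1), ZP 1 (-1), ZP (-1) 1}"
    using assms by (auto simp: entries_def)
  moreover have "twist False False (ZP 0 1) = ZP 0 1" "twist False True (ZP 0 (-1)) = ZP 0 1"
    "twist True False (ZP 1 (-1)) = ZP 0 1" "twist True True (ZP (-1) 1) = ZP 0 1"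
    by (simp_all add: twist_def)
  ultimately show ?thesis using that by blast
qed

text \<open>A global twist turns any irrational entry into phi. On the diagonal it is a cell by
  itself; off the diagonal the two vertices form one of the matrices in
  \<open>edge_mats\<close>.\<close>

lemma realized_seed:
  assumes fin: "finite V" and con: "\<And>c. contractive V (\<lambda>i j. emb c (Z i j))" and sym: "\<And>i j. Z i j = Z j i"
    and irr: "v \<in> V" "w \<in> V" "\<nexists>k. Z v w = ZP k 0"
  shows "\<exists>W. W \<subseteq> V \<and> W \<noteq> {} \<and> realized Z W"
proof -
  have ent: "Z i j \<in> set entries" if "i \<in> V" "j \<in> V" for i j
  proof -
    have "(emb c (Z i j))\<^sup>2 \<le> 4" for c
    proof -
      have "(emb c (Z i j))\<^sup>2 \<le> (\<Sum>i\<in>V. (emb c (Z i j))\<^sup>2)" using fin that by (intro member_le_sum) auto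
      also have "\<dots> \<le> 4" by (rule contractive_column[OF con fin that(2)])
      finally show ?thesis .
    qed
    from this this show ?thesis by (rule in_entries)
  qed
  obtain cj ng where tw: "twist cj ng (Z v w) = ZP 0 1" using entry_cases[OF ent[OF irr(1,2)]] irr(3) by blast
  show ?thesis
  proof (cases "v = w")
    case True
    have "signed_minor cj ng [(v, False)] Z = [[ZP 0 1]]" using tw True by (simp add: signed_minor_def)
    then have "realized Z {v}"
      unfolding realized_def using phi_cell by (intro exI[of _ cj] exI[of _ ng] exI[of _ "[(v, False)]"]) simp
    then show ?thesis using irr(1) by blast
  next
    case False
    let ?qs = "[(v, False), (w, False)]"
    have qs: "distinct (map fst ?qs)" "set (map fst ?qs) \<subseteq> V" using False irr by auto
    define c d where "c = twist cj ng (Z v v)" and "d = twist cj ng (Z w w)"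
    have B: "signed_minor cj ng ?qs Z = [[c, ZP 0 1], [ZP 0 1, d]]"
      using tw sym[of w v] by (simp add: signed_minor_def c_def d_def)
    have "[c, ZP 0 1] \<in> set (signed_minor cj ng ?qs Z)" "[ZP 0 1, d] \<in> set (signed_minor cj ng ?qs Z)"
      unfolding B by simp_all
    then have "c \<in> set entries" "d \<in> set entries"
      using signed_minor_row(2)[OF fin con sym qs] by (metis insert_subset list.simps(15))+
    then have "signed_minor cj ng ?qs Z \<in> set edge_mats" unfolding B edge_mats_def by (auto intro!: bexI[of _ c])
    then have mem: "signed_minor cj ng ?qs Z \<in> set (filter admissible edge_mats)"
      using admissible_signed_minor[OF fin con qs] by simp
    from list_all2_mem1[OF edge_cert_correct mem] obtain ct where "matches cell_mats (signed_minor cj ng ?qs Z) ct" by blast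
    then have "realized Z (set (map fst ?qs))" by (rule realized_if_matches[OF qs(1)])
    then show ?thesis using qs(2) by (intro exI[of _ "set (map fst ?qs)"]) simp
  qed
qed

text \<open>A maximal realized set cannot have a neighbour outside it, so connectivity makes it all
  of \<open>V\<close>.\<close>

lemma realized_all:
  assumes fin: "finite V" and con: "\<And>c. contractive V (\<lambda>i j. emb c (Z i j))" and sym: "\<And>i j. Z i j = Z j i"
    and irr: "v \<in> V" "w \<in> V" "\<nexists>k. Z v w = ZP k 0"
    and conn: "\<And>X. X \<noteq> {} \<Longrightarrow> X \<subseteq> V \<Longrightarrow> X \<noteq> V \<Longrightarrow> \<exists>i\<in>X. \<exists>j\<in>V - X. Z i j \<noteq> 0"
  shows "realized Z V"
proof -
  define F where "F = {W. W \<subseteq> V \<and> W \<noteq> {} \<and> realized Z W}"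
  have "finite F" unfolding F_def using fin by simp
  moreover have "F \<noteq> {}" using realized_seed[OF fin con sym irr] by (auto simp: F_def)
  ultimately obtain W where W: "W \<in> F" "\<And>W'. W' \<in> F \<Longrightarrow> W \<subseteq> W' \<Longrightarrow> W = W'"
    using finite_has_maximal[of F] by blast
  have "W = V"
  proof (rule ccontr)
    assume "W \<noteq> V"
    then obtain i j where ij: "i \<in> W" "j \<in> V" "j \<notin> W" "Z i j \<noteq> 0" using conn[of W] W(1) by (auto simp: F_def)
    then have "\<exists>v\<in>W. Z j v \<noteq> 0" using sym[of j i] by (intro bexI[of _ i]) simp_all
    then have "realized Z (insert j W)"
      using W(1) ij by (intro realized_step[where Z = Z, OF fin con sym]) (auto simp: F_def)
    then have "insert j W \<in> F" using W(1) ij(2) by (auto simp: F_def)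
    from W(2)[OF this] ij(3) show False by blast
  qed
  then show ?thesis using W(1) by (simp add: F_def)
qed

section \<open>The seven graphs as real matrices\<close>

lemma weight_sym: "weight cs es i j = weight cs es j i"
  by (induction es) auto

lemma weight_offdiag:
  "i \<noteq> j \<Longrightarrow> weight cs es i j = sum_list (map (\<lambda>(u, v, w). if u = i \<and> v = j \<or> u = j \<and> v = i then w else 0) es)"
  by (induction es) auto

definition graph_real :: "zphi list \<times> (nat \<times> nat \<times> zphi) list \<Rightarrow> real mat" where
  "graph_real G = wgraph (map (emb False) (fst G)) (map (\<lambda>(u, v, w). (u, v, emb False w)) (snd G))"

lemma graph_real_dim [simp]: "dim_row (graph_real G) = length (fst G)" "dim_col (graph_real G) = length (fst G)"
  by (simp_all add: graph_real_def wgraph_def)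

lemma graph_real_entry:
  assumes "i < length (fst G)" "j < length (fst G)"
  shows "graph_real G $$ (i,j) = emb False (weight (fst G) (snd G) i j)"
proof (cases "i = j")
  case True
  have "weight cs es j j = cs ! j" for cs :: "zphi list" and es by (cases "(cs, es, j, j)" rule: weight.cases) auto
  then show ?thesis using assms True by (simp add: graph_real_def wgraph_def)
next
  case False
  have "sum_list (map (\<lambda>(u, v, w). if u = i \<and> v = j \<or> u = j \<and> v = i then w else 0) (map (\<lambda>(u, v, w). (u, v, emb False w)) es))
    = emb False (sum_list (map (\<lambda>(u, v, w). if u = i \<and> v = j \<or> u = j \<and> v = i then w else 0) es))" for es
    by (induction es) auto
  then show ?thesis using assms False by (simp add: graph_real_def wgraph_def weight_offdiag)
qed

lemma graphs_are_listed: "graph_real ` set graphs = {S3, S4_1, S4_2, S4_3, S6, S8_dagdag, S8_ddag}"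
proof -
  \<comment> \<open>\<open>ZP 1 (-1)\<close> embeds as \<open>1 - phi\<close>, so the listed graphs
    are brought to this form.\<close>
  have pb: "phibar = 1 - phi" by (simp add: phi_def phibar_def)
  show ?thesis
    by (simp add: graphs_def graph_real_def S3_def S4_1_def S4_2_def S4_3_def S6_def S8_dagdag_def S8_ddag_def pb)
qed

lemma graph_square:
  assumes G: "G \<in> set graphs" and ij: "i < length (fst G)" "j < length (fst G)"
  shows "(\<Sum>k<length (fst G). emb c (weight (fst G) (snd G) i k) * emb c (weight (fst G) (snd G) k j)) = (if i = j then 4 else 0)"
proof -
  let ?m = "length (fst G)" and ?w = "weight (fst G) (snd G)"
  have gm: "graph_mat G = map (\<lambda>i. map (?w i) [0..<?m]) [0..<?m]" by (simp add: graph_mat_def case_prod_beta)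
  have "dot (graph_mat G ! i) (graph_mat G ! j) = (if i = j then ZP 4 0 else ZP 0 0)"
  proof -
    have "length (graph_mat G) = ?m" by (simp add: gm)
    then show ?thesis using graphs_square G ij by (simp add: list_all_iff squares_to_four_def)
  qed
  then have "emb c (dot (graph_mat G ! i) (graph_mat G ! j)) = (if i = j then 4 else 0)" by simp
  moreover have "emb c (dot (graph_mat G ! i) (graph_mat G ! j)) = (\<Sum>k<?m. emb c (?w i k) * emb c (?w j k))"
    using ij by (subst emb_dot) (simp_all add: gm)
  moreover have "?w j k = ?w k j" for k by (rule weight_sym)
  ultimately show ?thesis by simp
qed

lemma graph_connected:
  assumes G: "G \<in> set graphs" and i: "i < length (fst G)"
  shows "(\<lambda>u v. u < length (fst G) \<and> v < length (fst G) \<and> u \<noteq> v \<and> weight (fst G) (snd G) u v \<noteq> 0)\<^sup>*\<^sup>* 0 i"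
  using i
proof (induction i rule: less_induct)
  case (less i)
  show ?case
  proof (cases "i = 0")
    case False
    then have "i \<in> set [1..<length (fst G)]" using less.prems by simp
    moreover have "\<forall>i\<in>set [1..<length (fst G)]. \<exists>j\<in>set [0..<i]. weight (fst G) (snd G) j i \<noteq> ZP 0 0"
      using graphs_connected G unfolding list_all_iff list_ex_iff by (rule bspec)
    ultimately have "\<exists>j\<in>set [0..<i]. weight (fst G) (snd G) j i \<noteq> ZP 0 0" by blast
    then have "\<exists>j<i. weight (fst G) (snd G) j i \<noteq> ZP 0 0" by auto
    then obtain j where j: "j < i" "weight (fst G) (snd G) j i \<noteq> 0" by (auto simp: zero_zphi_def)
    then show ?thesis using less by (intro rtranclp.rtrancl_into_rtrancl[OF less.IH[OF j(1)]]) auto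
  qed simp
qed

section \<open>From cells to completions of irrational matrices\<close>

lemma irrational_embedding:
  assumes A: "matrix_over Zphi A" "indecomposable A" "cyclotomic A" "\<not> matrix_over Zring A" and n: "n = dim_row A"
  obtains G cj ng s f where "G \<in> set graphs" "inj_on f {..<n}" "f ` {..<n} \<subseteq> {..<length (fst G)}"
    "\<And>i j. i < n \<Longrightarrow> j < n \<Longrightarrow> A $$ (i,j) =
       sgn_of ng * sgn_of (s i) * sgn_of (s j) * emb cj (weight (fst G) (snd G) (f i) (f j))"
proof -
  obtain Z where sym: "\<And>i j. Z i j = Z j i" and AZ: "A = mat n n (\<lambda>(i,j). emb False (Z i j))"
    and con: "\<And>c. contractive {..<n} (\<lambda>i j. emb c (Z i j))"
    using cyclotomic_contractive[OF A(1,3) n] by blast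
  obtain v w where vw: "v < n" "w < n" "emb False (Z v w) \<notin> Zring"
    using A(4) unfolding AZ matrix_over_def by auto
  have irr: "\<nexists>k. Z v w = ZP k 0" using vw(3) by (auto simp: Zring_def)
  have conn: "\<exists>i\<in>X. \<exists>j\<in>{..<n} - X. Z i j \<noteq> 0" if X: "X \<noteq> {}" "X \<subseteq> {..<n}" "X \<noteq> {..<n}" for X
  proof -
    obtain x y where "x \<in> X" "x < n" "y \<notin> X" "y < n" using X by auto
    then obtain i j where "i < n" "j < n" "i \<in> X" "j \<notin> X" "A $$ (i,j) \<noteq> 0"
      using indecomposable_neighbour[OF A(2) n] by blast
    then show ?thesis unfolding AZ by (intro bexI[of _ i] bexI[of _ j]) auto
  qed
  have "realized Z {..<n}"
    by (rule realized_all[where Z = Z, OF finite_lessThan con sym _ _ irr conn]) (use vw in auto)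
  then obtain cj ng ps where ps: "distinct (map fst ps)" "set (map fst ps) = {..<n}" "signed_minor cj ng ps Z \<in> set cell_mats"
    unfolding realized_def by blast
  obtain k vs where kv: "(k, vs) \<in> set cells"
    "signed_minor cj ng ps Z = map (\<lambda>i. map (\<lambda>j. graph_mat (graphs ! k) ! i ! j) vs) vs"
    using ps(3) by (auto simp: cell_mats_def)
  define G where "G = graphs ! k"
  have "(k, vs) \<in> set cells \<Longrightarrow> k < length graphs \<and> distinct vs \<and> (\<forall>v\<in>set vs. v < length (fst (graphs ! k)))"
    using cells_correct by (fastforce simp: list_all_iff)
  then have k: "G \<in> set graphs" "distinct vs" "\<And>v. v \<in> set vs \<Longrightarrow> v < length (fst G)"
    using kv(1) by (auto simp: G_def)
  let ?g = "\<lambda>t. fst (ps ! t)"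
  have lv: "length vs = length ps" using arg_cong[OF kv(2), of length] by simp
  have bij: "bij_betw ?g {..<length ps} {..<n}" using bij_betw_fst_nth[OF ps(1)] ps(2) by simp
  define h where "h = inv_into {..<length ps} ?g"
  have h: "h i < length ps" "?g (h i) = i" if "i < n" for i
  proof -
    have "i \<in> ?g ` {..<length ps}" using bij that by (simp add: bij_betw_def)
    then show "h i < length ps" "?g (h i) = i"
      unfolding h_def using inv_into_into[of i ?g "{..<length ps}"] f_inv_into_f[of i ?g "{..<length ps}"] by simp_all
  qed
  define f where "f i = vs ! h i" for i
  define s where "s i = snd (ps ! h i)" for i
  have fm: "f i < length (fst G)" if "i < n" for i using h[OF that] lv k(3) by (simp add: f_def)
  have "inj_on f {..<n}"
  proof (rule inj_onI)
    fix i j assume ij: "i \<in> {..<n}" "j \<in> {..<n}" "f i = f j"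
    then have "h i = h j" using h(1) lv k(2) by (simp add: f_def nth_eq_iff_index_eq)
    then show "i = j" using h(2) ij by (metis lessThan_iff)
  qed
  moreover have "A $$ (i,j) = sgn_of ng * sgn_of (s i) * sgn_of (s j) * emb cj (weight (fst G) (snd G) (f i) (f j))"
    if ij: "i < n" "j < n" for i j
  proof -
    have "emb cj (signed_minor cj ng ps Z ! h i ! h j) = sgn_of ng * sgn_of (s i) * sgn_of (s j) * emb (cj \<noteq> cj) (Z i j)"
      using emb_nth_signed_minor[OF h(1)[OF ij(1)] h(1)[OF ij(2)]] h(2) ij by (simp add: s_def)
    moreover have "signed_minor cj ng ps Z ! h i ! h j = weight (fst G) (snd G) (f i) (f j)"
      using h(1) ij lv fm[OF ij(1)] fm[OF ij(2)]
      by (simp add: kv(2) f_def graph_mat_def case_prod_beta flip: G_def)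
    moreover have "A $$ (i,j) = emb False (Z i j)" using ij by (simp add: AZ)
    \<comment> \<open>Conjugation and sign changes are involutions, so the data leading from
      \<open>Z\<close> to the cell also lead back.\<close>
    ultimately show ?thesis by (cases ng; cases "s i"; cases "s j") (simp_all add: sgn_of_def)
  qed
  moreover have "f ` {..<n} \<subseteq> {..<length (fst G)}" using fm by auto
  ultimately show ?thesis using that k(1) by blast
qed

lemma sgn_mult_Zphi: "sgn_of a * sgn_of b * sgn_of d * emb c z \<in> Zphi"
proof -
  have "sgn_of a * sgn_of b * sgn_of d * emb c z = emb False (twist c ((a \<noteq> b) \<noteq> d) z)"
    unfolding emb_twist sgn_of_simps(2) by simp
  then show ?thesis unfolding Zphi_eq_range by simp
qed

lemma signed_permutation_equivalent:
  assumes f: "bij_betw f {..<n} {..<n}" and A: "A \<in> carrier_mat n n" and S: "S \<in> carrier_mat n n"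
    and w: "\<And>k l. k < n \<Longrightarrow> l < n \<Longrightarrow> S $$ (k,l) = emb False (w k l)"
    and AS: "\<And>i j. i < n \<Longrightarrow> j < n \<Longrightarrow> A $$ (i,j) = sgn_of ng * sgn_of (s i) * sgn_of (s j) * emb cj (w (f i) (f j))"
  shows "equivalent A S"
proof -
  define Q where "Q = mat n n (\<lambda>(i,k). if k = f i then sgn_of (s i) else 0)"
  have fn: "f i < n" if "i < n" for i using f that by (auto simp: bij_betw_def)
  have fi: "f i = f j \<longleftrightarrow> i = j" if "i < n" "j < n" for i j
    using f that inj_on_eq_iff[of f "{..<n}" i j] by (simp add: bij_betw_def)
  have Q: "Q \<in> carrier_mat n n" by (simp add: Q_def)
  have QB: "(Q * B) $$ (i,k) = sgn_of (s i) * B $$ (f i,k)" if B: "B \<in> carrier_mat n n" and ik: "i < n" "k < n" for B i k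
  proof -
    have "(Q * B) $$ (i,k) = (\<Sum>l\<in>{0..<n}. (if l = f i then sgn_of (s i) else 0) * B $$ (l,k))"
      using B ik by (simp add: Q_def scalar_prod_def)
    also have "\<dots> = (\<Sum>l\<in>{0..<n}. if l = f i then sgn_of (s i) * B $$ (l,k) else 0)"
      by (intro sum.cong refl) simp
    also have "\<dots> = sgn_of (s i) * B $$ (f i,k)" using fn[OF ik(1)] by simp
    finally show ?thesis .
  qed
  have BQ: "(C * transpose_mat Q) $$ (i,j) = C $$ (i, f j) * sgn_of (s j)" if C: "C \<in> carrier_mat n n" and ij: "i < n" "j < n" for C i j
  proof -
    have "(C * transpose_mat Q) $$ (i,j) = (\<Sum>l\<in>{0..<n}. C $$ (i,l) * (if l = f j then sgn_of (s j) else 0))"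
      using C ij by (simp add: Q_def scalar_prod_def)
    also have "\<dots> = (\<Sum>l\<in>{0..<n}. if l = f j then C $$ (i,l) * sgn_of (s j) else 0)"
      by (intro sum.cong refl) simp
    also have "\<dots> = C $$ (i, f j) * sgn_of (s j)" using fn[OF ij(2)] by simp
    finally show ?thesis .
  qed
  have QBQ: "(Q * B * transpose_mat Q) $$ (i,j) = sgn_of (s i) * sgn_of (s j) * B $$ (f i, f j)"
    if "B \<in> carrier_mat n n" "i < n" "j < n" for B i j
    using BQ[of "Q * B" i j] QB[OF that(1,2) fn[OF that(3)]] that Q by simp
  have "Q * transpose_mat Q = 1\<^sub>m n"
  proof (rule eq_matI)
    fix i j assume "i < dim_row (1\<^sub>m n)" "j < dim_col (1\<^sub>m n)"
    then have ij: "i < n" "j < n" by simp_all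
    have "(Q * transpose_mat Q) $$ (i,j) = Q $$ (i, f j) * sgn_of (s j)" by (rule BQ[OF Q ij])
    also have "\<dots> = 1\<^sub>m n $$ (i,j)" using ij fn fi by (auto simp: Q_def sgn_of_simps)
    finally show "(Q * transpose_mat Q) $$ (i,j) = 1\<^sub>m n $$ (i,j)" .
  qed (simp_all add: Q_def)
  then have orth: "orth_int n Q" using Q unfolding orth_int_def by (auto simp: Q_def sgn_of_def)
  define B where "B = (if ng then - S else S)"
  have B: "B \<in> carrier_mat n n" using S by (simp add: B_def)
  define \<sigma> where "\<sigma> = (if cj then galconj else id)"
  have "A = map_mat \<sigma> (Q * B * transpose_mat Q)"
  proof (rule eq_matI)
    fix i j assume "i < dim_row (map_mat \<sigma> (Q * B * transpose_mat Q))" "j < dim_col (map_mat \<sigma> (Q * B * transpose_mat Q))"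
    then have ij: "i < n" "j < n" using Q by simp_all
    have "B $$ (f i, f j) = sgn_of ng * emb False (w (f i) (f j))"
      using fn ij S w by (simp add: B_def sgn_of_def)
    \<comment> \<open>All signs are absorbed into one ring element, because \<open>galconj\<close>
      is evaluated only on the image of \<open>emb False\<close>.\<close>
    then have "(Q * B * transpose_mat Q) $$ (i,j)
        = emb False (twist False ((ng \<noteq> s i) \<noteq> s j) (w (f i) (f j)))"
      unfolding QBQ[OF B ij] emb_twist sgn_of_simps(2) by simp
    then have "\<sigma> ((Q * B * transpose_mat Q) $$ (i,j)) = emb cj (twist False ((ng \<noteq> s i) \<noteq> s j) (w (f i) (f j)))"
      by (simp add: \<sigma>_def galconj_emb)
    also have "\<dots> = A $$ (i,j)" unfolding AS[OF ij] emb_twist sgn_of_simps(2) by simp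
    finally show "A $$ (i,j) = map_mat \<sigma> (Q * B * transpose_mat Q) $$ (i,j)" using Q ij by simp
  qed (use A Q in auto)
  then have "strongly_equivalent A B"
    unfolding strongly_equivalent_def using A B orth by (intro exI[of _ n] exI[of _ Q] exI[of _ \<sigma>]) (auto simp: \<sigma>_def)
  then show ?thesis by (auto simp: equivalent_def B_def split: if_splits)
qed

text \<open>The signs and the conjugation that place \<open>A\<close> in a graph are spread over the
  whole graph. The resulting square root of 4 contains \<open>A\<close> itself and not merely an
  equivalent matrix.\<close>

lemma irrational_completion:
  assumes A: "matrix_over Zphi A" "indecomposable A" "cyclotomic A" "\<not> matrix_over Zring A"
  obtains G B where "G \<in> set graphs" "maximal_indecomposable_cyclotomic Zphi B" "principal_submatrix A B"
    "dim_row B = dim_row A \<Longrightarrow> equivalent A (graph_real G)"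
proof -
  define n where "n = dim_row A"
  obtain G cj ng s f where G: "G \<in> set graphs" and f: "inj_on f {..<n}" "f ` {..<n} \<subseteq> {..<length (fst G)}"
    and AG: "\<And>i j. i < n \<Longrightarrow> j < n \<Longrightarrow> A $$ (i,j) =
       sgn_of ng * sgn_of (s i) * sgn_of (s j) * emb cj (weight (fst G) (snd G) (f i) (f j))"
    by (rule irrational_embedding[OF A n_def]) (rule that)
  define m where "m = length (fst G)"
  let ?w = "weight (fst G) (snd G)"
  have n0: "0 < n" and Ac: "A \<in> carrier_mat n n" using A(2) by (auto simp: indecomposable_def n_def)
  have fm: "f i < m" if "i < n" for i using f(2) that by (auto simp: m_def)
  have m0: "0 < m" using fm[OF n0] by simp
  \<comment> \<open>Off the image of \<open>f\<close> this is an unspecified truth value; either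
    sign there leaves the square equal to 4.\<close>
  define \<sigma> where "\<sigma> k = s (inv_into {..<n} f k)" for k
  have \<sigma>f: "\<sigma> (f i) = s i" if "i < n" for i using that f(1) by (simp add: \<sigma>_def)
  define B where "B = mat m m (\<lambda>(i,j). sgn_of ng * sgn_of (\<sigma> i) * sgn_of (\<sigma> j) * emb cj (?w i j))"
  have B: "B \<in> carrier_mat m m" by (simp add: B_def)
  have Bij: "B $$ (i,j) = sgn_of ng * sgn_of (\<sigma> i) * sgn_of (\<sigma> j) * emb cj (?w i j)" if "i < m" "j < m" for i j
    using that by (simp add: B_def)
  have Bsym: "B $$ (i,j) = B $$ (j,i)" if "i < m" "j < m" for i j
    using that by (simp add: Bij weight_sym[of _ _ i j])
  have BT: "B = transpose_mat B" using B Bsym by (intro eq_matI) auto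
  have BB: "B * B = 4 \<cdot>\<^sub>m 1\<^sub>m m"
  proof (rule eq_matI)
    fix i j assume "i < dim_row (4 \<cdot>\<^sub>m 1\<^sub>m m)" "j < dim_col (4 \<cdot>\<^sub>m 1\<^sub>m m)"
    then have ij: "i < m" "j < m" by simp_all
    have "(B * B) $$ (i,j) = (\<Sum>k<m. B $$ (i,k) * B $$ (k,j))"
      using B ij by (simp add: scalar_prod_def atLeast0LessThan)
    also have "\<dots> = (\<Sum>k<m. sgn_of (\<sigma> i) * sgn_of (\<sigma> j) * (emb cj (?w i k) * emb cj (?w k j)))"
    proof (intro sum.cong refl)
      fix k assume "k \<in> {..<m}"
      then have "B $$ (i,k) * B $$ (k,j) = (sgn_of ng * sgn_of ng) * (sgn_of (\<sigma> k) * sgn_of (\<sigma> k))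
          * (sgn_of (\<sigma> i) * sgn_of (\<sigma> j) * (emb cj (?w i k) * emb cj (?w k j)))"
        using ij by (simp add: Bij)
      then show "B $$ (i,k) * B $$ (k,j) = sgn_of (\<sigma> i) * sgn_of (\<sigma> j) * (emb cj (?w i k) * emb cj (?w k j))"
        by (simp add: sgn_of_simps(1))
    qed
    also have "\<dots> = sgn_of (\<sigma> i) * sgn_of (\<sigma> j) * (if i = j then 4 else 0)"
      unfolding sum_distrib_left[symmetric] using graph_square[OF G] ij unfolding m_def by simp
    also have "\<dots> = (4 \<cdot>\<^sub>m 1\<^sub>m m) $$ (i,j)" using ij by (simp add: sgn_of_simps(1))
    finally show "(B * B) $$ (i,j) = (4 \<cdot>\<^sub>m 1\<^sub>m m) $$ (i,j)" .
  qed (use B in auto)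
  have Bover: "matrix_over Zphi B" unfolding matrix_over_def using B Bij sgn_mult_Zphi by auto
  have "(\<lambda>u v. u < m \<and> v < m \<and> u \<noteq> v \<and> B $$ (u,v) \<noteq> 0) = (\<lambda>u v. u < m \<and> v < m \<and> u \<noteq> v \<and> ?w u v \<noteq> 0)"
    by (intro ext) (auto simp: Bij)
  then have "indecomposable B"
    using graph_connected[OF G] unfolding m_def[symmetric]
    by (intro indecomposable_rooted[OF B Bsym m0]) simp_all
  then have "maximal_indecomposable_cyclotomic Zphi B" by (rule square_four_maximal[OF B BT BB Bover])
  moreover have "principal_submatrix A B"
    unfolding principal_submatrix_def
  proof (intro conjI exI[of _ f] allI impI)
    fix i j assume "i < dim_row A" "j < dim_row A"
    then have ij: "i < n" "j < n" by (simp_all add: n_def)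
    then show "A $$ (i,j) = B $$ (f i, f j)" using fm by (simp add: Bij AG \<sigma>f)
  next
    show "dim_row A = dim_col A" "dim_row B = dim_col B" using Ac B by simp_all
    show "inj_on f {..<dim_row A}" using f(1) unfolding n_def .
    show "f ` {..<dim_row A} \<subseteq> {..<dim_row B}" unfolding n_def[symmetric] using fm B by auto
  qed
  moreover have "equivalent A (graph_real G)" if "dim_row B = dim_row A"
  proof -
    have mn: "m = n" using that B by (simp add: n_def)
    have "f ` {..<n} = {..<n}" using f(1) fm mn by (intro card_subset_eq) (auto simp: card_image)
    then have bij: "bij_betw f {..<n} {..<n}" using f(1) by (simp add: bij_betw_def)
    have lG: "length (fst G) = n" using mn unfolding m_def .
    have Gc: "graph_real G \<in> carrier_mat n n" by (rule carrier_matI) (simp_all only: graph_real_dim lG)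
    show ?thesis
    proof (rule signed_permutation_equivalent[OF bij Ac Gc])
      show "graph_real G $$ (k,l) = emb False (?w k l)" if "k < n" "l < n" for k l
        using that by (intro graph_real_entry) (simp_all only: lG)
    qed (rule AG)
  qed
  ultimately show ?thesis using G by (intro that)
qed

theorem theorem6:
  shows "(\<forall>A. maximal_indecomposable_cyclotomic Zphi A \<and> \<not> matrix_over Zring A \<longrightarrow>
            (\<exists>B \<in> {S3, S4_1, S4_2, S4_3, S6, S8_dagdag, S8_ddag}. equivalent A B))
       \<and> (\<forall>A. matrix_over Zphi A \<and> indecomposable A \<and> cyclotomic A \<longrightarrow>
            (\<exists>B. maximal_indecomposable_cyclotomic Zphi B \<and> principal_submatrix A B))"
proof (intro conjI allI impI)
  fix A assume A: "maximal_indecomposable_cyclotomic Zphi A \<and> \<not> matrix_over Zring A"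
  then have AZ: "matrix_over Zphi A" "indecomposable A" "cyclotomic A" "\<not> matrix_over Zring A"
    by (auto simp: maximal_indecomposable_cyclotomic_def)
  obtain G B where G: "G \<in> set graphs" and B: "maximal_indecomposable_cyclotomic Zphi B" "principal_submatrix A B"
    and eq: "dim_row B = dim_row A \<Longrightarrow> equivalent A (graph_real G)"
    by (rule irrational_completion[OF AZ]) (rule that)

  \<comment> \<open>Maximality of \<open>A\<close> excludes a larger \<open>B\<close>, and equal
    sizes make the embedding into the graph a relabelling of all its vertices.\<close>
  have "\<not> dim_row A < dim_row B"
    using A B unfolding maximal_indecomposable_cyclotomic_def proper_principal_submatrix_def by blast
  moreover have "dim_row A \<le> dim_row B"
  proof -
    obtain f where "inj_on f {..<dim_row A}" "f ` {..<dim_row A} \<subseteq> {..<dim_row B}"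
      using B(2) unfolding principal_submatrix_def by blast
    then show ?thesis using card_inj_on_le[of f "{..<dim_row A}" "{..<dim_row B}"] by simp
  qed
  ultimately have "equivalent A (graph_real G)" using eq by simp
  moreover have "graph_real G \<in> {S3, S4_1, S4_2, S4_3, S6, S8_dagdag, S8_ddag}"
    unfolding graphs_are_listed[symmetric] using G by simp
  ultimately show "\<exists>B\<in>{S3, S4_1, S4_2, S4_3, S6, S8_dagdag, S8_ddag}. equivalent A B" by blast
next
  fix A assume "matrix_over Zphi A \<and> indecomposable A \<and> cyclotomic A"
  then have A: "matrix_over Zphi A" "indecomposable A" "cyclotomic A" by simp_all
  show "\<exists>B. maximal_indecomposable_cyclotomic Zphi B \<and> principal_submatrix A B"
  proof (rule contained_in_maximal[OF A])
    fix B assume "matrix_over Zphi B" "indecomposable B" "cyclotomic B" "\<not> matrix_over Zring B"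
    then show "\<exists>C. maximal_indecomposable_cyclotomic Zphi C \<and> principal_submatrix B C"
      using irrational_completion[of B] by metis
  qed
qed

end
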